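(* Let $q$ be a $Q$-function such that $\sup_{t\in[T_0,T_1[}q(x,t)<\infty$ for each $x\in\mathbf{X}$. Then $\bar P$ is the minimal function in $\hat{\mathcal{P}}$ among functions $P\in\hat{\mathcal{P}}$ satisfying the following two properties: (a) for all $u\in[T_0,T_1[$, $x\in\mathbf{X}$, and $q$-bounded sets $B$, the function $P(u,x;t,B)$ satisfies $\lim_{t\to u+}P(u,x;t,B)=\mathbf{I}\{x\in B\}$ and is absolutely continuous in $t\in\,]u,s[$ for each $s\in\,]u,T_1[$; (b) for all $u\in[T_0,T_1[$, $x\in\mathbf{X}$, and $q$-bounded sets $B$, the function $P(u,x;t,B)$ satisfies Kolmogorov's forward equation $$\frac{\partial}{\partial t}P(u,x;t,B)=-\int_B q(y,t)P(u,x;t,dy)+\int_{\mathbf{X}}q(y,t,B\setminus\{y\})P(u,x;t,dy)$$ for almost every $t\in\,]u,T_1[$. Furthermore, if the transition function $\bar P$ is regular (that is, $\bar P(u,x;t,\mathbf{X})=1$ for all $u\in[T_0,T_1[$, $t\in\,]u,T_1[$, $x\in\mathbf{X}$), then $\bar P$ is the unique element of $\hat{\mathcal{P}}$ taking values in $[0,1]$ and satisfying properties (a) and (b).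
   Context: Intervals: $]a,b[$ and $[a,b[$ denote open and half-open intervals. $(\mathbf{X},\mathfrak{B}(\mathbf{X}))$ is a standard Borel space; $0\le T_0<T_1\le\infty$; measurability means Borel measurability. $Q$-function: a function $q(x,t,B)$, $x\in\mathbf{X}$, $t\in[T_0,T_1[$, $B\in\mathfrak{B}(\mathbf{X})$, such that (a) for all $x,t$, $q(x,t,\cdot)$ is a (finite) signed measure with $q(x,t,\mathbf{X})\le 0$ and $0\le q(x,t,B\setminus\{x\})<\infty$ for all $B$; (b) for each $B$, $q(x,t,B)$ is measurable in $(x,t)$. Standing assumption: $q$ is conservative, i.e. $q(x,t,\mathbf{X})=0$ for all $x,t$. Put $q(x,t):=-q(x,t,\{x\})$ and $q^+(x,t,B):=q(x,t,B\setminus\{x\})$. The function $\bar P$ (which under the hypothesis of the claim is known to be a transition function, i.e. $[0,1]$-valued, a measure in $B$, measurable in $(u,x,t)$, and satisfying the Chapman–Kolmogorov equation): for $x\in\mathbf{X}$, $u\in[T_0,T_1[$, $t\in\,]u,T_1[$, $B\in\mathfrak{B}(\mathbf{X})$, $\bar P^{(0)}(u,x;t,B):=\mathbf{I}\{x\in B\}e^{-\int_u^t q(x,s)ds}$, $\bar P^{(n)}(u,x;t,B):=\int_u^t\int_{\mathbf{X}}e^{-\int_u^w q(x,\theta)d\theta}\,\bar P^{(n-1)}(w,y;t,B)\,q^+(x,w,dy)\,dw$ for $n\ge1$, and $\bar P:=\sum_{n=0}^\infty\bar P^{(n)}$. $\hat{\mathcal{P}}$ is the family of real-valued functions $P(u,x;t,B)$,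 defined for all $u\in[T_0,T_1[$, $t\in\,]u,T_1[$, $x\in\mathbf{X}$, $B\in\mathfrak{B}(\mathbf{X})$, which are (non-negative, finite) measures on $(\mathbf{X},\mathfrak{B}(\mathbf{X}))$ for fixed $u,x,t$ and measurable in $t$ for fixed $u,x,B$. A set $B\in\mathfrak{B}(\mathbf{X})$ is called $q$-bounded if the function $q(x,t)$ is bounded on $B\times[T_0,T_1[$. A function $f$ is minimal in a family $\mathcal{A}$ of functions on a common set $E$ if $f\in\mathcal{A}$ and $f\le g$ pointwise on $E$ for every $g\in\mathcal{A}$; "the minimal function satisfying given properties" means the minimal element of the subfamily of functions with those properties (in particular it has them). A differential equation "holds" at a point if the derivative exists there and the equality holds between finite numbers (in particular the integrals are finite). *)

theory Defs
  imports "HOL-Analysis.Analysis"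
begin

definition standard_borel :: "'a measure \<Rightarrow> bool" where
  "standard_borel M \<longleftrightarrow>
     (\<exists>X. completely_metrizable_space X \<and> second_countable X \<and> topspace X = space M \<and>
          sets M = sigma_sets (topspace X) {U. openin X U})"

definition time_interval :: "real \<Rightarrow> ereal \<Rightarrow> real set" where
  "time_interval T0 T1 = {t. T0 \<le> t \<and> ereal t < T1}"

definition time_after :: "real \<Rightarrow> ereal \<Rightarrow> real set" where
  "time_after u T1 = {t. u < t \<and> ereal t < T1}"

text \<open>Finite signed measures; the library's \<open>countably_additive\<close> is for
  \<open>ennreal\<close>-valued set functions only.\<close>

definition finite_signed_measure :: "'a measure \<Rightarrow> ('a set \<Rightarrow> real) \<Rightarrow> bool" where
  "finite_signed_measure M \<mu> \<longleftrightarrow>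
     \<mu> {} = 0 \<and>
     (\<forall>A :: nat \<Rightarrow> 'a set. range A \<subseteq> sets M \<longrightarrow> disjoint_family A \<longrightarrow>
        (\<lambda>i. \<mu> (A i)) sums \<mu> (\<Union>i. A i))"

definition Q_function ::
    "'a measure \<Rightarrow> real \<Rightarrow> ereal \<Rightarrow> ('a \<Rightarrow> real \<Rightarrow> 'a set \<Rightarrow> real) \<Rightarrow> bool" where
  "Q_function M T0 T1 q \<longleftrightarrow>
     (\<forall>x\<in>space M. \<forall>t\<in>time_interval T0 T1.
        finite_signed_measure M (q x t) \<and> q x t (space M) \<le> 0 \<and>
        (\<forall>B\<in>sets M. 0 \<le> q x t (B - {x}))) \<and>
     (\<forall>B\<in>sets M. (\<lambda>(x, t). q x t B) \<in>
        borel_measurable (M \<Otimes>\<^sub>M restrict_space borel (time_interval T0 T1)))"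

definition conservative ::
    "'a measure \<Rightarrow> real \<Rightarrow> ereal \<Rightarrow> ('a \<Rightarrow> real \<Rightarrow> 'a set \<Rightarrow> real) \<Rightarrow> bool" where
  "conservative M T0 T1 q \<longleftrightarrow>
     (\<forall>x\<in>space M. \<forall>t\<in>time_interval T0 T1. q x t (space M) = 0)"

definition exit_rate :: "('a \<Rightarrow> real \<Rightarrow> 'a set \<Rightarrow> real) \<Rightarrow> 'a \<Rightarrow> real \<Rightarrow> real" where
  "exit_rate q x t = - q x t {x}"

definition jump_measure ::
    "'a measure \<Rightarrow> ('a \<Rightarrow> real \<Rightarrow> 'a set \<Rightarrow> real) \<Rightarrow> 'a \<Rightarrow> real \<Rightarrow> 'a measure" where
  "jump_measure M q x t = measure_of (space M) (sets M) (\<lambda>B. ennreal (q x t (B - {x})))"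

text \<open>Transition functions \<open>P u x t B\<close> are \<open>ennreal\<close>-valued, so that no value of the series
  below is lost; that values are finite is part of membership in \<open>P_hat\<close>.
  The integrals in the exponents are Bochner integrals, so \<open>P_bar\<close> is meaningful
  when \<open>exit_rate q x\<close> is integrable on the intervals \<open>[u, t]\<close>, in particular when it is
  bounded in time for each \<open>x\<close>.\<close>

type_synonym 'a transition = "real \<Rightarrow> 'a \<Rightarrow> real \<Rightarrow> 'a set \<Rightarrow> ennreal"

primrec P_bar_n ::
    "'a measure \<Rightarrow> ('a \<Rightarrow> real \<Rightarrow> 'a set \<Rightarrow> real) \<Rightarrow> nat \<Rightarrow> 'a transition" where
  "P_bar_n M q 0 u x t B =
     indicator B x * ennreal (exp (- (LBINT s:{u..t}. exit_rate q x s)))"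
| "P_bar_n M q (Suc n) u x t B =
     (\<integral>\<^sup>+w\<in>{u<..<t}.
        (\<integral>\<^sup>+y. ennreal (exp (- (LBINT s:{u..w}. exit_rate q x s))) * P_bar_n M q n w y t B
           \<partial>jump_measure M q x w) \<partial>lborel)"

definition P_bar :: "'a measure \<Rightarrow> ('a \<Rightarrow> real \<Rightarrow> 'a set \<Rightarrow> real) \<Rightarrow> 'a transition" where
  "P_bar M q u x t B = (\<Sum>n. P_bar_n M q n u x t B)"

definition P_hat :: "'a measure \<Rightarrow> real \<Rightarrow> ereal \<Rightarrow> 'a transition set" where
  "P_hat M T0 T1 = {P.
     (\<forall>u\<in>time_interval T0 T1. \<forall>x\<in>space M.
        (\<forall>t\<in>time_after u T1.
           measure_space (space M) (sets M) (P u x t) \<and> (\<forall>B\<in>sets M. P u x t B < \<infinity>)) \<and>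
        (\<forall>B\<in>sets M. (\<lambda>t. P u x t B) \<in> borel_measurable (restrict_space borel (time_after u T1))))}"

definition q_bounded ::
    "'a measure \<Rightarrow> real \<Rightarrow> ereal \<Rightarrow> ('a \<Rightarrow> real \<Rightarrow> 'a set \<Rightarrow> real) \<Rightarrow> 'a set \<Rightarrow> bool" where
  "q_bounded M T0 T1 q B \<longleftrightarrow>
     B \<in> sets M \<and> bounded ((\<lambda>(x, t). exit_rate q x t) ` (B \<times> time_interval T0 T1))"

text \<open>Absolute continuity of a real function on an interval \<open>I\<close>; a pair \<open>(a, b)\<close> in the
  finite set \<open>D\<close> stands for the interval with these endpoints. (The library's
  \<open>absolutely_continuous\<close> is the unrelated notion for measures.)\<close>

definition absolutely_continuous_on :: "real set \<Rightarrow> (real \<Rightarrow> real) \<Rightarrow> bool" where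
  "absolutely_continuous_on I f \<longleftrightarrow>
     (\<forall>\<epsilon>>0. \<exists>\<delta>>0. \<forall>D. finite D \<longrightarrow>
        (\<forall>(a, b)\<in>D. a < b \<and> {a..b} \<subseteq> I) \<longrightarrow>
        disjoint_family_on (\<lambda>(a, b). {a<..<b}) D \<longrightarrow>
        (\<Sum>(a, b)\<in>D. b - a) < \<delta> \<longrightarrow>
        (\<Sum>(a, b)\<in>D. \<bar>f b - f a\<bar>) < \<epsilon>)"

definition initial_ac_property ::
    "'a measure \<Rightarrow> real \<Rightarrow> ereal \<Rightarrow> ('a \<Rightarrow> real \<Rightarrow> 'a set \<Rightarrow> real) \<Rightarrow> 'a transition \<Rightarrow> bool" where
  "initial_ac_property M T0 T1 q P \<longleftrightarrow>
     (\<forall>u\<in>time_interval T0 T1. \<forall>x\<in>space M. \<forall>B. q_bounded M T0 T1 q B \<longrightarrow>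
        ((\<lambda>t. enn2real (P u x t B)) \<longlongrightarrow> indicator B x) (at_right u) \<and>
        (\<forall>s\<in>time_after u T1. absolutely_continuous_on {u<..<s} (\<lambda>t. enn2real (P u x t B))))"

definition forward_equation_at ::
    "'a measure \<Rightarrow> ('a \<Rightarrow> real \<Rightarrow> 'a set \<Rightarrow> real) \<Rightarrow> 'a transition \<Rightarrow>
     real \<Rightarrow> 'a \<Rightarrow> real \<Rightarrow> 'a set \<Rightarrow> bool" where
  "forward_equation_at M q P u x t B \<longleftrightarrow>
     (let N = measure_of (space M) (sets M) (P u x t) in
        set_integrable N B (\<lambda>y. exit_rate q y t) \<and>
        integrable N (\<lambda>y. q y t (B - {y})) \<and>
        ((\<lambda>r. enn2real (P u x r B)) has_real_derivative
           - (LINT y:B|N. exit_rate q y t) + (LINT y|N. q y t (B - {y}))) (at t))"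

definition forward_equation_property ::
    "'a measure \<Rightarrow> real \<Rightarrow> ereal \<Rightarrow> ('a \<Rightarrow> real \<Rightarrow> 'a set \<Rightarrow> real) \<Rightarrow> 'a transition \<Rightarrow> bool" where
  "forward_equation_property M T0 T1 q P \<longleftrightarrow>
     (\<forall>u\<in>time_interval T0 T1. \<forall>x\<in>space M. \<forall>B. q_bounded M T0 T1 q B \<longrightarrow>
        (AE t in lborel. t \<in> time_after u T1 \<longrightarrow> forward_equation_at M q P u x t B))"

text \<open>Transition functions are only considered on their domain; values elsewhere are arbitrary,
  so order and equality are those of the restrictions.\<close>

definition transition_le ::
    "'a measure \<Rightarrow> real \<Rightarrow> ereal \<Rightarrow> 'a transition \<Rightarrow> 'a transition \<Rightarrow> bool" where
  "transition_le M T0 T1 P P' \<longleftrightarrow>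
     (\<forall>u\<in>time_interval T0 T1. \<forall>x\<in>space M. \<forall>t\<in>time_after u T1. \<forall>B\<in>sets M.
        P u x t B \<le> P' u x t B)"

definition transition_eq ::
    "'a measure \<Rightarrow> real \<Rightarrow> ereal \<Rightarrow> 'a transition \<Rightarrow> 'a transition \<Rightarrow> bool" where
  "transition_eq M T0 T1 P P' \<longleftrightarrow>
     (\<forall>u\<in>time_interval T0 T1. \<forall>x\<in>space M. \<forall>t\<in>time_after u T1. \<forall>B\<in>sets M.
        P u x t B = P' u x t B)"

definition minimal_transition ::
    "'a measure \<Rightarrow> real \<Rightarrow> ereal \<Rightarrow> 'a transition set \<Rightarrow> 'a transition \<Rightarrow> bool" where
  "minimal_transition M T0 T1 \<A> P \<longleftrightarrow> P \<in> \<A> \<and> (\<forall>P'\<in>\<A>. transition_le M T0 T1 P P')"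

definition unique_transition ::
    "'a measure \<Rightarrow> real \<Rightarrow> ereal \<Rightarrow> 'a transition set \<Rightarrow> 'a transition \<Rightarrow> bool" where
  "unique_transition M T0 T1 \<A> P \<longleftrightarrow> P \<in> \<A> \<and> (\<forall>P'\<in>\<A>. transition_eq M T0 T1 P' P)"

definition regular_transition :: "'a measure \<Rightarrow> real \<Rightarrow> ereal \<Rightarrow> 'a transition \<Rightarrow> bool" where
  "regular_transition M T0 T1 P \<longleftrightarrow>
     (\<forall>u\<in>time_interval T0 T1. \<forall>x\<in>space M. \<forall>t\<in>time_after u T1. P u x t (space M) = 1)"

end

theory Submission
  imports Defs
begin

text \<open>
  Splitting a trajectory at its last jump instead of its first one turns the backward recursion that
  defines \<open>P_bar\<close> into a forward recursion. Hence \<open>P_bar\<close> satisfies, with all terms nonnegative,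
  \[ P_t(B) = 1_B(x) e^{-\int_u^t q(x,s) ds}
      + \int_u^t \int\int_B e^{-\int_v^t q(z,s) ds} q^+(y,v,dz) P_v(dy) dv, \]
  and it is the least solution, being the sum of the iterates. By Tonelli's theorem and the identity
  \<open>\<integral> q(x,s) exp (- \<integral> q(x,\<theta>) d\<theta>) ds = 1 - exp (- \<integral> q(x,\<theta>) d\<theta>)\<close>, this equation is, on
  \<open>q\<close>-bounded sets, equivalent to Kolmogorov's forward equation integrated over time; the latter
  corresponds to properties (a) and (b) by Lebesgue's differentiation theorem in one direction and by
  the fundamental theorem of calculus for absolutely continuous functions in the other.

  The comparison on \<open>q\<close>-bounded sets extends to all measurable sets because \<open>q\<close>-bounded sets exhaust
  the space up to null sets of any finite measure. This is not immediate, since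
  \<open>{x. \<forall>t. q(x,t) \<le> n}\<close> is only the complement of a measurable projection; it follows from Choquet's
  capacitability theorem. If \<open>P_bar\<close> is regular, uniqueness follows by comparing complements.
\<close>

section \<open>Absolute continuity and differentiation of integrals\<close>

text \<open>A competitor in \<open>P_hat\<close> is, for fixed \<open>u\<close> and
  \<open>x\<close>, merely a measurable curve of finite measures in \<open>t\<close>. Nothing
  relates its values for different \<open>u\<close> or \<open>x\<close>, and no Chapman-Kolmogorov
  equation is available. The backward recursion moves the starting point and so cannot be applied to
  it; a recursion that keeps \<open>u\<close> and \<open>x\<close> fixed is needed, and splitting at
  the last jump provides one. The forward equation holds off a null set of times that depends on
  \<open>B\<close>, so at a given time it is not an equation between measures. Integrated over time
  it holds for every \<open>t\<close> and every measurable subset of a \<open>q\<close>-bounded set,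
  and can then be extended from sets to functions. The classical passage to the last-jump form uses
  an integrating factor and differentiates integrals of time-dependent functions against
  \<open>P\<close>; weighting the integrated equation and applying Tonelli avoids this. Equations
  are written in \<open>ennreal\<close> with nonnegative terms on both sides. Cancelling needs
  finite terms, which boundedness of the rate on the set supplies.\<close>

lemma absolutely_continuous_on_subset:
  assumes "absolutely_continuous_on I f" "J \<subseteq> I"
  shows "absolutely_continuous_on J f"
  unfolding absolutely_continuous_on_def
proof (intro allI impI)
  fix e :: real assume "e > 0"
  then obtain d where "d > 0" and d: "\<And>D. finite D \<Longrightarrow> (\<forall>(a, b)\<in>D. a < b \<and> {a..b} \<subseteq> I) \<Longrightarrow>
      disjoint_family_on (\<lambda>(a, b). {a<..<b}) D \<Longrightarrow> (\<Sum>(a, b)\<in>D. b - a) < d \<Longrightarrow>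
      (\<Sum>(a, b)\<in>D. \<bar>f b - f a\<bar>) < e"
    using assms(1) unfolding absolutely_continuous_on_def by blast
  show "\<exists>\<delta>>0. \<forall>D. finite D \<longrightarrow> (\<forall>(a, b)\<in>D. a < b \<and> {a..b} \<subseteq> J) \<longrightarrow>
      disjoint_family_on (\<lambda>(a, b). {a<..<b}) D \<longrightarrow> (\<Sum>(a, b)\<in>D. b - a) < \<delta> \<longrightarrow>
      (\<Sum>(a, b)\<in>D. \<bar>f b - f a\<bar>) < e"
    using \<open>d > 0\<close> assms(2) by (intro exI[of _ d] conjI allI impI d) (auto, force)
qed

text \<open>The form \<open>c + f t - g t\<close> is that of the integrated forward equation: an
  initial indicator, plus accumulated entrances, minus accumulated exits.\<close>

lemma absolutely_continuous_on_diff: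
  assumes f: "absolutely_continuous_on I f" and g: "absolutely_continuous_on I g"
    and h: "\<And>t. t \<in> I \<Longrightarrow> h t = c + f t - g t"
  shows "absolutely_continuous_on I h"
  unfolding absolutely_continuous_on_def
proof (intro allI impI)
  fix e :: real assume "e > 0"
  have "\<exists>d>0. \<forall>D. finite D \<longrightarrow> (\<forall>(a, b)\<in>D. a < b \<and> {a..b} \<subseteq> I) \<longrightarrow>
      disjoint_family_on (\<lambda>(a, b). {a<..<b}) D \<longrightarrow> (\<Sum>(a, b)\<in>D. b - a) < d \<longrightarrow>
      (\<Sum>(a, b)\<in>D. \<bar>k b - k a\<bar>) < e / 2" if "absolutely_continuous_on I k" for k
    using that[unfolded absolutely_continuous_on_def, rule_format, of "e / 2"] \<open>e > 0\<close> by simp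
  from this[OF f] this[OF g] obtain d1 d2 where
    d1: "d1 > 0 \<and> (\<forall>D. finite D \<longrightarrow> (\<forall>(a, b)\<in>D. a < b \<and> {a..b} \<subseteq> I) \<longrightarrow>
      disjoint_family_on (\<lambda>(a, b). {a<..<b}) D \<longrightarrow> (\<Sum>(a, b)\<in>D. b - a) < d1 \<longrightarrow>
      (\<Sum>(a, b)\<in>D. \<bar>f b - f a\<bar>) < e / 2)" and
    d2: "d2 > 0 \<and> (\<forall>D. finite D \<longrightarrow> (\<forall>(a, b)\<in>D. a < b \<and> {a..b} \<subseteq> I) \<longrightarrow>
      disjoint_family_on (\<lambda>(a, b). {a<..<b}) D \<longrightarrow> (\<Sum>(a, b)\<in>D. b - a) < d2 \<longrightarrow>
      (\<Sum>(a, b)\<in>D. \<bar>g b - g a\<bar>) < e / 2)" by auto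
  have "(\<Sum>(a, b)\<in>D. \<bar>h b - h a\<bar>) < e"
    if D: "finite D" "\<forall>(a, b)\<in>D. a < b \<and> {a..b} \<subseteq> I" "disjoint_family_on (\<lambda>(a, b). {a<..<b}) D"
      "(\<Sum>(a, b)\<in>D. b - a) < min d1 d2" for D
  proof -
    have "(\<Sum>(a, b)\<in>D. \<bar>h b - h a\<bar>) \<le> (\<Sum>(a, b)\<in>D. \<bar>f b - f a\<bar> + \<bar>g b - g a\<bar>)"
    proof (rule sum_mono, clarify)
      fix a b assume "(a, b) \<in> D"
      then have "a < b" "{a..b} \<subseteq> I" using D(2) by auto
      then have "a \<in> I" "b \<in> I" by (simp_all add: subset_iff)
      then show "\<bar>h b - h a\<bar> \<le> \<bar>f b - f a\<bar> + \<bar>g b - g a\<bar>" by (simp add: h)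
    qed
    also have "\<dots> = (\<Sum>(a, b)\<in>D. \<bar>f b - f a\<bar>) + (\<Sum>(a, b)\<in>D. \<bar>g b - g a\<bar>)"
      by (simp add: sum.distrib case_prod_unfold)
    also have "\<dots> < e / 2 + e / 2"
      using D by (intro add_strict_mono conjunct2[OF d1, rule_format] conjunct2[OF d2, rule_format]) auto
    finally show ?thesis by simp
  qed
  then show "\<exists>\<delta>>0. \<forall>D. finite D \<longrightarrow> (\<forall>(a, b)\<in>D. a < b \<and> {a..b} \<subseteq> I) \<longrightarrow>
      disjoint_family_on (\<lambda>(a, b). {a<..<b}) D \<longrightarrow> (\<Sum>(a, b)\<in>D. b - a) < \<delta> \<longrightarrow>
      (\<Sum>(a, b)\<in>D. \<bar>h b - h a\<bar>) < e"
    using d1 d2 by (intro exI[of _ "min d1 d2"]) simp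
qed

lemma lipschitz_absolutely_continuous_on:
  assumes "\<And>a b. a < b \<Longrightarrow> {a..b} \<subseteq> I \<Longrightarrow> \<bar>f b - f a\<bar> \<le> L * (b - a)"
  shows "absolutely_continuous_on I f"
  unfolding absolutely_continuous_on_def
proof (intro allI impI)
  fix e :: real assume e: "e > 0"
  \<comment> \<open>\<open>L\<close> may be zero or negative; \<open>\<bar>L\<bar> + 1\<close> is a
    positive Lipschitz constant in every case.\<close>
  define d where "d = e / (\<bar>L\<bar> + 1)"
  have "(\<Sum>(a, b)\<in>D. \<bar>f b - f a\<bar>) < e"
    if D: "finite D" "\<forall>(a, b)\<in>D. a < b \<and> {a..b} \<subseteq> I" "(\<Sum>(a, b)\<in>D. b - a) < d" for D
  proof -
    have "\<bar>f b - f a\<bar> \<le> (\<bar>L\<bar> + 1) * (b - a)" if "(a,b) \<in> D" for a b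
    proof -
      have "a < b" "{a..b} \<subseteq> I" using D(2) that by auto
      then have "\<bar>f b - f a\<bar> \<le> L * (b - a)" by (rule assms)
      also have "\<dots> \<le> (\<bar>L\<bar> + 1) * (b - a)" using \<open>a < b\<close> by (intro mult_right_mono) auto
      finally show ?thesis .
    qed
    then have "(\<Sum>(a, b)\<in>D. \<bar>f b - f a\<bar>) \<le> (\<Sum>(a, b)\<in>D. (\<bar>L\<bar> + 1) * (b - a))"
      by (intro sum_mono) auto
    also have "\<dots> = (\<bar>L\<bar> + 1) * (\<Sum>(a, b)\<in>D. b - a)"
      by (simp add: sum_distrib_left case_prod_unfold)
    also have "\<dots> < (\<bar>L\<bar> + 1) * d"
      using D(3) by (intro mult_strict_left_mono) auto
    also have "\<dots> = e" unfolding d_def by (simp add: add_nonneg_eq_0_iff)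
    finally show ?thesis .
  qed
  moreover have "d > 0" using e by (simp add: d_def add_nonneg_pos)
  ultimately show "\<exists>\<delta>>0. \<forall>D. finite D \<longrightarrow> (\<forall>(a, b)\<in>D. a < b \<and> {a..b} \<subseteq> I) \<longrightarrow>
      disjoint_family_on (\<lambda>(a, b). {a<..<b}) D \<longrightarrow> (\<Sum>(a, b)\<in>D. b - a) < \<delta> \<longrightarrow>
      (\<Sum>(a, b)\<in>D. \<bar>f b - f a\<bar>) < e" by blast
qed

lemma absolutely_continuous_on_imp_continuous_on:
  assumes "absolutely_continuous_on I f" "\<And>a b. a \<in> I \<Longrightarrow> b \<in> I \<Longrightarrow> {a..b} \<subseteq> I"
  shows "continuous_on I f"
  unfolding continuous_on_iff
proof (intro ballI allI impI)
  fix x e :: real assume x: "x \<in> I" and "e > 0"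
  then obtain d where "d > 0" and d: "\<And>D. finite D \<Longrightarrow> (\<forall>(a, b)\<in>D. a < b \<and> {a..b} \<subseteq> I) \<Longrightarrow>
      disjoint_family_on (\<lambda>(a, b). {a<..<b}) D \<Longrightarrow> (\<Sum>(a, b)\<in>D. b - a) < d \<Longrightarrow>
      (\<Sum>(a, b)\<in>D. \<bar>f b - f a\<bar>) < e"
    using assms(1) unfolding absolutely_continuous_on_def by blast
  have *: "\<bar>f b - f a\<bar> < e" if "a \<in> I" "b \<in> I" "a < b" "b - a < d" for a b
    using d[of "{(a,b)}"] that assms(2)[of a b] by (auto simp: disjoint_family_on_def)
  have "dist (f y) (f x) < e" if "y \<in> I" "dist y x < d" for y
    using *[of x y] *[of y x] x that \<open>e > 0\<close>
    by (cases "x < y"; cases "x = y") (auto simp: dist_real_def abs_minus_commute)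
  then show "\<exists>d>0. \<forall>y\<in>I. dist y x < d \<longrightarrow> dist (f y) (f x) < e"
    using \<open>d > 0\<close> by blast
qed

text \<open>The gauge is chosen separately on and off \<open>N\<close>. Off \<open>N\<close> it
  comes from differentiability, so each Riemann term matches the increment of \<open>f\<close> up to
  a small multiple of the length. On \<open>N\<close> it confines intervals to an open set of small
  measure, where absolute continuity makes the total increment small. Integrability of
  \<open>g\<close> is thus part of the conclusion.\<close>

lemma absolutely_continuous_has_integral_derivative:
  fixes f g :: "real \<Rightarrow> real"
  assumes "a \<le> b" and ac: "absolutely_continuous_on {a..b} f" and N: "negligible N"
    and deriv: "\<And>t. t \<in> {a..b} \<Longrightarrow> t \<notin> N \<Longrightarrow> (f has_real_derivative g t) (at t within {a..b})"
  shows "(g has_integral f b - f a) {a..b}"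
proof -
  \<comment> \<open>With the value 0 on \<open>N\<close>, a term tagged in \<open>N\<close>
    contributes only the increment of \<open>f\<close>.\<close>
  define g' where "g' = (\<lambda>t. if t \<in> N then 0 else g t)"
  have "(g' has_integral f b - f a) {a..b}"
    unfolding has_integral_real
  proof (intro allI impI)
    fix e :: real assume "e > 0"
    \<comment> \<open>The \<open>+ 1\<close> keeps the quotient positive for \<open>a = b\<close>
      and makes \<open>e' * (b - a) < e / 2\<close> strict.\<close>
    define e' where "e' = e / (2 * (b - a + 1))"
    have e': "e' > 0" "e' * (b - a) < e / 2"
      using \<open>e > 0\<close> \<open>a \<le> b\<close> by (auto simp: e'_def field_simps)
    have "\<exists>d>0. x \<in> {a..b} - N \<longrightarrow>
         (\<forall>y\<in>{a..b}. norm (y-x) < d \<longrightarrow> norm (f y - f x - (y-x) * g x) \<le> e' * norm (y-x))" for x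
    proof (cases "x \<in> {a..b} - N")
      case True
      then have "(f has_derivative (*) (g x)) (at x within {a..b})"
        using deriv[of x] by (simp add: has_field_derivative_def)
      then show ?thesis
        using e'(1) unfolding has_derivative_within_alt by (simp add: mult.commute) blast
    next
      case False
      then show ?thesis by (intro exI[of _ 1]) auto
    qed
    then obtain d where d0: "\<forall>x. 0 < d x \<and> (x \<in> {a..b} - N \<longrightarrow>
         (\<forall>y\<in>{a..b}. norm (y-x) < d x \<longrightarrow> norm (f y - f x - (y-x) * g x) \<le> e' * norm (y-x)))"
      using choice[of "\<lambda>x d. 0 < d \<and> (x \<in> {a..b} - N \<longrightarrow>
         (\<forall>y\<in>{a..b}. norm (y-x) < d \<longrightarrow> norm (f y - f x - (y-x) * g x) \<le> e' * norm (y-x)))"] by auto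
    have d1: "0 < d x" for x using spec[OF d0, of x] by (rule conjunct1)
    have d2: "norm (f y - f x - (y-x) * g x) \<le> e' * norm (y-x)"
      if "x \<in> {a..b} - N" "y \<in> {a..b}" "norm (y-x) < d x" for x y
      using conjunct2[OF spec[OF d0, of x], THEN mp, OF that(1), rule_format, OF that(2) that(3)] .
    obtain \<delta> where "\<delta> > 0" and \<delta>: "\<And>D. finite D \<Longrightarrow> (\<forall>(a', b')\<in>D. a' < b' \<and> {a'..b'} \<subseteq> {a..b}) \<Longrightarrow>
      disjoint_family_on (\<lambda>(a, b). {a<..<b}) D \<Longrightarrow> (\<Sum>(a, b)\<in>D. b - a) < \<delta> \<Longrightarrow>
      (\<Sum>(a, b)\<in>D. \<bar>f b - f a\<bar>) < e / 2"
      using ac[unfolded absolutely_continuous_on_def, rule_format, of "e / 2"] \<open>e > 0\<close> by auto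
    \<comment> \<open>Outer regularity: the null set \<open>N\<close> lies in an open set whose
      measure is below the \<open>\<delta>\<close> of absolute continuity.\<close>
    obtain U where U: "open U" "N \<subseteq> U" "U \<in> lmeasurable" "measure lebesgue U < \<delta>"
    proof -
      obtain T where T: "open T" "N \<subseteq> T" "(T - N) \<in> lmeasurable" "emeasure lebesgue (T - N) < ennreal \<delta>"
        using sets_lebesgue_outer_open[OF negligible_imp_sets[OF N] \<open>\<delta> > 0\<close>] .
      have Nn: "N \<in> null_sets lebesgue" using N by (simp add: negligible_iff_null_sets)
      have "T \<in> sets lebesgue" using T(1) by (metis borel_open sets_completionI_sets sets_lborel)
      then have em: "emeasure lebesgue T = emeasure lebesgue (T - N)"
        using Nn by (simp add: emeasure_Diff_null_set)
      have "T \<in> lmeasurable"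
        using T(4) \<open>T \<in> sets lebesgue\<close> order.strict_trans[OF T(4) ennreal_less_top]
        unfolding em[symmetric] by (intro fmeasurableI) (auto simp: infinity_ennreal_def)
      moreover have "measure lebesgue T < \<delta>"
        using T(4) unfolding em[symmetric] using \<open>\<delta> > 0\<close>
        by (metis calculation emeasure_eq_measure2 ennreal_less_iff measure_nonneg)
      ultimately show ?thesis using that T by blast
    qed
    have "\<exists>r>0. x \<in> U \<longrightarrow> ball x r \<subseteq> U" for x
      using U(1) by (cases "x \<in> U") (auto simp: open_contains_ball intro: exI[of _ 1])
    then obtain r where r0: "\<forall>x. 0 < r x \<and> (x \<in> U \<longrightarrow> ball x (r x) \<subseteq> U)"
      using choice[of "\<lambda>x r. 0 < r \<and> (x \<in> U \<longrightarrow> ball x r \<subseteq> U)"] by auto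
    have r: "0 < r x" "x \<in> U \<Longrightarrow> ball x (r x) \<subseteq> U" for x
      using spec[OF r0, of x] by auto
    \<comment> \<open>Radius \<open>d x\<close> serves the tags off \<open>N\<close>; radius
      \<open>r x\<close> keeps intervals tagged in \<open>N\<close> inside \<open>U\<close>.\<close>
    define \<gamma> where "\<gamma> = (\<lambda>x. ball x (min (d x) (r x)))"
    have "gauge \<gamma>" unfolding \<gamma>_def using d1 r(1) by (intro gauge_ball_dependent) auto
    moreover have "norm ((\<Sum>(x, K)\<in>p. measure lborel K *\<^sub>R g' x) - (f b - f a)) < e"
      if p: "p tagged_division_of {a..b}" "\<gamma> fine p" for p
    proof -
      have ba: "b - a = (\<Sum>(x,K)\<in>p. Sup K - Inf K)" "f b - f a = (\<Sum>(x,K)\<in>p. f(Sup K) - f(Inf K))"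
        using additive_tagged_division_1[where f= "\<lambda>x. x"] additive_tagged_division_1[where f= f]
            \<open>a \<le> b\<close> p(1) by auto
      have fin: "finite p" using p(1) by blast
      have K: "\<exists>u v. K = {u..v} \<and> u \<le> v \<and> x \<in> {u..v} \<and> {u..v} \<subseteq> {a..b} \<and> {u..v} \<subseteq> \<gamma> x"
        if xK: "(x, K) \<in> p" for x K
      proof -
        obtain u v where "K = cbox u v" "x \<in> K" "K \<subseteq> {a..b}"
          using tagged_division_ofD(2-4)[OF p(1) xK] by blast
        moreover have "K \<subseteq> \<gamma> x" using p(2) xK by (auto simp: fine_def)
        ultimately show ?thesis by (intro exI[of _ u] exI[of _ v]) auto
      qed
      \<comment> \<open>Degenerate intervals are dropped: they carry no increment, absolute
        continuity speaks of \<open>a < b\<close> only, and without \<open>Inf K < Sup K\<close>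
        distinct tagged intervals could share their endpoints, so that \<open>h\<close> would not be
        injective.\<close>
      define p1 where "p1 = {(x,K)\<in>p. x \<in> N \<and> Inf K < Sup K}"
      define h where "h = (\<lambda>(x::real,K::real set). (Inf K, Sup K))"
      define D where "D = h ` p1"
      have fin1: "finite p1" "p1 \<subseteq> p" unfolding p1_def using fin by (auto intro: finite_subset[of _ p])
      have disj: "{Inf K<..<Sup K} \<inter> {Inf K'<..<Sup K'} = {}"
        if "(x,K) \<in> p" "(x',K') \<in> p" "(x,K) \<noteq> (x',K')" for x K x' K'
      proof -
        have "interior K \<inter> interior K' = {}" using tagged_division_ofD(5)[OF p(1) that] .
        then show ?thesis using K[OF that(1)] K[OF that(2)] by (auto simp: interior_atLeastAtMost_real)
      qed
      have inj: "inj_on h p1"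
      proof (rule inj_onI, clarify)
        fix x K x' K' assume a: "(x,K) \<in> p1" "(x',K') \<in> p1" "h (x,K) = h (x',K')"
        show "x = x' \<and> K = K'"
        proof (rule ccontr)
          assume "\<not> ?thesis"
          then have "{Inf K<..<Sup K} \<inter> {Inf K'<..<Sup K'} = {}" using a disj p1_def by blast
          moreover have "Inf K < Sup K" "Inf K = Inf K'" "Sup K = Sup K'" using a by (auto simp: p1_def h_def)
          ultimately show False using dense by fastforce
        qed
      qed
      have disjD: "disjoint_family_on (\<lambda>(a, b). {a<..<b}) D"
        unfolding disjoint_family_on_def D_def h_def using disj fin1(2) by (fastforce split: prod.splits)
      have D2: "\<forall>(a', b')\<in>D. a' < b' \<and> {a'..b'} \<subseteq> {a..b}"
        unfolding D_def h_def using K by (fastforce simp: p1_def)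
      have D3: "(\<Union>(a', b')\<in>D. {a'<..<b'}) \<subseteq> U"
      proof -
        have "{Inf K<..<Sup K} \<subseteq> U" if "(x,K) \<in> p1" for x K
        proof -
          have "(x,K) \<in> p" "x \<in> U" using that U(2) by (auto simp: p1_def)
          then have "\<gamma> x \<subseteq> U" using r(2)[of x] by (auto simp: \<gamma>_def)
          then show ?thesis using K[OF \<open>(x,K) \<in> p\<close>] by fastforce
        qed
        then show ?thesis unfolding D_def h_def by fastforce
      qed
      have finD: "emeasure lebesgue (case z of (a,b) \<Rightarrow> {a<..<b}) \<noteq> \<infinity>" if "z \<in> D" for z
        using D2 that by (cases z) (force simp: infinity_ennreal_def)
      have "(\<Sum>(a, b)\<in>D. b - a) = (\<Sum>z\<in>D. measure lebesgue (case z of (a,b) \<Rightarrow> {a<..<b}))"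
        using D2 by (intro sum.cong) auto
      also have "\<dots> = measure lebesgue (\<Union>(a', b')\<in>D. {a'<..<b'})"
        using fin1(1) disjD finD by (intro measure_finite_Union[symmetric]) (auto simp: D_def split: prod.splits)
      also have "\<dots> \<le> measure lebesgue U"
        using D3 U(3) by (intro measure_mono_fmeasurable) (auto simp: D_def fin1 split: prod.splits intro!: sets.finite_UN)
      finally have "(\<Sum>(a, b)\<in>D. b - a) < \<delta>" using U(4) by simp
      then have bD: "(\<Sum>(a, b)\<in>D. \<bar>f b - f a\<bar>) < e / 2"
        using \<delta>[OF _ D2 disjD] fin1(1) by (simp add: D_def)
      have "norm ((\<Sum>(x, K)\<in>p. measure lborel K *\<^sub>R g' x) - (f b - f a))
          = norm (\<Sum>(x, K)\<in>p. measure lborel K *\<^sub>R g' x - (f (Sup K) - f (Inf K)))"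
        unfolding ba(2) by (simp add: sum_subtractf case_prod_unfold)
      also have "\<dots> \<le> (\<Sum>(x,K)\<in>p. e' * (Sup K - Inf K) + (if (x,K) \<in> p1 then \<bar>f (Sup K) - f (Inf K)\<bar> else 0))"
      proof (rule sum_norm_le, clarify)
        fix x K assume xK: "(x,K) \<in> p"
        from K[OF xK] obtain u v where uv: "K = {u..v}" "u \<le> v" "x \<in> {u..v}" "{u..v} \<subseteq> {a..b}" "{u..v} \<subseteq> \<gamma> x"
          by blast
        show "norm (measure lborel K *\<^sub>R g' x - (f (Sup K) - f (Inf K))) \<le>
          e' * (Sup K - Inf K) + (if (x,K) \<in> p1 then \<bar>f (Sup K) - f (Inf K)\<bar> else 0)"
        proof (cases "x \<in> N")
          case True
          have "u = v \<or> (x,K) \<in> p1" using True xK uv by (auto simp: p1_def)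
          then show ?thesis using True uv e' by (auto simp: g'_def abs_minus_commute)
        next
          case False
          have "u \<in> \<gamma> x" "v \<in> \<gamma> x" using uv by auto
          then have "norm (u - x) < d x" "norm (v - x) < d x" by (auto simp: \<gamma>_def dist_real_def)
          then have *: "norm (f u - f x - (u-x) * g x) \<le> e' * norm (u-x)" 
                    "norm (f v - f x - (v-x) * g x) \<le> e' * norm (v-x)"
            using False uv by (intro d2; force)+
          \<comment> \<open>Straddle estimate: the approximation at the tag \<open>x\<close> is used
            at both endpoints, whose distances to \<open>x\<close> add up to \<open>v - u\<close>
            because \<open>x\<close> lies between them.\<close>
          have "norm ((v - u) * g x - (f v - f u)) = norm ((f u - f x - (u-x) * g x) - (f v - f x - (v-x) * g x))"
            by (simp add: algebra_simps)
          also have "\<dots> \<le> e' * norm (u-x) + e' * norm (v-x)" by (rule order_trans[OF norm_triangle_ineq4 add_mono[OF *]])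
          also have "\<dots> = e' * (v - u)" using uv(3) by (simp add: algebra_simps)
          finally show ?thesis using uv False by (simp add: g'_def p1_def)
        qed
      qed
      also have "\<dots> = e' * (b - a) + (\<Sum>(x,K)\<in>p. if (x,K) \<in> p1 then \<bar>f (Sup K) - f (Inf K)\<bar> else 0)"
        unfolding ba(1) by (simp add: sum.distrib case_prod_unfold sum_distrib_left)
      also have "(\<Sum>(x,K)\<in>p. if (x,K) \<in> p1 then \<bar>f (Sup K) - f (Inf K)\<bar> else 0) = (\<Sum>(x,K)\<in>p1. \<bar>f (Sup K) - f (Inf K)\<bar>)"
        using fin fin1 by (intro sum.mono_neutral_cong_right) auto
      also have "\<dots> = (\<Sum>(a, b)\<in>D. \<bar>f b - f a\<bar>)"
        unfolding D_def by (subst sum.reindex[OF inj]) (auto simp: h_def intro!: sum.cong)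
      finally show ?thesis using bD e'(2) by simp
    qed
    ultimately show "\<exists>\<gamma>. gauge \<gamma> \<and> (\<forall>\<D>. \<D> tagged_division_of {a..b} \<and> \<gamma> fine \<D> \<longrightarrow>
        norm ((\<Sum>(x, k)\<in>\<D>. measure lborel k *\<^sub>R g' x) - (f b - f a)) < e)"
      by (intro exI[of _ \<gamma>]) simp
  qed
  then show ?thesis
    by (rule has_integral_spike[OF N, rotated]) (auto simp: g'_def)
qed

text \<open>Averages over intervals to the right of a point converge to the integrand almost
  everywhere. Applied to the reflected function this covers intervals to the left, and the two
  one-sided limits together give the derivative. Neither null set involves \<open>a\<close>, so one
  null set serves all starting points.\<close>

lemma indefinite_integral_has_derivative_ae:
  fixes g :: "real \<Rightarrow> real"
  assumes int: "\<And>a b. g integrable_on {a..b}"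
  shows "AE t in lborel. \<forall>a<t. ((\<lambda>s. integral {a..s} g) has_real_derivative g t) (at t)"
proof -
  have int': "(\<lambda>x. g (-x)) integrable_on {a..b}" for a b
    using int[of "-b" "-a"] Henstock_Kurzweil_Integration.integrable_reflect_real[where f=g and a="-b" and b="-a"] by simp
  obtain N1 where N1: "negligible N1" "\<And>x e. x \<notin> N1 \<Longrightarrow> 0 < e \<Longrightarrow>
      \<exists>d>0. \<forall>h. 0 < h \<and> h < d \<longrightarrow> norm (integral {x..x + h} g / h - g x) < e"
    using integrable_ccontinuous_explicit[of g] int by (auto simp: divide_inverse_commute)
  obtain N2 where N2: "negligible N2" "\<And>x e. x \<notin> N2 \<Longrightarrow> 0 < e \<Longrightarrow>
      \<exists>d>0. \<forall>h. 0 < h \<and> h < d \<longrightarrow> norm (integral {x..x + h} (\<lambda>x. g (-x)) / h - g (-x)) < e"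
    using integrable_ccontinuous_explicit[of "\<lambda>x. g (-x)"] int' by (auto simp: divide_inverse_commute)
  have "AE t in lebesgue. t \<notin> N1" "AE t in lebesgue. t \<notin> N2"
    using N1(1) N2(1) by (auto simp: negligible_iff_null_sets intro: AE_not_in)
  then have ae1: "AE t in lborel. t \<notin> N1" and "AE t in lborel. t \<notin> N2"
    by (auto dest: AE_completion_iff[THEN iffD1])
  \<comment> \<open>Lebesgue measure is invariant under \<open>uminus\<close>, so the exceptional
    set of the reflected function can be reflected back.\<close>
  then have "AE t in distr lborel borel uminus. t \<notin> N2"
    by (subst lborel_distr_uminus)
  then have ae2: "AE t in lborel. - t \<notin> N2"
    by (rule AE_distrD[rotated]) simp
  show ?thesis
    using ae1 ae2
  proof eventually_elim
    fix t assume t: "t \<notin> N1" "- t \<notin> N2"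
    show "\<forall>a<t. ((\<lambda>s. integral {a..s} g) has_real_derivative g t) (at t)"
    proof (intro allI impI)
      fix a assume "a < t"
      have r: "((\<lambda>s. (integral {a..s} g - integral {a..t} g) / (s - t)) \<longlongrightarrow> g t) (at_right t)"
      proof (rule tendstoI)
        fix e :: real assume "e > 0"
        then obtain d where d: "d > 0" "\<And>h. 0 < h \<Longrightarrow> h < d \<Longrightarrow> norm (integral {t..t + h} g / h - g t) < e"
          using N1(2)[OF t(1)] by blast
        have "dist ((integral {a..s} g - integral {a..t} g) / (s - t)) (g t) < e" if "t < s" "s < t + d" for s
        proof -
          have "integral {a..t} g + integral {t..s} g = integral {a..s} g"
            using that \<open>a < t\<close> int by (intro Henstock_Kurzweil_Integration.integral_combine) auto
          then have "integral {t..t + (s - t)} g = integral {a..s} g - integral {a..t} g" by (simp add: algebra_simps)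
          then show ?thesis using d(2)[of "s - t"] that by (simp add: dist_real_def)
        qed
        then show "\<forall>\<^sub>F s in at_right t. dist ((integral {a..s} g - integral {a..t} g) / (s - t)) (g t) < e"
          using d(1) unfolding eventually_at_right_field by (intro exI[of _ "t + d"]) auto
      qed
      have l: "((\<lambda>s. (integral {a..s} g - integral {a..t} g) / (s - t)) \<longlongrightarrow> g t) (at_left t)"
      proof (rule tendstoI)
        fix e :: real assume "e > 0"
        then obtain d where d: "d > 0" "\<And>h. 0 < h \<Longrightarrow> h < d \<Longrightarrow>
           norm (integral {-t..-t + h} (\<lambda>x. g (-x)) / h - g t) < e"
          using N2(2)[OF t(2)] by fastforce
        have "dist ((integral {a..s} g - integral {a..t} g) / (s - t)) (g t) < e"
          if "max a (t - d) < s" "s < t" for s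
        proof -
          have "integral {a..s} g + integral {s..t} g = integral {a..t} g"
            using that int by (intro Henstock_Kurzweil_Integration.integral_combine) auto
          moreover have "integral {-t..-t + (t - s)} (\<lambda>x. g (-x)) = integral {s..t} g"
            using Henstock_Kurzweil_Integration.integral_reflect_real[where f=g and a=s and b=t] by (simp add: algebra_simps)
          ultimately have "integral {-t..-t + (t - s)} (\<lambda>x. g (-x)) = - (integral {a..s} g - integral {a..t} g)"
            by linarith
          then have "(integral {a..s} g - integral {a..t} g) / (s - t) =
              integral {-t..-t + (t - s)} (\<lambda>x. g (-x)) / (t - s)"
            by (metis minus_diff_eq minus_divide_divide)
          then show ?thesis using d(2)[of "t - s"] that unfolding dist_real_def by auto
        qed
        then show "\<forall>\<^sub>F s in at_left t. dist ((integral {a..s} g - integral {a..t} g) / (s - t)) (g t) < e"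
          using d(1) \<open>a < t\<close> unfolding eventually_at_left_field by (intro exI[of _ "max a (t - d)"]) auto
      qed
      show "((\<lambda>s. integral {a..s} g) has_real_derivative g t) (at t)"
        unfolding has_field_derivative_iff using l r by (simp add: filterlim_split_at)
    qed
  qed
qed

section \<open>Measurable projection\<close>

text \<open>The paving for Choquet's theorem. The first factor carries only a sigma-algebra;
  compactness of the time factor is what makes projection to \<open>M\<close> commute with
  decreasing intersections.\<close>

inductive_set compact_rects :: "'a measure \<Rightarrow> real set \<Rightarrow> ('a \<times> real) set set"
  for M T where
  rect: "F \<in> sets M \<Longrightarrow> compact K \<Longrightarrow> K \<subseteq> T \<Longrightarrow> F \<times> K \<in> compact_rects M T"
| Un: "R \<in> compact_rects M T \<Longrightarrow> S \<in> compact_rects M T \<Longrightarrow> R \<union> S \<in> compact_rects M T"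

lemma compact_rects_subset: "R \<in> compact_rects M T \<Longrightarrow> R \<subseteq> space M \<times> T"
  by (induction rule: compact_rects.induct) (auto dest: sets.sets_into_space)

lemma compact_rects_Int:
  assumes "R \<in> compact_rects M T" "S \<in> compact_rects M T"
  shows "R \<inter> S \<in> compact_rects M T"
  using assms(1)
proof induction
  case (rect F K)
  show ?case using assms(2)
  proof induction
    case (rect F' K')
    have "(F \<times> K) \<inter> (F' \<times> K') = (F \<inter> F') \<times> (K \<inter> K')" by auto
    then show ?case using rect \<open>F \<in> sets M\<close> \<open>compact K\<close> \<open>K \<subseteq> T\<close>
      by (auto intro!: compact_rects.rect compact_Int)
  qed (auto simp: Int_Un_distrib intro: compact_rects.Un)
qed (auto simp: Int_Un_distrib2 intro: compact_rects.Un)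

lemma compact_rects_empty: "{} \<in> compact_rects M T"
  using compact_rects.rect[of "{}" M "{}" T] by simp

lemma compact_rects_UN:
  "finite I \<Longrightarrow> (\<And>i. i \<in> I \<Longrightarrow> R i \<in> compact_rects M T) \<Longrightarrow> (\<Union>i\<in>I. R i) \<in> compact_rects M T"
  by (induction I rule: finite_induct) (auto intro: compact_rects.Un compact_rects_empty)

lemma compact_rects_INT:
  "finite I \<Longrightarrow> I \<noteq> {} \<Longrightarrow> (\<And>i. i \<in> I \<Longrightarrow> R i \<in> compact_rects M T) \<Longrightarrow> (\<Inter>i\<in>I. R i) \<in> compact_rects M T"
  by (induction I rule: finite_ne_induct) (auto intro: compact_rects_Int)

lemma compact_rects_fst: "R \<in> compact_rects M T \<Longrightarrow> fst ` R \<in> sets M"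
  by (induction rule: compact_rects.induct) (auto simp: image_Un fst_image_times)

lemma compact_rects_section: "R \<in> compact_rects M T \<Longrightarrow> compact (Pair x -` R)"
proof (induction rule: compact_rects.induct)
  case (rect F K)
  have "Pair x -` (F \<times> K) = (if x \<in> F then K else {})" by auto
  then show ?case using rect by simp
qed (simp add: compact_Un)

text \<open>For a point \<open>x\<close> in all projections the time sections at \<open>x\<close>
  are nonempty, compact and decreasing, so by Cantor's intersection theorem they share a
  time.\<close>

lemma compact_rects_fst_INT:
  assumes R: "\<And>n. R n \<in> compact_rects M T" and dec: "decseq R"
  shows "(\<Inter>n. fst ` R n) = fst ` (\<Inter>n. R n)"
proof (intro antisym subsetI)
  fix x assume x: "x \<in> (\<Inter>n. fst ` R n)"
  have "\<Inter>(range (\<lambda>n. Pair x -` R n)) \<noteq> {}"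
  proof (rule compact_nest)
    show "Pair x -` R n \<noteq> {}" for n
      using INT_D[OF x UNIV_I, of n] by force
    show "Pair x -` R n \<subseteq> Pair x -` R m" if "m \<le> n" for m n
      using decseqD[OF dec that] by auto
  qed (rule compact_rects_section[OF R])
  then obtain t where "\<And>n. (x, t) \<in> R n" by auto
  then show "x \<in> fst ` (\<Inter>n. R n)" by (intro image_eqI[of _ _ "(x,t)"]) auto
qed auto

text \<open>The Souslin operation applied to \<open>compact_rects\<close>:
  \<open>map \<sigma> [0..<n]\<close> is the initial segment of length \<open>n\<close> of the
  branch \<open>\<sigma>\<close>. The case \<open>n = 0\<close> is included, so the set lies in
  \<open>R []\<close>. The scheme \<open>R\<close> need not decrease along branches.\<close>

definition compact_souslin :: "'a measure \<Rightarrow> real set \<Rightarrow> ('a \<times> real) set \<Rightarrow> bool" where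
  "compact_souslin M T A \<longleftrightarrow> (\<exists>R. (\<forall>xs. R xs \<in> compact_rects M T) \<and>
     A = {p. \<exists>\<sigma>::nat \<Rightarrow> nat. \<forall>n. p \<in> R (map \<sigma> [0..<n])})"

lemma compact_souslin_rect:
  assumes "R \<in> compact_rects M T" shows "compact_souslin M T R"
  unfolding compact_souslin_def using assms by (intro exI[of _ "\<lambda>_. R"]) auto

text \<open>The first entry of a branch selects the set \<open>A k\<close>, the rest is a branch for
  \<open>A k\<close>. The root imposes nothing beyond \<open>space M \<times> T\<close>, which is a
  compact rectangle since \<open>T\<close> is compact.\<close>

lemma compact_souslin_UN:
  fixes A :: "nat \<Rightarrow> _"
  assumes "compact T" and A: "\<And>k. compact_souslin M T (A k)"
  shows "compact_souslin M T (\<Union>k. A k)"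
proof -
  from A have "\<forall>k. \<exists>R. (\<forall>xs. R xs \<in> compact_rects M T) \<and>
     A k = {p. \<exists>\<sigma>::nat \<Rightarrow> nat. \<forall>n. p \<in> R (map \<sigma> [0..<n])}"
    unfolding compact_souslin_def by blast
  then obtain R where "\<forall>k. (\<forall>xs. R k xs \<in> compact_rects M T) \<and>
     A k = {p. \<exists>\<sigma>::nat \<Rightarrow> nat. \<forall>n. p \<in> R k (map \<sigma> [0..<n])}"
    by (rule choice[THEN exE])
  then have R: "R k xs \<in> compact_rects M T"
    "A k = {p. \<exists>\<sigma>::nat \<Rightarrow> nat. \<forall>n. p \<in> R k (map \<sigma> [0..<n])}" for k xs
    by simp_all
  define R' where "R' = (\<lambda>xs. case xs of [] \<Rightarrow> space M \<times> T | k # ys \<Rightarrow> R k ys)"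
  have R': "R' xs \<in> compact_rects M T" for xs
    unfolding R'_def using R(1) \<open>compact T\<close> by (auto split: list.split intro: compact_rects.rect)
  have step: "map \<sigma> [0..<Suc n] = \<sigma> 0 # map (\<lambda>i. \<sigma> (Suc i)) [0..<n]" for \<sigma> :: "nat \<Rightarrow> nat" and n
    by (simp add: upt_conv_Cons map_Suc_upt[symmetric] del: upt_Suc)
  have "(\<Union>k. A k) = {p. \<exists>\<sigma>::nat \<Rightarrow> nat. \<forall>n. p \<in> R' (map \<sigma> [0..<n])}"
  proof (intro antisym subsetI)
    fix p assume "p \<in> (\<Union>k. A k)"
    then obtain k \<sigma> where \<sigma>: "\<And>n. p \<in> R k (map \<sigma> [0..<n])" unfolding R(2) by auto
    define \<tau> where "\<tau> = (\<lambda>i. case i of 0 \<Rightarrow> k | Suc j \<Rightarrow> \<sigma> j)"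
    have "p \<in> R' (map \<tau> [0..<n])" for n
    proof (cases n)
      case 0
      have "p \<in> space M \<times> T" using \<sigma>[of 0] compact_rects_subset[OF R(1)[of k "[]"]] by auto
      then show ?thesis using 0 by (simp add: R'_def)
    next
      case (Suc m)
      then show ?thesis using \<sigma>[of m] by (simp only: step) (simp add: R'_def \<tau>_def)
    qed
    then show "p \<in> {p. \<exists>\<sigma>. \<forall>n. p \<in> R' (map \<sigma> [0..<n])}" by auto
  next
    fix p assume "p \<in> {p. \<exists>\<sigma>::nat \<Rightarrow> nat. \<forall>n. p \<in> R' (map \<sigma> [0..<n])}"
    then obtain \<tau> :: "nat \<Rightarrow> nat" where \<tau>: "\<And>n. p \<in> R' (map \<tau> [0..<n])" by auto
    have "p \<in> R (\<tau> 0) (map (\<lambda>i. \<tau> (Suc i)) [0..<n])" for n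
      using \<tau>[of "Suc n"] by (simp only: step) (simp add: R'_def)
    then show "p \<in> (\<Union>k. A k)" unfolding R(2) by auto
  qed
  then show ?thesis unfolding compact_souslin_def using R' by blast
qed

lemma compact_souslin_Un:
  assumes "compact T" "compact_souslin M T A" "compact_souslin M T B"
  shows "compact_souslin M T (A \<union> B)"
proof -
  have eq: "A \<union> B = (\<Union>k::nat. if k = 0 then A else B)" by (auto split: if_splits)
  show ?thesis unfolding eq using assms by (intro compact_souslin_UN) auto
qed

text \<open>Branches \<open>\<sigma> k\<close> for all \<open>A k\<close> are interleaved into a
  single branch \<open>\<tau>\<close> by the pairing \<open>prod_encode\<close>, so one existential
  quantifier replaces countably many.\<close>

lemma compact_souslin_INT:
  fixes A :: "nat \<Rightarrow> _"
  assumes A: "\<And>k. compact_souslin M T (A k)"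
  shows "compact_souslin M T (\<Inter>k. A k)"
proof -
  from A have "\<forall>k. \<exists>R. (\<forall>xs. R xs \<in> compact_rects M T) \<and>
     A k = {p. \<exists>\<sigma>::nat \<Rightarrow> nat. \<forall>n. p \<in> R (map \<sigma> [0..<n])}"
    unfolding compact_souslin_def by blast
  then obtain R where "\<forall>k. (\<forall>xs. R k xs \<in> compact_rects M T) \<and>
     A k = {p. \<exists>\<sigma>::nat \<Rightarrow> nat. \<forall>n. p \<in> R k (map \<sigma> [0..<n])}"
    by (rule choice[THEN exE])
  then have R: "R k xs \<in> compact_rects M T"
    "A k = {p. \<exists>\<sigma>::nat \<Rightarrow> nat. \<forall>n. p \<in> R k (map \<sigma> [0..<n])}" for k xs
    by simp_all
  \<comment> \<open>A sequence of length \<open>l\<close> can only test conditions whose entries it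
    already contains, hence the bound on \<open>prod_encode (k,i)\<close>. The bounds on
    \<open>k\<close> and \<open>m\<close> make \<open>I l\<close> finite, and the pair
    \<open>(0,0)\<close> makes it nonempty, so \<open>R'\<close> is a nonempty finite
    intersection.\<close>
  define I where "I = (\<lambda>l. {(k,m). k \<le> l \<and> m \<le> l \<and> (\<forall>i<m. prod_encode (k,i) < (l::nat))})"
  define R' where "R' = (\<lambda>xs. \<Inter>(k,m)\<in>I (length xs). R k (map (\<lambda>i. xs ! prod_encode (k,i)) [0..<m]))"
  have "finite (I l)" for l
    by (rule finite_subset[of _ "{..l} \<times> {..l}"]) (auto simp: I_def)
  moreover have "(0,0) \<in> I l" for l by (auto simp: I_def)
  ultimately have R': "R' xs \<in> compact_rects M T" for xs
    unfolding R'_def by (intro compact_rects_INT) (auto intro: R(1))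
  have key: "(\<forall>n. p \<in> R' (map \<tau> [0..<n])) \<longleftrightarrow> (\<forall>k m. p \<in> R k (map (\<lambda>i. \<tau> (prod_encode (k,i))) [0..<m]))" for p \<tau>
  proof (intro iffI allI)
    fix k m assume *: "\<forall>n. p \<in> R' (map \<tau> [0..<n])"
    \<comment> \<open>Large enough to exceed \<open>k\<close>, \<open>m\<close> and every code
      \<open>prod_encode (k,i)\<close> with \<open>i < m\<close>, so that the condition
      \<open>(k,m)\<close> is visible at length \<open>n\<close>.\<close>
    define n where "n = k + m + Suc (\<Sum>i<m. prod_encode (k,i))"
    have "prod_encode (k,i) < n" if "i < m" for i
      using member_le_sum[of i "{..<m}" "\<lambda>i. prod_encode (k,i)"] that by (simp add: n_def)
    then have "(k,m) \<in> I n" by (auto simp: I_def n_def)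
    then have "p \<in> R k (map (\<lambda>i. map \<tau> [0..<n] ! prod_encode (k,i)) [0..<m])"
      using spec[OF *, of n] unfolding R'_def by auto
    also have "map (\<lambda>i. map \<tau> [0..<n] ! prod_encode (k,i)) [0..<m] = map (\<lambda>i. \<tau> (prod_encode (k,i))) [0..<m]"
      using \<open>(k,m) \<in> I n\<close> by (auto simp: I_def)
    finally show "p \<in> R k (map (\<lambda>i. \<tau> (prod_encode (k,i))) [0..<m])" .
  next
    fix n assume *: "\<forall>k m. p \<in> R k (map (\<lambda>i. \<tau> (prod_encode (k,i))) [0..<m])"
    show "p \<in> R' (map \<tau> [0..<n])"
      unfolding R'_def
    proof clarify
      fix k m assume "(k, m) \<in> I (length (map \<tau> [0..<n]))"
      then have "map (\<lambda>i. map \<tau> [0..<n] ! prod_encode (k,i)) [0..<m] = map (\<lambda>i. \<tau> (prod_encode (k,i))) [0..<m]"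
        by (auto simp: I_def)
      then show "p \<in> R k (map (\<lambda>i. map \<tau> [0..<n] ! prod_encode (k, i)) [0..<m])" using * by (simp only:)
    qed
  qed
  have "(\<Inter>k. A k) = {p. \<exists>\<tau>::nat \<Rightarrow> nat. \<forall>n. p \<in> R' (map \<tau> [0..<n])}"
  proof (intro antisym subsetI)
    fix p assume p: "p \<in> (\<Inter>k. A k)"
    then have "\<forall>k. \<exists>\<sigma>. \<forall>n. p \<in> R k (map \<sigma> [0..<n])" unfolding R(2) by auto
    from choice[OF this] obtain \<sigma> where \<sigma>: "\<And>k n. p \<in> R k (map (\<sigma> k) [0..<n])" by auto
    define \<tau> where "\<tau> = (\<lambda>j. case prod_decode j of (k,i) \<Rightarrow> \<sigma> k i)"
    have "(\<lambda>i. \<tau> (prod_encode (k,i))) = \<sigma> k" for k by (auto simp: \<tau>_def)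
    then have "\<forall>n. p \<in> R' (map \<tau> [0..<n])" unfolding key using \<sigma> by simp
    then show "p \<in> {p. \<exists>\<tau>. \<forall>n. p \<in> R' (map \<tau> [0..<n])}" by auto
  next
    fix p assume "p \<in> {p. \<exists>\<tau>::nat \<Rightarrow> nat. \<forall>n. p \<in> R' (map \<tau> [0..<n])}"
    then show "p \<in> (\<Inter>k. A k)" unfolding key R(2) by auto
  qed
  then show ?thesis unfolding compact_souslin_def using R' by blast
qed

lemma compact_souslin_Int:
  assumes "compact_souslin M T A" "compact_souslin M T B"
  shows "compact_souslin M T (A \<inter> B)"
proof -
  have eq: "A \<inter> B = (\<Inter>k::nat. if k = 0 then A else B)" by (auto split: if_splits)
  show ?thesis unfolding eq using assms by (intro compact_souslin_INT) auto
qed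

text \<open>Souslin sets need not be closed under complement. The induction over the sigma-algebra
  therefore carries each set together with its complement: the complement case swaps the two halves,
  and the union case uses a countable union for one half and a countable intersection for the
  other.\<close>

lemma compact_souslin_times:
  assumes T: "compact T" and B: "B \<in> sets (borel :: real measure)"
  shows "compact_souslin M T (space M \<times> (B \<inter> T)) \<and> compact_souslin M T (space M \<times> (T - B))"
proof -
  have "B \<in> sigma_sets UNIV (range (\<lambda>a. {..a::real}))"
    using B by (simp add: borel_eq_atMost)
  then show ?thesis
  proof induction
    case (Basic B)
    then obtain a where a: "B = {..a}" by auto
    \<comment> \<open>The open half-line is exhausted by closed ones, whose traces on
      \<open>T\<close> are compact.\<close>
    have "T - B = (\<Union>n. T \<inter> {a + 1 / real (Suc n)..})"
    proof (intro antisym subsetI)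
      fix t assume t: "t \<in> T - B"
      then obtain n where "1 / real (Suc n) < t - a"
        using a nat_approx_posE[of "t - a"] by auto
      then show "t \<in> (\<Union>n. T \<inter> {a + 1 / real (Suc n)..})" using t by (auto intro!: exI[of _ n])
    next
      fix t assume "t \<in> (\<Union>n. T \<inter> {a + 1 / real (Suc n)..})"
      then obtain n where "t \<in> T" "a + 1 / real (Suc n) \<le> t" by auto
      moreover have "0 < 1 / real (Suc n)" by simp
      ultimately have "a < t" by linarith
      then show "t \<in> T - B" using \<open>t \<in> T\<close> unfolding a by simp
    qed
    then have eq: "space M \<times> (T - B) = (\<Union>n. space M \<times> (T \<inter> {a + 1 / real (Suc n)..}))" by auto
    have "compact_souslin M T (space M \<times> (T - B))"
      unfolding eq using T by (intro compact_souslin_UN compact_souslin_rect compact_rects.rect compact_Int_closed) auto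
    moreover have "compact_souslin M T (space M \<times> (B \<inter> T))"
      unfolding a using T by (intro compact_souslin_rect compact_rects.rect closed_Int_compact) auto
    ultimately show ?case by blast
  next
    case Empty
    show ?case using T by (auto intro!: compact_souslin_rect compact_rects_empty compact_rects.rect)
  next
    case (Compl B)
    moreover have "(UNIV - B) \<inter> T = T - B" "T - (UNIV - B) = B \<inter> T" by auto
    ultimately show ?case by simp
  next
    case (Union B)
    have eq: "space M \<times> ((\<Union>i. B i) \<inter> T) = (\<Union>i. space M \<times> (B i \<inter> T))"
      "space M \<times> (T - (\<Union>i. B i)) = (\<Inter>i. space M \<times> (T - B i))" by auto
    show ?case unfolding eq using Union T by (auto intro!: compact_souslin_UN compact_souslin_INT)
  qed
qed

text \<open>The same pairing with complements, now over the product sigma-algebra; the complement of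
  a rectangle is the union of a rectangle over \<open>space M - F\<close> and a strip over
  \<open>T - B\<close>.\<close>

lemma compact_souslin_measurable:
  assumes T: "compact T" and E: "E \<in> sets (M \<Otimes>\<^sub>M (borel :: real measure))"
  shows "compact_souslin M T (E \<inter> space M \<times> T) \<and> compact_souslin M T (space M \<times> T - E)"
proof -
  have "E \<in> sigma_sets (space M \<times> UNIV) {a \<times> b | a b. a \<in> sets M \<and> b \<in> sets (borel :: real measure)}"
    using E by (simp add: sets_pair_measure)
  then show ?thesis
  proof induction
    case (Basic E)
    then obtain F B where FB: "E = F \<times> B" "F \<in> sets M" "B \<in> sets borel" by auto
    have rect: "compact_souslin M T (G \<times> T)" if "G \<in> sets M" for G
      using T that by (intro compact_souslin_rect compact_rects.rect) auto
    have "E \<inter> space M \<times> T = (F \<times> T) \<inter> (space M \<times> (B \<inter> T))"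
      "space M \<times> T - E = ((space M - F) \<times> T) \<union> (space M \<times> (T - B))"
      using FB sets.sets_into_space[OF FB(2)] by auto
    then show ?case
      using compact_souslin_times[OF T FB(3), of M] rect[OF FB(2)] rect[OF sets.compl_sets[OF FB(2)]] T
      by (auto intro!: compact_souslin_Int compact_souslin_Un)
  next
    case Empty
    show ?case using T by (auto intro!: compact_souslin_rect compact_rects_empty compact_rects.rect)
  next
    case (Compl E)
    moreover have "(space M \<times> UNIV - E) \<inter> space M \<times> T = space M \<times> T - E"
      "space M \<times> T - (space M \<times> UNIV - E) = E \<inter> space M \<times> T" by auto
    ultimately show ?case by simp
  next
    case (Union E)
    have eq: "(\<Union>i. E i) \<inter> space M \<times> T = (\<Union>i. E i \<inter> space M \<times> T)"
      "space M \<times> T - (\<Union>i. E i) = (\<Inter>i. space M \<times> T - E i)" by auto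
    show ?case unfolding eq using Union T
      by (intro conjI compact_souslin_UN compact_souslin_INT) blast+
  qed
qed

text \<open>Koenig's lemma, for finitely branching trees of sequences.\<close>

lemma bounded_branch:
  fixes m :: "nat \<Rightarrow> nat" and P :: "nat list \<Rightarrow> bool"
  assumes ex: "\<And>n. \<exists>xs. length xs = n \<and> (\<forall>i<n. xs ! i \<le> m i) \<and> (\<forall>k\<le>n. P (take k xs))"
  shows "\<exists>\<sigma>. \<forall>n. P (map \<sigma> [0..<n])"
proof -
  \<comment> \<open>\<open>ext xs n\<close> says that the node \<open>xs\<close> has an admissible
    descendant of length \<open>n\<close>. By \<open>ext_mono\<close> descendants of large length
    yield those of all smaller lengths, so \<open>good\<close> means that the subtree below
    \<open>xs\<close> is infinite.\<close>
  define ext where "ext = (\<lambda>xs n. \<exists>ys. length ys = n \<and> take (length xs) ys = xs \<and>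
    (\<forall>i<n. ys ! i \<le> m i) \<and> (\<forall>k\<le>n. P (take k ys)))"
  have ext_mono: "ext xs n" if "ext xs n'" "length xs \<le> n" "n \<le> n'" for xs n n'
  proof -
    obtain ys where "length ys = n'" "take (length xs) ys = xs"
      "\<forall>i<n'. ys ! i \<le> m i" "\<forall>k\<le>n'. P (take k ys)" using \<open>ext xs n'\<close> unfolding ext_def by blast
    then show ?thesis unfolding ext_def using that(2,3)
      by (intro exI[of _ "take n ys"]) (auto simp: min_def)
  qed
  define good where "good = (\<lambda>xs. \<forall>n\<ge>length xs. ext xs n)"
  have "good []" unfolding good_def ext_def using ex by auto
  have step: "\<exists>j. good (xs @ [j])" if "good xs" for xs
  proof (rule ccontr)
    assume "\<not> ?thesis"
    then have "\<forall>j. \<exists>n. Suc (length xs) \<le> n \<and> \<not> ext (xs @ [j]) n" by (auto simp: good_def)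
    from choice[OF this] obtain f where f: "\<And>j. Suc (length xs) \<le> f j" "\<And>j. \<not> ext (xs @ [j]) (f j)" by auto
    \<comment> \<open>Only finitely many children can occur below \<open>xs\<close>. If each of them
      died out at its length \<open>f j\<close>, a descendant of \<open>xs\<close> of the maximal
      such length would still pass through one of them.\<close>
    define n where "n = Max (f ` {..m (length xs)})"
    have fn: "f j \<le> n" if "j \<le> m (length xs)" for j using that by (auto simp: n_def)
    have ln: "Suc (length xs) \<le> n" using f(1)[of 0] fn[of 0] by simp
    then have "ext xs n" using \<open>good xs\<close> by (simp add: good_def)
    then obtain ys where ys: "length ys = n" "take (length xs) ys = xs"
      "\<forall>i<n. ys ! i \<le> m i" "\<forall>k\<le>n. P (take k ys)" unfolding ext_def by blast
    define j where "j = ys ! length xs"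
    have "take (length (xs @ [j])) ys = xs @ [j]"
      using ys(1,2) ln by (simp add: j_def take_Suc_conv_app_nth)
    then have "ext (xs @ [j]) n" unfolding ext_def using ys by blast
    then have "ext (xs @ [j]) (f j)"
      using f(1)[of j] fn[of j] ys(3) ln by (auto intro: ext_mono simp: j_def)
    then show False using f(2) by simp
  qed
  have "\<exists>f. \<forall>n. (good (f n) \<and> length (f n) = n) \<and> (\<exists>j. f (Suc n) = f n @ [j])"
  proof (rule dependent_nat_choice)
    fix xs n assume "good xs \<and> length xs = n"
    then obtain j where "good (xs @ [j])" using step by blast
    then show "\<exists>y. (good y \<and> length y = Suc n) \<and> (\<exists>j. y = xs @ [j])"
      using \<open>good xs \<and> length xs = n\<close> by (intro exI[of _ "xs @ [j]"]) auto
  qed (use \<open>good []\<close> in auto)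
  then obtain f where f: "\<And>n. good (f n)" "\<And>n. length (f n) = n" "\<And>n. \<exists>j. f (Suc n) = f n @ [j]" by auto
  define \<sigma> where "\<sigma> = (\<lambda>n. last (f (Suc n)))"
  have "f n = map \<sigma> [0..<n]" for n
  proof (induction n)
    case (Suc n)
    then show ?case using f(3)[of n] by (auto simp: \<sigma>_def)
  qed (use f(2) in auto)
  moreover have "P (f n)" for n
  proof -
    have "ext (f n) n" using f(1,2)[of n] by (simp add: good_def)
    then show ?thesis unfolding ext_def using f(2)[of n] by auto
  qed
  ultimately show ?thesis by (intro exI[of _ \<sigma>]) simp
qed

text \<open>Choquet's capacitability argument: the outer measure of the projection is continuous along
  increasing sequences, and projections of decreasing sequences of compact rectangles commute with
  intersections.\<close>

lemma compact_souslin_fst_inner: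
  assumes A: "compact_souslin M T A" and \<mu>: "finite_measure \<mu>" "sets \<mu> = sets M"
    and b: "b < outer_measure_of \<mu> (fst ` A)"
  shows "\<exists>B\<in>sets M. B \<subseteq> fst ` A \<and> b \<le> emeasure \<mu> B"
proof -
  interpret finite_measure \<mu> by fact
  obtain R where R: "\<And>xs. R xs \<in> compact_rects M T"
    "A = {p. \<exists>\<sigma>::nat \<Rightarrow> nat. \<forall>n. p \<in> R (map \<sigma> [0..<n])}"
    using A unfolding compact_souslin_def by blast
  have sp: "space \<mu> = space M" using \<mu>(2) by (rule sets_eq_imp_space_eq)
  \<comment> \<open>Points of \<open>A\<close> that have a branch dominated by \<open>ms\<close> on
    its first \<open>length ms\<close> entries; later entries are unrestricted. Relaxing the last
    bound makes \<open>D (ms @ [j])\<close> increase to \<open>D ms\<close>.\<close>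
  define D where "D = (\<lambda>ms. {p. \<exists>\<sigma>::nat \<Rightarrow> nat. (\<forall>i<length ms. \<sigma> i \<le> ms ! i) \<and> (\<forall>n. p \<in> R (map \<sigma> [0..<n]))})"
  have D0: "D [] = A" by (simp add: D_def R(2))
  have Dsub: "fst ` D ms \<subseteq> space \<mu>" for ms
  proof -
    have "D ms \<subseteq> R []" by (auto simp: D_def dest: spec[of _ 0])
    then show ?thesis using compact_rects_subset[OF R(1)[of "[]"]] sp by fastforce
  qed
  have DUN: "(\<Union>j. D (ms @ [j])) = D ms" for ms
  proof (intro antisym subsetI)
    fix p assume "p \<in> (\<Union>j. D (ms @ [j]))"
    then obtain j \<sigma> where \<sigma>: "\<And>i. i < Suc (length ms) \<Longrightarrow> \<sigma> i \<le> (ms @ [j]) ! i" "\<And>n. p \<in> R (map \<sigma> [0..<n])"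
      unfolding D_def by auto
    have "\<sigma> i \<le> ms ! i" if "i < length ms" for i using \<sigma>(1)[of i] that by (simp add: nth_append)
    then show "p \<in> D ms" using \<sigma>(2) unfolding D_def by auto
  next
    fix p assume "p \<in> D ms"
    then obtain \<sigma> where \<sigma>: "\<And>i. i < length ms \<Longrightarrow> \<sigma> i \<le> ms ! i" "\<And>n. p \<in> R (map \<sigma> [0..<n])"
      unfolding D_def by auto
    have "\<sigma> i \<le> (ms @ [\<sigma> (length ms)]) ! i" if "i < Suc (length ms)" for i
      using \<sigma>(1)[of i] that by (auto simp: nth_append less_Suc_eq)
    then have "p \<in> D (ms @ [\<sigma> (length ms)])" unfolding D_def using \<sigma>(2) by auto
    then show "p \<in> (\<Union>j. D (ms @ [j]))" by blast
  qed
  have Dinc: "incseq (\<lambda>j. fst ` D (ms @ [j]))" for ms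
  proof (intro incseq_SucI image_mono subsetI)
    fix j p assume "p \<in> D (ms @ [j])"
    then obtain \<sigma> where \<sigma>: "\<And>i. i < Suc (length ms) \<Longrightarrow> \<sigma> i \<le> (ms @ [j]) ! i" "\<And>n. p \<in> R (map \<sigma> [0..<n])"
      unfolding D_def by auto
    have "\<sigma> i \<le> (ms @ [Suc j]) ! i" if "i < Suc (length ms)" for i
      using \<sigma>(1)[of i] that by (auto simp: nth_append split: if_splits)
    then show "p \<in> D (ms @ [Suc j])" unfolding D_def using \<sigma>(2) by auto
  qed
  \<comment> \<open>Since the outer measure is continuous along this increasing sequence, the next
    bound can be fixed while the outer measure stays above \<open>b\<close>.\<close>
  have step: "\<exists>j. b < outer_measure_of \<mu> (fst ` D (ms @ [j]))" if "b < outer_measure_of \<mu> (fst ` D ms)" for ms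
  proof -
    have "(SUP j. outer_measure_of \<mu> (fst ` D (ms @ [j]))) = outer_measure_of \<mu> (\<Union>j. fst ` D (ms @ [j]))"
      using Dsub Dinc by (intro SUP_outer_measure_of_incseq) auto
    also have "(\<Union>j. fst ` D (ms @ [j])) = fst ` D ms" by (simp add: image_UN[symmetric] DUN)
    finally have "b < (SUP j. outer_measure_of \<mu> (fst ` D (ms @ [j])))" using that by simp
    then show ?thesis unfolding less_SUP_iff by simp
  qed
  have "\<exists>f. \<forall>n. (b < outer_measure_of \<mu> (fst ` D (f n)) \<and> length (f n) = n) \<and> (\<exists>j. f (Suc n) = f n @ [j])"
  proof (rule dependent_nat_choice)
    fix ms n assume ms: "b < outer_measure_of \<mu> (fst ` D ms) \<and> length ms = n"
    then obtain j where "b < outer_measure_of \<mu> (fst ` D (ms @ [j]))" using step by blast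
    then show "\<exists>y. (b < outer_measure_of \<mu> (fst ` D y) \<and> length y = Suc n) \<and> (\<exists>j. y = ms @ [j])"
      using ms by (intro exI[of _ "ms @ [j]"]) auto
  qed (use b D0 in auto)
  then obtain f where f: "\<And>n. b < outer_measure_of \<mu> (fst ` D (f n))" "\<And>n. length (f n) = n"
    "\<And>n. \<exists>j. f (Suc n) = f n @ [j]" by auto
  define m where "m = (\<lambda>n. last (f (Suc n)))"
  have fm: "f n = map m [0..<n]" for n
  proof (induction n)
    case (Suc n)
    then show ?case using f(3)[of n] by (auto simp: m_def)
  qed (use f(2) in auto)
  \<comment> \<open>Bounding the entries by \<open>m\<close> leaves finitely many sequences of each
    length. Hence \<open>C n\<close>, which only looks at the first \<open>n\<close> entries, is a
    finite union of finite intersections of compact rectangles and has a measurable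
    projection.\<close>
  define L where "L = (\<lambda>n. {xs. length xs = n \<and> (\<forall>i<n. xs ! i \<le> m i)})"
  define C where "C = (\<lambda>n. \<Union>xs\<in>L n. \<Inter>k\<in>{..n}. R (take k xs))"
  have "finite (L n)" for n
  proof -
    have "L n \<subseteq> {xs. set xs \<subseteq> (\<Union>i<n. {..m i}) \<and> length xs = n}"
      by (fastforce simp: L_def in_set_conv_nth)
    then show ?thesis by (rule finite_subset) (simp add: finite_lists_length_eq)
  qed
  then have C: "C n \<in> compact_rects M T" for n
    unfolding C_def by (intro compact_rects_UN compact_rects_INT R(1)) auto
  have "C (Suc n) \<subseteq> C n" for n
  proof
    fix p assume "p \<in> C (Suc n)"
    then obtain xs where xs: "xs \<in> L (Suc n)" "\<And>k. k \<le> Suc n \<Longrightarrow> p \<in> R (take k xs)" by (auto simp: C_def)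
    have "take n xs \<in> L n" using xs(1) by (auto simp: L_def)
    moreover have "p \<in> R (take k (take n xs))" if "k \<le> n" for k using xs(2)[of k] that by (simp add: min_def)
    ultimately show "p \<in> C n" unfolding C_def by blast
  qed
  then have dec: "decseq C" by (rule decseq_SucI)
  \<comment> \<open>At every level a point of all \<open>C n\<close> has an admissible finite branch
    bounded by \<open>m\<close>; Koenig's lemma turns these into one infinite branch, which is
    membership in \<open>A\<close>.\<close>
  have CA: "(\<Inter>n. C n) \<subseteq> A"
  proof
    fix p assume p: "p \<in> (\<Inter>n. C n)"
    have "\<exists>xs. length xs = n \<and> (\<forall>i<n. xs ! i \<le> m i) \<and> (\<forall>k\<le>n. p \<in> R (take k xs))" for n
    proof -
      have "p \<in> C n" using p by blast
      then show ?thesis unfolding C_def L_def by auto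
    qed
    then show "p \<in> A" unfolding R(2) using bounded_branch[of m "\<lambda>xs. p \<in> R xs"] by simp
  qed
  have DC: "D (f n) \<subseteq> C n" for n
  proof
    fix p assume "p \<in> D (f n)"
    then obtain \<sigma> where \<sigma>: "\<And>i. i < n \<Longrightarrow> \<sigma> i \<le> m i" "\<And>n. p \<in> R (map \<sigma> [0..<n])"
      unfolding D_def fm by auto
    have "map \<sigma> [0..<n] \<in> L n" using \<sigma>(1) by (auto simp: L_def)
    moreover have "p \<in> R (take k (map \<sigma> [0..<n]))" if "k \<le> n" for k
      using \<sigma>(2)[of k] that by (simp add: take_map min_def)
    ultimately show "p \<in> C n" unfolding C_def by blast
  qed
  have Cs: "fst ` C n \<in> sets \<mu>" for n using compact_rects_fst[OF C] \<mu>(2) by simp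
  have "b \<le> emeasure \<mu> (fst ` C n)" for n
    using f(1)[of n] outer_measure_of_mono[OF image_mono[OF DC[of n]], of \<mu> fst] Cs[of n] by simp
  then have "b \<le> (INF n. emeasure \<mu> (fst ` C n))" by (intro INF_greatest)
  also have "\<dots> = emeasure \<mu> (\<Inter>n. fst ` C n)"
    using Cs dec by (intro INF_emeasure_decseq) (auto simp: decseq_def intro!: image_mono)
  finally have "b \<le> emeasure \<mu> (\<Inter>n. fst ` C n)" .
  moreover have "(\<Inter>n. fst ` C n) \<subseteq> fst ` A"
    unfolding compact_rects_fst_INT[OF C dec] using CA by (rule image_mono)
  moreover have "(\<Inter>n. fst ` C n) \<in> sets M" using Cs \<mu>(2) by auto
  ultimately show ?thesis by blast
qed

text \<open>The projection is caught between measurable sets that differ by a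
  \<open>\<mu>\<close>-null set. Time is cut into windows \<open>[-k, k]\<close> because the paving
  wants a compact time factor; in each window the outer measure provides the hull \<open>D\<close>
  and capacitability the inner set \<open>C\<close>.\<close>

lemma measurable_projection:
  assumes E: "E \<in> sets (M \<Otimes>\<^sub>M (borel :: real measure))"
    and \<mu>: "finite_measure \<mu>" "sets \<mu> = sets M"
  shows "\<exists>C D. C \<in> sets M \<and> D \<in> sets M \<and> C \<subseteq> fst ` E \<and> fst ` E \<subseteq> D \<and> emeasure \<mu> (D - C) = 0"
proof -
  interpret finite_measure \<mu> by fact
  have sp: "space \<mu> = space M" using \<mu>(2) by (rule sets_eq_imp_space_eq)
  have "\<exists>CD. fst CD \<in> sets M \<and> snd CD \<in> sets M \<and> fst CD \<subseteq> fst ` (E \<inter> space M \<times> {-real k..real k}) \<and>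
     fst ` (E \<inter> space M \<times> {-real k..real k}) \<subseteq> snd CD \<and> emeasure \<mu> (snd CD - fst CD) = 0" for k
  proof -
    define A where "A = E \<inter> space M \<times> {-real k..real k}"
    have A: "compact_souslin M {-real k..real k} A"
      using compact_souslin_measurable[OF _ E, of "{-real k..real k}"] by (simp add: A_def)
    have Asp: "fst ` A \<subseteq> space \<mu>" by (auto simp: A_def sp)
    obtain D where D: "D \<in> sets \<mu>" "fst ` A \<subseteq> D" "outer_measure_of \<mu> (fst ` A) = emeasure \<mu> D"
      using outer_measure_of_attain[OF Asp] by (elim bexE conjE)
    define \<B> where "\<B> = {B \<in> sets M. B \<subseteq> fst ` A}"
    \<comment> \<open>Any value below the outer measure is reached by a measurable subset of the
      projection; the union of a maximizing sequence of such subsets then attains it.\<close>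
    have "emeasure \<mu> D \<le> (SUP B\<in>\<B>. emeasure \<mu> B)"
    proof (rule dense_le)
      fix b assume "b < emeasure \<mu> D"
      then obtain B where "B \<in> \<B>" "b \<le> emeasure \<mu> B"
        using compact_souslin_fst_inner[OF A \<mu>, of b] D(3) by (auto simp: \<B>_def)
      then show "b \<le> (SUP B\<in>\<B>. emeasure \<mu> B)" by (meson SUP_upper2)
    qed
    moreover have "{} \<in> \<B>" by (auto simp: \<B>_def)
    then obtain g :: "nat \<Rightarrow> ennreal" where g: "range g \<subseteq> emeasure \<mu> ` \<B>" "(SUP B\<in>\<B>. emeasure \<mu> B) = Sup (range g)"
      using ennreal_SUP_countable_SUP[of \<B> "emeasure \<mu>"] by blast
    then have "\<forall>n. \<exists>B. B \<in> \<B> \<and> g n = emeasure \<mu> B" by auto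
    from choice[OF this] obtain B where B: "\<And>n. B n \<in> \<B>" "\<And>n. g n = emeasure \<mu> (B n)" by auto
    define C where "C = (\<Union>n. B n)"
    have C: "C \<in> sets M" "C \<subseteq> fst ` A" using B(1) by (auto simp: C_def \<B>_def)
    have "Sup (range g) \<le> emeasure \<mu> C"
      using C(1) by (intro SUP_least) (auto simp: B(2) C_def \<mu>(2) intro!: emeasure_mono)
    ultimately have "emeasure \<mu> D \<le> emeasure \<mu> C" using g(2) by simp
    moreover have "emeasure \<mu> (D - C) = emeasure \<mu> D - emeasure \<mu> C"
      using C D \<mu>(2) by (intro emeasure_Diff) auto
    ultimately have "emeasure \<mu> (D - C) = 0" by (simp add: diff_eq_0_iff_ennreal less_top[symmetric])
    then show ?thesis using C D \<mu>(2) by (intro exI[of _ "(C,D)"]) (auto simp: A_def)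
  qed
  then have "\<forall>k. \<exists>CD. fst CD \<in> sets M \<and> snd CD \<in> sets M \<and> fst CD \<subseteq> fst ` (E \<inter> space M \<times> {-real k..real k}) \<and>
     fst ` (E \<inter> space M \<times> {-real k..real k}) \<subseteq> snd CD \<and> emeasure \<mu> (snd CD - fst CD) = 0" by blast
  from choice[OF this] obtain CD where CD: "\<And>k. fst (CD k) \<in> sets M" "\<And>k. snd (CD k) \<in> sets M"
    "\<And>k. fst (CD k) \<subseteq> fst ` (E \<inter> space M \<times> {-real k..real k})"
    "\<And>k. fst ` (E \<inter> space M \<times> {-real k..real k}) \<subseteq> snd (CD k)"
    "\<And>k. emeasure \<mu> (snd (CD k) - fst (CD k)) = 0" by blast
  define C D where "C = (\<Union>k. fst (CD k))" and "D = (\<Union>k. snd (CD k))"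
  have CDm: "C \<in> sets M" "D \<in> sets M" using CD(1,2) by (auto simp: C_def D_def)
  moreover have "C \<subseteq> fst ` E" using CD(3) by (fastforce simp: C_def)
  moreover have "fst ` E \<subseteq> D"
  proof
    fix x assume "x \<in> fst ` E"
    then obtain t where t: "(x,t) \<in> E" by force
    then have "x \<in> space M" using sets.sets_into_space[OF E] by (auto simp: space_pair_measure)
    obtain k :: nat where "\<bar>t\<bar> \<le> real k" using real_arch_simple by blast
    then have "x \<in> fst ` (E \<inter> space M \<times> {-real k..real k})"
      using t \<open>x \<in> space M\<close> by (intro image_eqI[of _ _ "(x,t)"]) auto
    then show "x \<in> D" using CD(4)[of k] by (auto simp: D_def)
  qed
  moreover have "emeasure \<mu> (D - C) = 0"
  proof -
    have "emeasure \<mu> (\<Union>k. snd (CD k) - fst (CD k)) = 0"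
      using CD by (intro emeasure_UN_eq_0) (auto simp: \<mu>(2))
    moreover have "emeasure \<mu> (D - C) \<le> emeasure \<mu> (\<Union>k. snd (CD k) - fst (CD k))"
      using CD by (intro emeasure_mono) (auto simp: C_def D_def \<mu>(2))
    ultimately show ?thesis by simp
  qed
  ultimately show ?thesis by blast
qed

text \<open>The points where \<open>r x\<close> exceeds \<open>n\<close> at some time form a
  projection. Outside its measurable hull the bound \<open>n\<close> holds. A point left out by all
  \<open>B n\<close> lies in every hull but, being bounded in time, misses some projection, hence
  lies in one of the null differences.\<close>

lemma bounded_sections_exhaust:
  fixes r :: "'a \<Rightarrow> real \<Rightarrow> real"
  assumes r: "(\<lambda>(x, t). r x t) \<in> borel_measurable (M \<Otimes>\<^sub>M borel)"
    and bdd: "\<And>x. x \<in> space M \<Longrightarrow> \<exists>c. \<forall>t. r x t \<le> c"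
    and \<mu>: "finite_measure \<mu>" "sets \<mu> = sets M"
  shows "\<exists>B :: nat \<Rightarrow> 'a set. incseq B \<and> (\<forall>n. B n \<in> sets M) \<and> (\<forall>n. \<exists>c. \<forall>x\<in>B n. \<forall>t. r x t \<le> c) \<and>
    emeasure \<mu> (space M - (\<Union>n. B n)) = 0"
proof -
  interpret finite_measure \<mu> by fact
  define E where "E = (\<lambda>n::nat. {p \<in> space (M \<Otimes>\<^sub>M borel). real n < (case p of (x,t) \<Rightarrow> r x t)})"
  have E: "E n \<in> sets (M \<Otimes>\<^sub>M borel)" for n unfolding E_def using r by measurable
  have "\<forall>n. \<exists>CD. fst CD \<in> sets M \<and> snd CD \<in> sets M \<and> fst CD \<subseteq> fst ` E n \<and> fst ` E n \<subseteq> snd CD \<and>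
     emeasure \<mu> (snd CD - fst CD) = 0"
    using measurable_projection[OF E \<mu>] by fastforce
  from choice[OF this] obtain CD where CD: "\<And>k. fst (CD k) \<in> sets M" "\<And>k. snd (CD k) \<in> sets M"
    "\<And>k. fst (CD k) \<subseteq> fst ` E k" "\<And>k. fst ` E k \<subseteq> snd (CD k)"
    "\<And>k. emeasure \<mu> (snd (CD k) - fst (CD k)) = 0" by blast
  \<comment> \<open>The hulls are obtained independently for each \<open>k\<close> and need not
    decrease; the union over \<open>k \<le> n\<close> makes \<open>B\<close> increasing.\<close>
  define B where "B = (\<lambda>n. \<Union>k\<le>n. space M - snd (CD k))"
  have "incseq B" unfolding incseq_def B_def by (auto intro: order_trans)
  moreover have "\<forall>n. B n \<in> sets M" unfolding B_def using CD(2) by auto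
  moreover have "\<exists>c. \<forall>x\<in>B n. \<forall>t. r x t \<le> c" for n
  proof (intro exI[of _ "real n"] ballI allI)
    fix x t assume "x \<in> B n"
    then obtain k where k: "k \<le> n" "x \<in> space M" "x \<notin> snd (CD k)" by (auto simp: B_def)
    then have "(x,t) \<notin> E k" using CD(4)[of k] by force
    then have "r x t \<le> real k" using k(2) by (auto simp: E_def space_pair_measure)
    then show "r x t \<le> real n" using k(1) by (meson of_nat_le_iff order_trans)
  qed
  moreover have "emeasure \<mu> (space M - (\<Union>n. B n)) = 0"
  proof -
    have "space M - (\<Union>n. B n) \<subseteq> (\<Union>k. snd (CD k) - fst (CD k))"
    proof
      fix x assume x: "x \<in> space M - (\<Union>n. B n)"
      obtain c where c: "\<And>t. r x t \<le> c" using bdd x by blast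
      obtain n :: nat where n: "c \<le> real n" using real_arch_simple by blast
      have "x \<notin> fst ` E n"
      proof
        assume "x \<in> fst ` E n"
        then obtain t where "real n < r x t" by (auto simp: E_def)
        then show False using c[of t] n by simp
      qed
      then have "x \<notin> fst (CD n)" using CD(3)[of n] by blast
      moreover have "x \<in> snd (CD n)" using x by (auto simp: B_def)
      ultimately show "x \<in> (\<Union>k. snd (CD k) - fst (CD k))" by blast
    qed
    then have "emeasure \<mu> (space M - (\<Union>n. B n)) \<le> emeasure \<mu> (\<Union>k. snd (CD k) - fst (CD k))"
      using CD by (intro emeasure_mono) (auto simp: \<mu>(2))
    also have "\<dots> = 0" using CD by (intro emeasure_UN_eq_0) (auto simp: \<mu>(2))
    finally show ?thesis by simp
  qed
  ultimately show ?thesis by blast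
qed

section \<open>Kernels\<close>

text \<open>Dynkin's argument for the sections of measurable sets, then approximation of functions
  by simple ones. Finiteness of the kernel enters where a complement becomes a difference.\<close>

lemma nn_integral_kernel_measurable:
  assumes sets: "\<And>x. x \<in> space N \<Longrightarrow> sets (\<kappa> x) = sets M"
    and fin: "\<And>x. x \<in> space N \<Longrightarrow> finite_measure (\<kappa> x)"
    and meas: "\<And>B. B \<in> sets M \<Longrightarrow> (\<lambda>x. emeasure (\<kappa> x) B) \<in> borel_measurable N"
    and f: "(\<lambda>(x, y). f x y) \<in> borel_measurable (N \<Otimes>\<^sub>M M)"
  shows "(\<lambda>x. \<integral>\<^sup>+y. f x y \<partial>\<kappa> x) \<in> borel_measurable N"
proof -
  have sp: "x \<in> space N \<Longrightarrow> space (\<kappa> x) = space M" for x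
    using sets by (rule sets_eq_imp_space_eq)
  have section_meas: "(\<lambda>x. emeasure (\<kappa> x) (Pair x -` A)) \<in> borel_measurable N" if "A \<in> sets (N \<Otimes>\<^sub>M M)" for A
    unfolding sets_pair_measure
    using Int_stable_pair_measure_generator pair_measure_closed that[unfolded sets_pair_measure]
  proof (induction rule: sigma_sets_induct_disjoint)
    case (basic A)
    then obtain E B where A: "A = E \<times> B" "E \<in> sets N" "B \<in> sets M" by auto
    have "emeasure (\<kappa> x) (Pair x -` A) = indicator E x * emeasure (\<kappa> x) B" for x
      by (auto simp: A split: split_indicator)
    then show ?case using A meas by simp
  next
    case (compl A)
    have "emeasure (\<kappa> x) (Pair x -` (space N \<times> space M - A)) = emeasure (\<kappa> x) (space M) - emeasure (\<kappa> x) (Pair x -` A)"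
      if x: "x \<in> space N" for x
    proof -
      interpret finite_measure "\<kappa> x" using fin x .
      have "Pair x -` A \<in> sets (\<kappa> x)"
        using sets_Pair1[of A N M x] compl(1) sets[OF x] by (simp add: sets_pair_measure)
      moreover have "Pair x -` (space N \<times> space M - A) = space (\<kappa> x) - Pair x -` A" using x sp by auto
      ultimately show ?thesis using emeasure_compl[of "Pair x -` A" "\<kappa> x"] emeasure_finite sp[OF x] by simp
    qed
    then show ?case using compl meas[of "space M"] by (simp cong: measurable_cong)
  next
    case (union A)
    have "emeasure (\<kappa> x) (Pair x -` (\<Union>i. A i)) = (\<Sum>i. emeasure (\<kappa> x) (Pair x -` A i))" if x: "x \<in> space N" for x
    proof -
      have "range (\<lambda>i. Pair x -` A i) \<subseteq> sets (\<kappa> x)"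
        using sets_Pair1[of _ N M x] union(2) sets[OF x] by (auto simp: sets_pair_measure)
      moreover have "disjoint_family (\<lambda>i. Pair x -` A i)"
        using union(1) by (auto simp: disjoint_family_on_def)
      ultimately show ?thesis by (subst vimage_UN, subst suminf_emeasure) auto
    qed
    then show ?case using union by (simp cong: measurable_cong)
  qed simp
  have "(\<lambda>x. \<integral>\<^sup>+y. g (x, y) \<partial>\<kappa> x) \<in> borel_measurable N" if "g \<in> borel_measurable (N \<Otimes>\<^sub>M M)" for g :: "_ \<Rightarrow> ennreal"
    using that
  proof induction
    case (cong f g)
    have "(\<integral>\<^sup>+y. f (x, y) \<partial>\<kappa> x) = (\<integral>\<^sup>+y. g (x, y) \<partial>\<kappa> x)" if "x \<in> space N" for x
      using cong(3) that sp by (intro nn_integral_cong) (auto simp: space_pair_measure)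
    then show ?case using cong(4) by (simp cong: measurable_cong)
  next
    case (set A)
    have "(\<integral>\<^sup>+y. indicator A (x, y) \<partial>\<kappa> x) = emeasure (\<kappa> x) (Pair x -` A)" if "x \<in> space N" for x
    proof -
      have "Pair x -` A \<in> sets (\<kappa> x)" using sets_Pair1[OF set, of x] sets[OF that] by simp
      moreover have "(\<integral>\<^sup>+y. indicator A (x, y) \<partial>\<kappa> x) = (\<integral>\<^sup>+y. indicator (Pair x -` A) y \<partial>\<kappa> x)"
        by (intro nn_integral_cong) (auto split: split_indicator)
      ultimately show ?thesis by simp
    qed
    then show ?case using section_meas[OF set] by (simp cong: measurable_cong)
  next
    case (mult u c)
    have "(\<integral>\<^sup>+y. c * u (x, y) \<partial>\<kappa> x) = c * (\<integral>\<^sup>+y. u (x, y) \<partial>\<kappa> x)" if "x \<in> space N" for x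
      using mult(2) that sets[OF that] by (intro nn_integral_cmult) (simp add: measurable_cong_sets[OF sets[OF that] refl])
    then show ?case using mult by (simp cong: measurable_cong)
  next
    case (add u v)
    have "(\<integral>\<^sup>+y. v (x, y) + u (x, y) \<partial>\<kappa> x) = (\<integral>\<^sup>+y. v (x, y) \<partial>\<kappa> x) + (\<integral>\<^sup>+y. u (x, y) \<partial>\<kappa> x)" if "x \<in> space N" for x
      using add that by (intro nn_integral_add) (simp_all add: measurable_cong_sets[OF sets[OF that] refl])
    then show ?case using add by (simp cong: measurable_cong)
  next
    case (seq U)
    have "(\<integral>\<^sup>+y. (SUP i. U i) (x, y) \<partial>\<kappa> x) = (SUP i. \<integral>\<^sup>+y. U i (x, y) \<partial>\<kappa> x)" if "x \<in> space N" for x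
      using seq that unfolding SUP_apply
      by (intro nn_integral_monotone_convergence_SUP)
         (auto simp add: measurable_cong_sets[OF sets[OF that] refl] incseq_def le_fun_def)
    then show ?case using seq by (simp cong: measurable_cong)
  qed
  from this[OF f] show ?thesis by simp
qed

text \<open>A recurring device: once an expression in \<open>f\<close> is recognized as integration
  against a measure, identities and inequalities known for sets pass to functions.\<close>

lemma mixture_exists:
  assumes sets: "\<And>w. w \<in> space \<mu> \<Longrightarrow> sets (\<nu> w) = sets M"
    and meas: "\<And>B. B \<in> sets M \<Longrightarrow> (\<lambda>w. emeasure (\<nu> w) B) \<in> borel_measurable \<mu>"
  shows "\<exists>\<rho>. sets \<rho> = sets M \<and>
    (\<forall>f\<in>borel_measurable M. (\<integral>\<^sup>+y. f y \<partial>\<rho>) = (\<integral>\<^sup>+w. (\<integral>\<^sup>+y. f y \<partial>\<nu> w) \<partial>\<mu>))"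
proof -
  have sp: "w \<in> space \<mu> \<Longrightarrow> space (\<nu> w) = space M" for w
    using sets by (rule sets_eq_imp_space_eq)
  define \<rho> where "\<rho> = measure_of (space M) (sets M) (\<lambda>B. \<integral>\<^sup>+w. emeasure (\<nu> w) B \<partial>\<mu>)"
  have s\<rho>: "sets \<rho> = sets M" "space \<rho> = space M" by (simp_all add: \<rho>_def)
  have em: "emeasure \<rho> B = (\<integral>\<^sup>+w. emeasure (\<nu> w) B \<partial>\<mu>)" if "B \<in> sets M" for B
    unfolding \<rho>_def
  proof (rule emeasure_measure_of_sigma)
    show "countably_additive (sets M) (\<lambda>B. \<integral>\<^sup>+w. emeasure (\<nu> w) B \<partial>\<mu>)"
    proof (rule countably_additiveI)
      fix A :: "nat \<Rightarrow> _ set" assume A: "range A \<subseteq> sets M" "disjoint_family A"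
      have "(\<Sum>i. \<integral>\<^sup>+w. emeasure (\<nu> w) (A i) \<partial>\<mu>) = (\<integral>\<^sup>+w. (\<Sum>i. emeasure (\<nu> w) (A i)) \<partial>\<mu>)"
        using A meas by (intro nn_integral_suminf[symmetric]) auto
      also have "\<dots> = (\<integral>\<^sup>+w. emeasure (\<nu> w) (\<Union>i. A i) \<partial>\<mu>)"
        using A sets by (intro nn_integral_cong suminf_emeasure) auto
      finally show "(\<Sum>i. \<integral>\<^sup>+w. emeasure (\<nu> w) (A i) \<partial>\<mu>) = (\<integral>\<^sup>+w. emeasure (\<nu> w) (\<Union>i. A i) \<partial>\<mu>)" .
    qed
  qed (use that in \<open>auto simp: positive_def sets.sigma_algebra_axioms\<close>)
  \<comment> \<open>Measurability in \<open>w\<close> is proved in the same induction, since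
    exchanging the outer integral with sums and suprema requires it at each stage.\<close>
  have "(\<lambda>w. \<integral>\<^sup>+y. f y \<partial>\<nu> w) \<in> borel_measurable \<mu> \<and> (\<integral>\<^sup>+y. f y \<partial>\<rho>) = (\<integral>\<^sup>+w. (\<integral>\<^sup>+y. f y \<partial>\<nu> w) \<partial>\<mu>)"
    if "f \<in> borel_measurable M" for f :: "_ \<Rightarrow> ennreal"
    using that
  proof induction
    case (cong f g)
    have "(\<integral>\<^sup>+y. f y \<partial>\<nu> w) = (\<integral>\<^sup>+y. g y \<partial>\<nu> w)" if "w \<in> space \<mu>" for w
      using cong(3) that sp by (intro nn_integral_cong) auto
    moreover have "(\<integral>\<^sup>+y. f y \<partial>\<rho>) = (\<integral>\<^sup>+y. g y \<partial>\<rho>)"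
      using cong(3) s\<rho> by (intro nn_integral_cong) auto
    ultimately show ?case using cong(4) by (simp cong: measurable_cong nn_integral_cong)
  next
    case (set A)
    have "(\<integral>\<^sup>+y. indicator A y \<partial>\<nu> w) = emeasure (\<nu> w) A" if "w \<in> space \<mu>" for w
      using set sets[OF that] by simp
    then show ?case using set em[OF set] meas s\<rho> by (simp cong: measurable_cong nn_integral_cong)
  next
    case (mult u c)
    have *: "(\<integral>\<^sup>+y. c * u y \<partial>\<nu> w) = c * (\<integral>\<^sup>+y. u y \<partial>\<nu> w)" if "w \<in> space \<mu>" for w
      using mult(2) by (intro nn_integral_cmult) (simp add: measurable_cong_sets[OF sets[OF that] refl])
    have "(\<integral>\<^sup>+y. c * u y \<partial>\<rho>) = c * (\<integral>\<^sup>+y. u y \<partial>\<rho>)"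
      using mult(2) by (intro nn_integral_cmult) (simp add: measurable_cong_sets[OF s\<rho>(1) refl])
    moreover have "(\<integral>\<^sup>+w. (\<integral>\<^sup>+y. c * u y \<partial>\<nu> w) \<partial>\<mu>) = c * (\<integral>\<^sup>+w. (\<integral>\<^sup>+y. u y \<partial>\<nu> w) \<partial>\<mu>)"
      using mult(4) * by (subst nn_integral_cmult[symmetric]) (auto intro!: nn_integral_cong)
    moreover have "(\<lambda>w. c * (\<integral>\<^sup>+y. u y \<partial>\<nu> w)) \<in> borel_measurable \<mu>"
      using mult(4) by (intro borel_measurable_times_ennreal) auto
    ultimately show ?case using mult(4) * by (simp cong: measurable_cong)
  next
    case (add u v)
    have *: "(\<integral>\<^sup>+y. v y + u y \<partial>\<nu> w) = (\<integral>\<^sup>+y. v y \<partial>\<nu> w) + (\<integral>\<^sup>+y. u y \<partial>\<nu> w)" if "w \<in> space \<mu>" for w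
      using add by (intro nn_integral_add) (simp_all add: measurable_cong_sets[OF sets[OF that] refl])
    have "(\<integral>\<^sup>+y. v y + u y \<partial>\<rho>) = (\<integral>\<^sup>+y. v y \<partial>\<rho>) + (\<integral>\<^sup>+y. u y \<partial>\<rho>)"
      using add by (intro nn_integral_add) (simp_all add: measurable_cong_sets[OF s\<rho>(1) refl])
    moreover have "(\<integral>\<^sup>+w. (\<integral>\<^sup>+y. v y + u y \<partial>\<nu> w) \<partial>\<mu>) = (\<integral>\<^sup>+w. (\<integral>\<^sup>+y. v y \<partial>\<nu> w) \<partial>\<mu>) + (\<integral>\<^sup>+w. (\<integral>\<^sup>+y. u y \<partial>\<nu> w) \<partial>\<mu>)"
      using add * by (subst nn_integral_add[symmetric]) (auto intro!: nn_integral_cong)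
    moreover have "(\<lambda>w. (\<integral>\<^sup>+y. v y \<partial>\<nu> w) + (\<integral>\<^sup>+y. u y \<partial>\<nu> w)) \<in> borel_measurable \<mu>"
      using add by (intro borel_measurable_add) auto
    ultimately show ?case using add * by (simp cong: measurable_cong)
  next
    case (seq U)
    have *: "(\<integral>\<^sup>+y. (SUP i. U i) y \<partial>\<nu> w) = (SUP i. \<integral>\<^sup>+y. U i y \<partial>\<nu> w)" if "w \<in> space \<mu>" for w
      using seq unfolding SUP_apply
      by (intro nn_integral_monotone_convergence_SUP) (auto simp add: measurable_cong_sets[OF sets[OF that] refl])
    have "(\<integral>\<^sup>+y. (SUP i. U i) y \<partial>\<rho>) = (SUP i. \<integral>\<^sup>+y. U i y \<partial>\<rho>)"
      using seq unfolding SUP_apply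
      by (intro nn_integral_monotone_convergence_SUP) (auto simp add: measurable_cong_sets[OF s\<rho>(1) refl])
    moreover have "(\<integral>\<^sup>+w. (\<integral>\<^sup>+y. (SUP i. U i) y \<partial>\<nu> w) \<partial>\<mu>) = (\<integral>\<^sup>+w. (SUP i. \<integral>\<^sup>+y. U i y \<partial>\<nu> w) \<partial>\<mu>)"
      using * by (intro nn_integral_cong) auto
    moreover have "\<dots> = (SUP i. \<integral>\<^sup>+w. (\<integral>\<^sup>+y. U i y \<partial>\<nu> w) \<partial>\<mu>)"
      using seq by (intro nn_integral_monotone_convergence_SUP)
        (auto intro!: nn_integral_mono simp: incseq_def le_fun_def)
    moreover have "(\<lambda>w. SUP i. \<integral>\<^sup>+y. U i y \<partial>\<nu> w) \<in> borel_measurable \<mu>"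
      using seq by (intro borel_measurable_SUP) auto
    ultimately show ?case using seq * by (simp cong: measurable_cong)
  qed
  then show ?thesis using s\<rho> by blast
qed

lemma nn_integral_Fubini_finite:
  assumes \<nu>: "finite_measure \<nu>" "sets \<nu> = sets M"
    and G: "(\<lambda>(s, y). G s y) \<in> borel_measurable (borel \<Otimes>\<^sub>M M)"
  shows "(\<integral>\<^sup>+y. (\<integral>\<^sup>+s. G s y \<partial>lborel) \<partial>\<nu>) = (\<integral>\<^sup>+s. (\<integral>\<^sup>+y. G s y \<partial>\<nu>) \<partial>(lborel :: real measure))"
proof -
  interpret finite_measure \<nu> by fact
  interpret pair_sigma_finite lborel \<nu> ..
  show ?thesis
    using G by (intro Fubini') (simp add: measurable_cong_sets[OF sets_pair_measure_cong[OF sets_lborel \<nu>(2)] refl])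
qed

text \<open>Since the measure in \<open>y\<close> depends on \<open>w\<close>, the exchange takes
  two steps: \<open>y\<close> with \<open>v\<close> for fixed \<open>w\<close>, then
  \<open>w\<close> with \<open>v\<close>, the \<open>y\<close>-integral staying innermost.\<close>

lemma nn_integral_kernel_swap:
  fixes \<kappa> :: "real \<Rightarrow> 'a measure"
  assumes sets: "\<And>w. sets (\<kappa> w) = sets M"
    and fin: "\<And>w. finite_measure (\<kappa> w)"
    and meas: "\<And>B. B \<in> sets M \<Longrightarrow> (\<lambda>w. emeasure (\<kappa> w) B) \<in> borel_measurable borel"
    and F: "(\<lambda>((w, v), y). F w v y) \<in> borel_measurable ((borel \<Otimes>\<^sub>M borel) \<Otimes>\<^sub>M M)"
  shows "(\<integral>\<^sup>+w. (\<integral>\<^sup>+y. (\<integral>\<^sup>+v. F w v y \<partial>lborel) \<partial>\<kappa> w) \<partial>lborel) =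
    (\<integral>\<^sup>+v. (\<integral>\<^sup>+w. (\<integral>\<^sup>+y. F w v y \<partial>\<kappa> w) \<partial>lborel) \<partial>(lborel :: real measure))"
proof -
  have "(\<integral>\<^sup>+y. (\<integral>\<^sup>+v. F w v y \<partial>lborel) \<partial>\<kappa> w) = (\<integral>\<^sup>+v. (\<integral>\<^sup>+y. F w v y \<partial>\<kappa> w) \<partial>lborel)" for w
  proof (rule nn_integral_Fubini_finite[OF fin sets])
    have "(\<lambda>p. ((w, fst p), snd p)) \<in> borel \<Otimes>\<^sub>M M \<rightarrow>\<^sub>M (borel \<Otimes>\<^sub>M borel) \<Otimes>\<^sub>M M" by measurable
    from measurable_compose[OF this F]
    show "(\<lambda>(v, y). F w v y) \<in> borel_measurable (borel \<Otimes>\<^sub>M M)" by (simp add: case_prod_unfold)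
  qed
  moreover have "(\<lambda>p. \<integral>\<^sup>+y. F (fst p) (snd p) y \<partial>\<kappa> (fst p)) \<in> borel_measurable (borel \<Otimes>\<^sub>M borel)"
  proof (rule nn_integral_kernel_measurable)
    show "(\<lambda>(p, y). F (fst p) (snd p) y) \<in> borel_measurable ((borel \<Otimes>\<^sub>M borel) \<Otimes>\<^sub>M M)"
      using F by (simp add: case_prod_unfold)
    show "(\<lambda>p. emeasure (\<kappa> (fst p)) B) \<in> borel_measurable (borel \<Otimes>\<^sub>M borel)" if "B \<in> sets M" for B
      using measurable_compose[OF measurable_fst meas[OF that]] .
  qed (use sets fin in auto)
  then have "(\<integral>\<^sup>+w. (\<integral>\<^sup>+v. (\<integral>\<^sup>+y. F w v y \<partial>\<kappa> w) \<partial>lborel) \<partial>lborel) =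
    (\<integral>\<^sup>+v. (\<integral>\<^sup>+w. (\<integral>\<^sup>+y. F w v y \<partial>\<kappa> w) \<partial>lborel) \<partial>(lborel :: real measure))"
    by (intro lborel_pair.Fubini'[symmetric]) (simp add: case_prod_unfold)
  ultimately show ?thesis by simp
qed

section \<open>Survival probabilities and jump expansions\<close>

text \<open>Nonnegativity of \<open>g\<close> lets the Henstock-Kurzweil form of the fundamental
  theorem be read as a Lebesgue integral; the endpoints are null.\<close>

lemma nn_integral_ae_derivative:
  fixes F g :: "real \<Rightarrow> real"
  assumes "v \<le> t" and ac: "absolutely_continuous_on {v..t} F"
    and g: "g \<in> borel_measurable borel" "\<And>s. 0 \<le> g s"
    and deriv: "AE s in lborel. v < s \<and> s < t \<longrightarrow> (F has_real_derivative g s) (at s)"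
  shows "(\<integral>\<^sup>+s\<in>{v<..<t}. ennreal (g s) \<partial>lborel) = ennreal (F t - F v)"
proof -
  obtain N where N: "{s \<in> space lborel. \<not> (v < s \<and> s < t \<longrightarrow> (F has_real_derivative g s) (at s))} \<subseteq> N"
    "emeasure lborel N = 0" "N \<in> sets lborel"
    using AE_E[OF deriv] .
  have neg: "negligible (N \<union> {v, t})"
    using null_sets_completionI[OF null_setsI[OF N(2,3)]] by (simp add: negligible_iff_null_sets[symmetric])
  have "(g has_integral F t - F v) {v..t}"
  proof (rule absolutely_continuous_has_integral_derivative[OF \<open>v \<le> t\<close> ac neg])
    fix s assume "s \<in> {v..t}" "s \<notin> N \<union> {v, t}"
    then have "v < s \<and> s < t" "s \<notin> N" by auto
    then have "(F has_real_derivative g s) (at s)" using subsetD[OF N(1), of s] by auto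
    then show "(F has_real_derivative g s) (at s within {v..t})" by (rule DERIV_subset) simp
  qed
  then have "((\<lambda>s. g s * indicator {v..t} s) has_integral F t - F v) UNIV"
    by (subst (asm) has_integral_restrict_UNIV[symmetric])
       (auto simp: indicator_def of_bool_def if_distrib cong: if_cong)
  then have "(\<integral>\<^sup>+s. ennreal (g s * indicator {v..t} s) \<partial>lborel) = ennreal (F t - F v)"
    using g by (intro nn_integral_has_integral_lborel) auto
  moreover have "(\<integral>\<^sup>+s\<in>{v<..<t}. ennreal (g s) \<partial>lborel) = (\<integral>\<^sup>+s. ennreal (g s * indicator {v..t} s) \<partial>lborel)"
    using AE_lborel_singleton[of v] AE_lborel_singleton[of t]
    by (intro nn_integral_cong_AE, eventually_elim) (auto split: split_indicator)
  ultimately show ?thesis by simp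
qed

lemma abs_exp_minus_diff_le:
  fixes a b :: real
  assumes "0 \<le> a" "a \<le> b"
  shows "\<bar>exp (- b) - exp (- a)\<bar> \<le> b - a"
proof -
  have "exp (-b) = exp (-a) * exp (-(b - a))" by (simp add: exp_add[symmetric])
  then have "exp (-a) - exp (-b) = exp (-a) * (1 - exp (-(b - a)))" by (simp add: algebra_simps)
  also have "\<dots> \<le> 1 * (b - a)"
  proof (rule mult_mono)
    show "1 - exp (- (b - a)) \<le> b - a" using exp_ge_add_one_self[of "a - b"] by (simp only: minus_diff_eq)
  qed (use assms in auto)
  finally show ?thesis using assms by simp
qed

text \<open>The bound on the rate is uniform in time for each state but not over states.
  \<open>kernel_space\<close> expresses conservativity: the total jump intensity is the exit rate,
  which makes the kernels finite and later bounds the total mass of the expansion by 1.\<close>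

locale jump_kernel =
  fixes M :: "'a measure" and r :: "'a \<Rightarrow> real \<Rightarrow> real" and K :: "'a \<Rightarrow> real \<Rightarrow> 'a measure"
  assumes rate_measurable: "(\<lambda>(x, t). r x t) \<in> borel_measurable (M \<Otimes>\<^sub>M borel)"
    and rate_nonneg: "\<And>x t. x \<in> space M \<Longrightarrow> 0 \<le> r x t"
    and rate_bounded: "\<And>x. x \<in> space M \<Longrightarrow> \<exists>c. \<forall>t. r x t \<le> c"
    and sets_kernel: "\<And>x t. x \<in> space M \<Longrightarrow> sets (K x t) = sets M"
    and kernel_measurable:
      "\<And>B. B \<in> sets M \<Longrightarrow> (\<lambda>(x, t). emeasure (K x t) B) \<in> borel_measurable (M \<Otimes>\<^sub>M borel)"
    and kernel_space: "\<And>x t. x \<in> space M \<Longrightarrow> emeasure (K x t) (space M) = ennreal (r x t)"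
begin

definition survival :: "real \<Rightarrow> real \<Rightarrow> 'a \<Rightarrow> real" where
  "survival u t x = exp (- (LBINT s:{u..t}. r x s))"

text \<open>\<open>jumps n u x t\<close> is \<open>P_bar_n\<close> acting on functions instead of sets, so that it can be composed
  with \<open>last_jump\<close>.\<close>

primrec jumps :: "nat \<Rightarrow> real \<Rightarrow> 'a \<Rightarrow> real \<Rightarrow> ('a \<Rightarrow> ennreal) \<Rightarrow> ennreal" where
  "jumps 0 u x t f = f x * ennreal (survival u t x)"
| "jumps (Suc n) u x t f =
    (\<integral>\<^sup>+w\<in>{u<..<t}. (\<integral>\<^sup>+y. ennreal (survival u w x) * jumps n w y t f \<partial>K x w) \<partial>lborel)"

text \<open>Splitting at the last jump, which occurs at time \<open>v\<close> from the state \<open>z\<close>, instead of the first one.\<close>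

definition last_jump :: "real \<Rightarrow> real \<Rightarrow> ('a \<Rightarrow> ennreal) \<Rightarrow> 'a \<Rightarrow> ennreal" where
  "last_jump v t f z = (\<integral>\<^sup>+y. ennreal (survival v t y) * f y \<partial>K z v)"

lemma rate_compose [measurable (raw)]:
  assumes "x \<in> N \<rightarrow>\<^sub>M M" "t \<in> borel_measurable N"
  shows "(\<lambda>w. r (x w) (t w)) \<in> borel_measurable N"
  using measurable_compose[OF measurable_Pair[OF assms] rate_measurable] by simp

lemma space_kernel: "x \<in> space M \<Longrightarrow> space (K x t) = space M"
  using sets_kernel by (rule sets_eq_imp_space_eq)

lemma finite_kernel: "x \<in> space M \<Longrightarrow> finite_measure (K x t)"
  by (intro finite_measureI) (simp add: space_kernel kernel_space)

lemma measurable_kernel_eq: "x \<in> space M \<Longrightarrow> measurable (K x t) N = measurable M N"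
  by (rule measurable_cong_sets[OF sets_kernel refl])

lemma nn_integral_kernel_compose [measurable (raw)]:
  assumes x: "x \<in> N \<rightarrow>\<^sub>M M" and t: "t \<in> borel_measurable N"
    and f: "(\<lambda>(w, y). f w y) \<in> borel_measurable (N \<Otimes>\<^sub>M M)"
  shows "(\<lambda>w. \<integral>\<^sup>+y. f w y \<partial>K (x w) (t w)) \<in> borel_measurable N"
proof (rule nn_integral_kernel_measurable[where M=M])
  fix B assume "B \<in> sets M"
  from measurable_compose[OF measurable_Pair[OF x t] kernel_measurable[OF this]]
  show "(\<lambda>w. emeasure (K (x w) (t w)) B) \<in> borel_measurable N" by simp
qed (use f measurable_space[OF x] sets_kernel finite_kernel in auto)

lemma rate_integrable: "x \<in> space M \<Longrightarrow> set_integrable lborel {u..t} (r x)"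
proof -
  assume x: "x \<in> space M"
  obtain c where "\<And>t. r x t \<le> c" using rate_bounded[OF x] by blast
  moreover have "r x \<in> borel_measurable lborel"
    using rate_compose[of "\<lambda>_. x" borel "\<lambda>t. t"] x by simp
  ultimately show ?thesis unfolding set_integrable_def
    using rate_nonneg[OF x]
    by (intro integrableI_bounded_set_indicator[where B=c]) (auto simp: emeasure_lborel_Icc_eq)
qed

lemma survival_eq: "x \<in> space M \<Longrightarrow> survival u t x = exp (- integral {u..t} (r x))"
  unfolding survival_def using set_borel_integral_eq_integral(2)[OF rate_integrable] by simp

lemma rate_integrable_on: "x \<in> space M \<Longrightarrow> r x integrable_on {u..t}"
  using set_borel_integral_eq_integral(1)[OF rate_integrable] by simp

lemma integral_rate_nonneg: "x \<in> space M \<Longrightarrow> 0 \<le> integral {u..t} (r x)"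
  by (intro Henstock_Kurzweil_Integration.integral_nonneg rate_integrable_on rate_nonneg)

lemma survival_nonneg [simp]: "0 \<le> survival u t x" by (simp add: survival_def)

lemma survival_le_1: "x \<in> space M \<Longrightarrow> survival u t x \<le> 1"
  using integral_rate_nonneg by (simp add: survival_eq)

lemma survival_trivial: "t \<le> u \<Longrightarrow> survival u t x = 1"
proof -
  assume "t \<le> u"
  then have "(LBINT s:{u..t}. r x s) = (\<integral>s. indicator {u..t} s * r x u \<partial>lborel)"
    unfolding set_lebesgue_integral_def
    by (intro Bochner_Integration.integral_cong refl) (metis antisym atLeastAtMost_iff indicator_simps(2) order.trans scaleR_zero_left mult_zero_left real_scaleR_def)
  also have "\<dots> = 0" using \<open>t \<le> u\<close> by (cases "t = u") auto
  finally have "(LBINT s:{u..t}. r x s) = 0" .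
  then show ?thesis by (simp add: survival_def)
qed

lemma survival_compose [measurable (raw)]:
  assumes [measurable]: "x \<in> N \<rightarrow>\<^sub>M M" "u \<in> borel_measurable N" "t \<in> borel_measurable N"
  shows "(\<lambda>w. survival (u w) (t w) (x w)) \<in> borel_measurable N"
proof -
  have "(\<lambda>w. LBINT s:{u w..t w}. r (x w) s) \<in> borel_measurable N"
  proof -
    have "(\<lambda>w. \<integral>s. (if u w \<le> s \<and> s \<le> t w then r (x w) s else 0) \<partial>lborel) \<in> borel_measurable N"
      by measurable
    also have "(\<lambda>w. \<integral>s. (if u w \<le> s \<and> s \<le> t w then r (x w) s else 0) \<partial>lborel) = (\<lambda>w. LBINT s:{u w..t w}. r (x w) s)"
      unfolding set_lebesgue_integral_def
      by (intro ext Bochner_Integration.integral_cong) (auto split: split_indicator)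
    finally show ?thesis .
  qed
  then show ?thesis unfolding survival_def by measurable
qed

lemma integral_rate_diff_le:
  assumes x: "x \<in> space M" and c: "\<And>t. r x t \<le> c" and "v \<le> s" "s \<le> s'"
  shows "integral {v..s} (r x) \<le> integral {v..s'} (r x)"
    "integral {v..s'} (r x) - integral {v..s} (r x) \<le> c * (s' - s)"
proof -
  have "integral {v..s} (r x) + integral {s..s'} (r x) = integral {v..s'} (r x)"
    using assms by (intro Henstock_Kurzweil_Integration.integral_combine rate_integrable_on) auto
  moreover have "integral {s..s'} (r x) \<le> integral {s..s'} (\<lambda>_. c)"
    using rate_integrable_on[OF x] c by (intro integral_le) auto
  ultimately show "integral {v..s} (r x) \<le> integral {v..s'} (r x)"
    "integral {v..s'} (r x) - integral {v..s} (r x) \<le> c * (s' - s)"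
    using integral_rate_nonneg[OF x, of s s'] \<open>s \<le> s'\<close> by (auto simp: mult.commute)
qed

lemma integral_rate_deriv_ae:
  assumes x: "x \<in> space M"
  shows "AE s in lborel. v < s \<longrightarrow> ((\<lambda>s. integral {v..s} (r x)) has_real_derivative r x s) (at s)"
  using indefinite_integral_has_derivative_ae[of "r x"] rate_integrable_on[OF x] by auto

text \<open>The integrand is the derivative of \<open>- survival v s x\<close> in the end time
  \<open>s\<close>. The time bound on the rate makes this function Lipschitz, hence absolutely
  continuous.\<close>

lemma integral_rate_survival_forward:
  assumes x: "x \<in> space M" and "v \<le> t"
  shows "(\<integral>\<^sup>+s\<in>{v<..<t}. ennreal (r x s) * ennreal (survival v s x) \<partial>lborel) = ennreal (1 - survival v t x)"
proof -
  obtain c where c: "\<And>t. r x t \<le> c" using rate_bounded[OF x] by blast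
  define F where "F = (\<lambda>s. - exp (- integral {v..s} (r x)))"
  have ac: "absolutely_continuous_on {v..t} F"
  proof (rule lipschitz_absolutely_continuous_on)
    fix a b assume ab: "a < b" "{a..b} \<subseteq> {v..t}"
    then have "v \<le> a" by auto
    note 1 = integral_rate_diff_le[OF x c \<open>v \<le> a\<close> less_imp_le[OF \<open>a < b\<close>]]
    have "\<bar>exp (- integral {v..b} (r x)) - exp (- integral {v..a} (r x))\<bar> \<le> integral {v..b} (r x) - integral {v..a} (r x)"
      by (rule abs_exp_minus_diff_le[OF integral_rate_nonneg[OF x] 1(1)])
    then show "\<bar>F b - F a\<bar> \<le> c * (b - a)"
      using 1(2) by (simp add: F_def abs_minus_commute)
  qed
  have "(\<integral>\<^sup>+s\<in>{v<..<t}. ennreal (r x s * survival v s x) \<partial>lborel) = ennreal (F t - F v)"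
  proof (rule nn_integral_ae_derivative[OF \<open>v \<le> t\<close> ac])
    show "AE s in lborel. v < s \<and> s < t \<longrightarrow> (F has_real_derivative r x s * survival v s x) (at s)"
      using integral_rate_deriv_ae[OF x, of v]
    proof eventually_elim
      case (elim s)
      show ?case
      proof
        assume "v < s \<and> s < t"
        then have "((\<lambda>s. integral {v..s} (r x)) has_real_derivative r x s) (at s)" using elim by auto
        then show "(F has_real_derivative r x s * survival v s x) (at s)"
          unfolding F_def survival_eq[OF x] by (auto intro!: derivative_eq_intros)
      qed
    qed
    show "(\<lambda>s. r x s * survival v s x) \<in> borel_measurable borel" using x by measurable
  qed (use rate_nonneg[OF x] in auto)
  also have "F t - F v = 1 - survival v t x" by (simp add: F_def survival_eq[OF x])
  finally show ?thesis using rate_nonneg[OF x] by (simp add: ennreal_mult)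
qed

text \<open>Here the integrand is the derivative of \<open>survival s t x\<close> in the starting
  time \<open>s\<close>.\<close>

lemma integral_rate_survival_backward:
  assumes x: "x \<in> space M" and "v \<le> t"
  shows "(\<integral>\<^sup>+s\<in>{v<..<t}. ennreal (r x s) * ennreal (survival s t x) \<partial>lborel) = ennreal (1 - survival v t x)"
proof -
  obtain c where c: "\<And>t. r x t \<le> c" using rate_bounded[OF x] by blast
  define R where "R = integral {v..t} (r x)"
  \<comment> \<open>Writing the integral over \<open>[s, t]\<close> as \<open>R\<close> minus an
    integral starting at \<open>v\<close> moves \<open>s\<close> to an upper limit, where
    \<open>integral_rate_deriv_ae\<close> applies. \<open>F\<close> agrees with
    \<open>survival s t x\<close> only for \<open>s\<close> in \<open>[v, t]\<close>.\<close>
  define F where "F = (\<lambda>s. exp (- (R - integral {v..s} (r x))))"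
  have surv: "survival s t x = F s" if "v \<le> s" "s \<le> t" for s
  proof -
    have "integral {v..s} (r x) + integral {s..t} (r x) = R"
      unfolding R_def using that x by (intro Henstock_Kurzweil_Integration.integral_combine rate_integrable_on) auto
    then show ?thesis by (simp add: survival_eq[OF x] F_def)
  qed
  have ac: "absolutely_continuous_on {v..t} F"
  proof (rule lipschitz_absolutely_continuous_on)
    fix a b assume ab: "a < b" "{a..b} \<subseteq> {v..t}"
    then have "v \<le> a" "b \<le> t" by auto
    note 1 = integral_rate_diff_le[OF x c \<open>v \<le> a\<close>, of b]
      and 2 = integral_rate_diff_le(1)[OF x c, of v b t]
    have "\<bar>exp (- (R - integral {v..a} (r x))) - exp (- (R - integral {v..b} (r x)))\<bar>
      \<le> (R - integral {v..a} (r x)) - (R - integral {v..b} (r x))"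
      using 1 2 ab(1) \<open>v \<le> a\<close> \<open>b \<le> t\<close> by (intro abs_exp_minus_diff_le) (auto simp: R_def)
    then show "\<bar>F b - F a\<bar> \<le> c * (b - a)"
      using 1(2) ab(1) by (simp add: F_def abs_minus_commute)
  qed
  have F_nonneg: "0 \<le> F s" for s by (simp add: F_def)
  have Fm: "F \<in> borel_measurable borel"
  proof -
    have eq: "F = (\<lambda>s. exp (- R) / survival v s x)"
      by (simp add: F_def survival_eq[OF x] exp_diff exp_minus field_simps)
    show ?thesis unfolding eq using x by measurable
  qed
  have "(\<integral>\<^sup>+s\<in>{v<..<t}. ennreal (r x s * F s) \<partial>lborel) = ennreal (F t - F v)"
  proof (rule nn_integral_ae_derivative[OF \<open>v \<le> t\<close> ac])
    show "AE s in lborel. v < s \<and> s < t \<longrightarrow> (F has_real_derivative r x s * F s) (at s)"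
      using integral_rate_deriv_ae[OF x, of v]
    proof eventually_elim
      case (elim s)
      show ?case
      proof
        assume "v < s \<and> s < t"
        then have "((\<lambda>s. integral {v..s} (r x)) has_real_derivative r x s) (at s)" using elim by auto
        then show "(F has_real_derivative r x s * F s) (at s)"
          unfolding F_def by (auto intro!: derivative_eq_intros)
      qed
    qed
    have "r x \<in> borel_measurable borel" using x by measurable
    then show "(\<lambda>s. r x s * F s) \<in> borel_measurable borel" using Fm by measurable
  qed (use rate_nonneg[OF x] in \<open>auto simp: F_def\<close>)
  also have "F t - F v = 1 - survival v t x"
    using surv[of t] surv[of v] \<open>v \<le> t\<close> survival_trivial[of t t x] by simp
  finally have "(\<integral>\<^sup>+s\<in>{v<..<t}. ennreal (r x s * F s) \<partial>lborel) = ennreal (1 - survival v t x)" .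
  moreover have "(\<integral>\<^sup>+s\<in>{v<..<t}. ennreal (r x s) * ennreal (survival s t x) \<partial>lborel) =
      (\<integral>\<^sup>+s\<in>{v<..<t}. ennreal (r x s * F s) \<partial>lborel)"
    using surv rate_nonneg[OF x] F_nonneg
    by (intro nn_integral_cong) (auto split: split_indicator simp: ennreal_mult)
  ultimately show ?thesis by simp
qed

text \<open>The test function carries a parameter \<open>p\<close> because the last-jump formula
  uses \<open>last_jump v t f\<close>, which varies with the time \<open>v\<close> being integrated.
  Joint measurability in all arguments is what the induction through both integrals needs.\<close>

lemma jumps_measurable:
  assumes f: "(\<lambda>(p, y). f p y) \<in> borel_measurable (P \<Otimes>\<^sub>M M)"
  shows "(\<lambda>(u, x, t, p). jumps n u x t (f p)) \<in> borel_measurable (borel \<Otimes>\<^sub>M M \<Otimes>\<^sub>M borel \<Otimes>\<^sub>M P)"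
proof (induction n)
  case 0
  have "(\<lambda>(u, x, t, p). f p x) \<in> borel_measurable (borel \<Otimes>\<^sub>M M \<Otimes>\<^sub>M borel \<Otimes>\<^sub>M P)"
    using measurable_compose[OF _ f, of "\<lambda>(u, x, t, p). (p, x)" "borel \<Otimes>\<^sub>M M \<Otimes>\<^sub>M borel \<Otimes>\<^sub>M P"]
    by (simp add: case_prod_unfold)
  then show ?case unfolding case_prod_unfold jumps.simps by measurable
next
  case (Suc n)
  note [measurable] = Suc
  let ?S = "borel \<Otimes>\<^sub>M M \<Otimes>\<^sub>M borel \<Otimes>\<^sub>M P"
  have 1: "(\<lambda>((z, w), y). jumps n w y (fst (snd (snd z))) (f (snd (snd (snd z))))) \<in> borel_measurable ((?S \<Otimes>\<^sub>M borel) \<Otimes>\<^sub>M M)"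
    using measurable_compose[OF _ Suc, of "\<lambda>((z, w), y). (w, y, fst (snd (snd z)), snd (snd (snd z)))" "(?S \<Otimes>\<^sub>M borel) \<Otimes>\<^sub>M M"]
    by (simp add: case_prod_unfold)
  have 2: "(\<lambda>(z, w). \<integral>\<^sup>+y. ennreal (survival (fst z) w (fst (snd z))) * jumps n w y (fst (snd (snd z))) (f (snd (snd (snd z)))) \<partial>K (fst (snd z)) w)
      \<in> borel_measurable (?S \<Otimes>\<^sub>M borel)"
    unfolding case_prod_unfold
  proof (rule nn_integral_kernel_compose)
    show "(\<lambda>(p, y). ennreal (survival (fst (fst p)) (snd p) (fst (snd (fst p)))) *
        jumps n (snd p) y (fst (snd (snd (fst p)))) (f (snd (snd (snd (fst p))))))
      \<in> borel_measurable ((?S \<Otimes>\<^sub>M borel) \<Otimes>\<^sub>M M)"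
      using 1 unfolding case_prod_unfold by measurable
  qed measurable
  have "(\<lambda>z. \<integral>\<^sup>+w. (\<integral>\<^sup>+y. ennreal (survival (fst z) w (fst (snd z))) * jumps n w y (fst (snd (snd z))) (f (snd (snd (snd z)))) \<partial>K (fst (snd z)) w)
      * (if fst z < w \<and> w < fst (snd (snd z)) then 1 else 0) \<partial>lborel) \<in> borel_measurable ?S"
    using 2 by measurable
  moreover have "(if a < w \<and> w < b then 1 else 0) = (indicator {a<..<b} w :: ennreal)" for a w b :: real
    by (auto split: split_indicator)
  ultimately show ?case by (simp add: case_prod_unfold)
qed

lemma jumps_compose:
  assumes "u \<in> borel_measurable N" "x \<in> N \<rightarrow>\<^sub>M M" "t \<in> borel_measurable N"
    and f: "(\<lambda>(w, y). f w y) \<in> borel_measurable (N \<Otimes>\<^sub>M M)"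
  shows "(\<lambda>w. jumps n (u w) (x w) (t w) (f w)) \<in> borel_measurable N"
proof -
  have "(\<lambda>w. (u w, x w, t w, w)) \<in> N \<rightarrow>\<^sub>M borel \<Otimes>\<^sub>M M \<Otimes>\<^sub>M borel \<Otimes>\<^sub>M N"
    using assms by measurable
  from measurable_compose[OF this jumps_measurable[OF f, of n]] show ?thesis by simp
qed

end

section \<open>The jump expansion as a measure and its last-jump equation\<close>

lemma point_measure_exists:
  assumes "x \<in> space M"
  shows "\<exists>\<rho>. sets \<rho> = sets M \<and> (\<forall>f\<in>borel_measurable M. (\<integral>\<^sup>+y. f y \<partial>\<rho>) = f x * c)"
proof (intro exI[of _ "distr (density (count_space {()}) (\<lambda>_. c)) M (\<lambda>_. x)"] conjI ballI)
  fix f :: "'a \<Rightarrow> ennreal" assume "f \<in> borel_measurable M"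
  then show "(\<integral>\<^sup>+y. f y \<partial>distr (density (count_space {()}) (\<lambda>_. c)) M (\<lambda>_. x)) = f x * c"
    using assms by (simp add: nn_integral_distr nn_integral_density nn_integral_count_space_finite emeasure_density mult.commute)
qed simp

lemma sum_measure_exists:
  assumes "sets \<rho>1 = sets M" "sets \<rho>2 = sets M"
  shows "\<exists>\<rho>. sets \<rho> = sets M \<and>
    (\<forall>f\<in>borel_measurable M. (\<integral>\<^sup>+y. f y \<partial>\<rho>) = (\<integral>\<^sup>+y. f y \<partial>\<rho>1) + (\<integral>\<^sup>+y. f y \<partial>\<rho>2))"
  using mixture_exists[of "count_space (UNIV :: bool set)" "\<lambda>b. if b then \<rho>1 else \<rho>2" M] assms
  by (simp add: nn_integral_count_space_finite UNIV_bool add.commute)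

context jump_kernel
begin

lemma last_jump_compose [measurable (raw)]:
  assumes "v \<in> borel_measurable N" "t \<in> borel_measurable N" "z \<in> N \<rightarrow>\<^sub>M M"
    and f: "(\<lambda>(w, y). f w y) \<in> borel_measurable (N \<Otimes>\<^sub>M M)"
  shows "(\<lambda>w. last_jump (v w) (t w) (f w) (z w)) \<in> borel_measurable N"
  unfolding last_jump_def
proof (rule nn_integral_kernel_compose)
  note [measurable] = assms(1,2)
  show "(\<lambda>(w, y). ennreal (survival (v w) (t w) y) * f w y) \<in> borel_measurable (N \<Otimes>\<^sub>M M)"
    using f unfolding case_prod_unfold by measurable
qed fact+

text \<open>Induction on the number of jumps: the first jump at time \<open>w\<close> is split off,
  the hypothesis splits the remaining path at its last jump at time \<open>v\<close>, and the two
  time integrals are exchanged over the triangle \<open>u < w < v < t\<close>.\<close>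

lemma jumps_Suc_last:
  assumes f: "f \<in> borel_measurable M"
  shows "x \<in> space M \<Longrightarrow> jumps (Suc n) u x t f = (\<integral>\<^sup>+v\<in>{u<..<t}. jumps n u x v (last_jump v t f) \<partial>lborel)"
proof (induction n arbitrary: u x)
  case 0
  have "(\<integral>\<^sup>+y. ennreal (survival u w x) * (f y * ennreal (survival w t y)) \<partial>K x w) =
      last_jump w t f x * ennreal (survival u w x)" for w
    unfolding last_jump_def using f
    by (subst nn_integral_cmult) (simp_all add: measurable_kernel_eq[OF 0] mult.commute)
  then show ?case by simp
next
  case (Suc n)
  note x = \<open>x \<in> space M\<close>
  have Lm: "(\<lambda>(v, y). last_jump v t f y) \<in> borel_measurable (borel \<Otimes>\<^sub>M M)"
    using last_jump_compose[of fst "borel \<Otimes>\<^sub>M M" "\<lambda>_. t" snd "\<lambda>_. f"] f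
    by (simp add: case_prod_unfold)
  have Jm: "(\<lambda>((w, v), y). jumps n w y v (last_jump v t f)) \<in> borel_measurable ((borel \<Otimes>\<^sub>M borel) \<Otimes>\<^sub>M M)"
  proof -
    have "(\<lambda>p. jumps n (fst (fst p)) (snd p) (snd (fst p)) (last_jump (snd (fst p)) t f))
        \<in> borel_measurable ((borel \<Otimes>\<^sub>M borel) \<Otimes>\<^sub>M M)"
    proof (rule jumps_compose)
      have "(\<lambda>q. (snd (fst (fst q)), snd q)) \<in> ((borel \<Otimes>\<^sub>M borel) \<Otimes>\<^sub>M M) \<Otimes>\<^sub>M M \<rightarrow>\<^sub>M (borel \<Otimes>\<^sub>M M)" by measurable
      from measurable_compose[OF this Lm]
      show "(\<lambda>(p, y). last_jump (snd (fst p)) t f y) \<in> borel_measurable (((borel \<Otimes>\<^sub>M borel) \<Otimes>\<^sub>M M) \<Otimes>\<^sub>M M)"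
        by (simp add: case_prod_unfold)
    qed measurable
    then show ?thesis by (simp add: case_prod_unfold)
  qed
  \<comment> \<open>The triangle is encoded as a factor of the integrand so that all integrals range
    over fixed spaces when they are exchanged.\<close>
  define F where "F = (\<lambda>w v y. (if u < w \<and> w < t \<and> w < v \<and> v < t then 1 else 0 :: ennreal) *
    (ennreal (survival u w x) * jumps n w y v (last_jump v t f)))"
  have Fm: "(\<lambda>((w, v), y). F w v y) \<in> borel_measurable ((borel \<Otimes>\<^sub>M borel) \<Otimes>\<^sub>M M)"
    using Jm x unfolding F_def case_prod_unfold by measurable
  have Jm1: "(\<lambda>y. jumps n w y v (last_jump v t f)) \<in> borel_measurable M" for w v
    using measurable_compose[OF _ Jm, of "\<lambda>y. ((w, v), y)" M] by simp
  have Jm2: "(\<lambda>v. jumps n w y v (last_jump v t f)) \<in> borel_measurable borel" if "y \<in> space M" for w y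
    using measurable_compose[OF _ Jm, of "\<lambda>v. ((w, v), y)" borel] that by simp
  have "jumps (Suc (Suc n)) u x t f = (\<integral>\<^sup>+w. (\<integral>\<^sup>+y. (\<integral>\<^sup>+v. F w v y \<partial>lborel) \<partial>K x w) \<partial>lborel)"
    unfolding jumps.simps(2)[of "Suc n"]
  proof (rule nn_integral_cong)
    fix w :: real
    show "(\<integral>\<^sup>+y. ennreal (survival u w x) * jumps (Suc n) w y t f \<partial>K x w) * indicator {u<..<t} w =
        (\<integral>\<^sup>+y. (\<integral>\<^sup>+v. F w v y \<partial>lborel) \<partial>K x w)"
    proof (cases "u < w \<and> w < t")
      case True
      have "ennreal (survival u w x) * jumps (Suc n) w y t f = (\<integral>\<^sup>+v. F w v y \<partial>lborel)" if "y \<in> space M" for y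
        unfolding Suc.IH[OF that] using Jm2[OF that] True
        by (subst nn_integral_cmult[symmetric])
           (auto simp: F_def intro!: nn_integral_cong split: split_indicator)
      then have "(\<integral>\<^sup>+y. ennreal (survival u w x) * jumps (Suc n) w y t f \<partial>K x w) = (\<integral>\<^sup>+y. (\<integral>\<^sup>+v. F w v y \<partial>lborel) \<partial>K x w)"
        by (intro nn_integral_cong) (simp only: space_kernel[OF x])
      then show ?thesis using True by simp
    qed (auto simp: F_def)
  qed
  also have "\<dots> = (\<integral>\<^sup>+v. (\<integral>\<^sup>+w. (\<integral>\<^sup>+y. F w v y \<partial>K x w) \<partial>lborel) \<partial>lborel)"
  proof (rule nn_integral_kernel_swap[where M=M])
    show "(\<lambda>w. emeasure (K x w) B) \<in> borel_measurable borel" if "B \<in> sets M" for B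
      using measurable_compose[OF _ kernel_measurable[OF that], of "\<lambda>w. (x, w)" borel] x by simp
  qed (use Fm sets_kernel[OF x] finite_kernel[OF x] in auto)
  also have "\<dots> = (\<integral>\<^sup>+v\<in>{u<..<t}. jumps (Suc n) u x v (last_jump v t f) \<partial>lborel)"
  proof (rule nn_integral_cong)
    fix v :: real
    show "(\<integral>\<^sup>+w. (\<integral>\<^sup>+y. F w v y \<partial>K x w) \<partial>lborel) = jumps (Suc n) u x v (last_jump v t f) * indicator {u<..<t} v"
    proof (cases "u < v \<and> v < t")
      case True
      \<comment> \<open>For fixed \<open>v\<close> the integrals over \<open>w < v\<close> are the
        first-jump recursion for a path ending at \<open>v\<close>.\<close>
      have "(\<integral>\<^sup>+y. F w v y \<partial>K x w) = (\<integral>\<^sup>+y. ennreal (survival u w x) * jumps n w y v (last_jump v t f) \<partial>K x w) * indicator {u<..<v} w" for w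
        using True by (auto simp: F_def split: split_indicator)
      then show ?thesis using True by simp
    next
      case False
      then have "F w v y = 0" for w y by (auto simp: F_def)
      then show ?thesis using False by auto
    qed
  qed
  finally show ?case .
qed

lemma jumps_measurable_start:
  assumes "f \<in> borel_measurable M"
  shows "(\<lambda>(w, y). jumps n w y t f) \<in> borel_measurable (borel \<Otimes>\<^sub>M M)"
proof -
  have "(\<lambda>p. jumps n (fst p) (snd p) t f) \<in> borel_measurable (borel \<Otimes>\<^sub>M M)"
    using assms by (intro jumps_compose) (simp_all add: case_prod_unfold)
  then show ?thesis by (simp add: case_prod_unfold)
qed

lemma jumps_measurable_start' [measurable]:
  assumes "f \<in> borel_measurable M"
  shows "(\<lambda>y. jumps n w y t f) \<in> borel_measurable M"
  using measurable_compose[OF _ jumps_measurable_start[OF assms], of "\<lambda>y. (w, y)" M n t] by simp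

text \<open>Two mixtures follow the recursion: over the landing point \<open>y\<close> with weight
  \<open>survival u w x\<close>, then over the jump time \<open>w\<close>.\<close>

lemma jumps_measure_exists:
  "x \<in> space M \<Longrightarrow> \<exists>\<rho>. sets \<rho> = sets M \<and> (\<forall>f\<in>borel_measurable M. (\<integral>\<^sup>+y. f y \<partial>\<rho>) = jumps n u x t f)"
proof (induction n arbitrary: u x)
  case 0
  then show ?case using point_measure_exists[of x M "ennreal (survival u t x)"] by simp
next
  case (Suc n)
  note x = \<open>x \<in> space M\<close>
  \<comment> \<open>The measures are selected arbitrarily for each \<open>y\<close>; their values on
    sets are prescribed by \<open>jumps\<close>, and this gives the measurability in
    \<open>y\<close> that mixing requires.\<close>
  define \<rho> where "\<rho> = (\<lambda>w y. SOME \<rho>. sets \<rho> = sets M \<and> (\<forall>f\<in>borel_measurable M. (\<integral>\<^sup>+y. f y \<partial>\<rho>) = jumps n w y t f))"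
  have \<rho>: "sets (\<rho> w y) = sets M" "f \<in> borel_measurable M \<Longrightarrow> (\<integral>\<^sup>+y. f y \<partial>\<rho> w y) = jumps n w y t f"
    if "y \<in> space M" for w y f
    using someI_ex[OF Suc.IH[OF that, of w]] by (auto simp: \<rho>_def)
  have em: "emeasure (\<rho> w y) B = jumps n w y t (indicator B)" if "y \<in> space M" "B \<in> sets M" for w y B
    using \<rho>(1)[OF that(1), of w] \<rho>(2)[OF that(1), of "indicator B" w] that(2) by simp
  have "\<exists>\<sigma>. sets \<sigma> = sets M \<and> (\<forall>f\<in>borel_measurable M. (\<integral>\<^sup>+y. f y \<partial>\<sigma>) =
      (\<integral>\<^sup>+y. ennreal (survival u w x) * jumps n w y t f \<partial>K x w))" for w
  proof -
    have "\<exists>\<sigma>. sets \<sigma> = sets M \<and> (\<forall>f\<in>borel_measurable M. (\<integral>\<^sup>+y. f y \<partial>\<sigma>) =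
      (\<integral>\<^sup>+y. (\<integral>\<^sup>+z. f z \<partial>\<rho> w y) \<partial>density (K x w) (\<lambda>_. ennreal (survival u w x))))"
    proof (rule mixture_exists)
      fix B assume B: "B \<in> sets M"
      have "(\<lambda>y. jumps n w y t (indicator B)) \<in> borel_measurable M" using B by measurable
      then have "(\<lambda>y. emeasure (\<rho> w y) B) \<in> borel_measurable M"
        using em[OF _ B] by (simp cong: measurable_cong)
      then show "(\<lambda>y. emeasure (\<rho> w y) B) \<in> borel_measurable (density (K x w) (\<lambda>_. ennreal (survival u w x)))"
        by (simp add: measurable_kernel_eq[OF x])
    qed (use \<rho> space_kernel[OF x] in auto)
    moreover have "(\<integral>\<^sup>+y. (\<integral>\<^sup>+z. f z \<partial>\<rho> w y) \<partial>density (K x w) (\<lambda>_. ennreal (survival u w x))) =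
        (\<integral>\<^sup>+y. ennreal (survival u w x) * jumps n w y t f \<partial>K x w)" if f: "f \<in> borel_measurable M" for f
    proof -
      have "(\<lambda>y. jumps n w y t f) \<in> borel_measurable M" using f by measurable
      moreover have "(\<lambda>y. \<integral>\<^sup>+z. f z \<partial>\<rho> w y) \<in> borel_measurable M \<longleftrightarrow> (\<lambda>y. jumps n w y t f) \<in> borel_measurable M"
        by (intro measurable_cong \<rho>(2) f)
      ultimately have "(\<lambda>y. \<integral>\<^sup>+z. f z \<partial>\<rho> w y) \<in> borel_measurable (K x w)"
        by (simp add: measurable_kernel_eq[OF x])
      then show ?thesis using \<rho>(2)[OF _ f] space_kernel[OF x]
        by (subst nn_integral_density) (auto intro!: nn_integral_cong)
    qed
    ultimately show ?thesis by auto
  qed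
  then obtain \<sigma> where \<sigma>: "\<forall>w. sets (\<sigma> w) = sets M \<and> (\<forall>f\<in>borel_measurable M. (\<integral>\<^sup>+y. f y \<partial>\<sigma> w) =
      (\<integral>\<^sup>+y. ennreal (survival u w x) * jumps n w y t f \<partial>K x w))"
    using choice[of "\<lambda>w \<sigma>. sets \<sigma> = sets M \<and> (\<forall>f\<in>borel_measurable M. (\<integral>\<^sup>+y. f y \<partial>\<sigma>) =
      (\<integral>\<^sup>+y. ennreal (survival u w x) * jumps n w y t f \<partial>K x w))"] by blast
  have \<sigma>m: "(\<lambda>w. \<integral>\<^sup>+y. ennreal (survival u w x) * jumps n w y t f \<partial>K x w) \<in> borel_measurable borel"
    if "f \<in> borel_measurable M" for f
  proof (rule nn_integral_kernel_compose)
    show "(\<lambda>(w, y). ennreal (survival u w x) * jumps n w y t f) \<in> borel_measurable (borel \<Otimes>\<^sub>M M)"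
      using jumps_measurable_start[OF that] x unfolding case_prod_unfold by measurable
  qed (use x in measurable)
  have "\<exists>\<rho>. sets \<rho> = sets M \<and> (\<forall>f\<in>borel_measurable M. (\<integral>\<^sup>+y. f y \<partial>\<rho>) =
      (\<integral>\<^sup>+w. (\<integral>\<^sup>+z. f z \<partial>\<sigma> w) \<partial>density lborel (indicator {u<..<t})))"
  proof (rule mixture_exists)
    fix B assume B: "B \<in> sets M"
    then have "emeasure (\<sigma> w) B = (\<integral>\<^sup>+y. ennreal (survival u w x) * jumps n w y t (indicator B) \<partial>K x w)" for w
      using \<sigma>[rule_format, of w] bspec[OF conjunct2[OF \<sigma>[rule_format, of w]], of "indicator B"] by simp
    then show "(\<lambda>w. emeasure (\<sigma> w) B) \<in> borel_measurable (density lborel (indicator {u<..<t}))"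
      using \<sigma>m[of "indicator B"] B by simp
  qed (use \<sigma> in auto)
  moreover have "(\<integral>\<^sup>+w. (\<integral>\<^sup>+z. f z \<partial>\<sigma> w) \<partial>density lborel (indicator {u<..<t})) = jumps (Suc n) u x t f"
    if f: "f \<in> borel_measurable M" for f
    using \<sigma>m[OF f] \<sigma> f by (simp add: nn_integral_density mult.commute)
  ultimately show ?case by auto
qed

text \<open>The index set \<open>UNIV\<close> gives the whole expansion, a finite index set the
  partial sums that are later compared with a competitor.\<close>

lemma jumps_sum_measure_exists:
  assumes x: "x \<in> space M"
  shows "\<exists>\<rho>. sets \<rho> = sets M \<and>
    (\<forall>f\<in>borel_measurable M. (\<integral>\<^sup>+y. f y \<partial>\<rho>) = (\<integral>\<^sup>+n. jumps n u x t f \<partial>count_space I))"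
proof -
  obtain \<rho> where \<rho>: "\<forall>n. sets (\<rho> n) = sets M \<and> (\<forall>f\<in>borel_measurable M. (\<integral>\<^sup>+y. f y \<partial>\<rho> n) = jumps n u x t f)"
    using choice[of "\<lambda>n \<rho>. sets \<rho> = sets M \<and> (\<forall>f\<in>borel_measurable M. (\<integral>\<^sup>+y. f y \<partial>\<rho>) = jumps n u x t f)"]
      jumps_measure_exists[OF x, of _ u t] by blast
  have "\<exists>\<sigma>. sets \<sigma> = sets M \<and>
    (\<forall>f\<in>borel_measurable M. (\<integral>\<^sup>+y. f y \<partial>\<sigma>) = (\<integral>\<^sup>+n. (\<integral>\<^sup>+y. f y \<partial>\<rho> n) \<partial>count_space I))"
    by (rule mixture_exists) (use \<rho> in auto)
  then show ?thesis using \<rho> by auto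
qed

text \<open>\<open>P_bar\<close> as a measure in its last argument. The choice is harmless: the
  prescribed integrals determine the measure.\<close>

definition transition :: "real \<Rightarrow> 'a \<Rightarrow> real \<Rightarrow> 'a measure" where
  "transition u x t = (SOME \<rho>. sets \<rho> = sets M \<and>
    (\<forall>f\<in>borel_measurable M. (\<integral>\<^sup>+y. f y \<partial>\<rho>) = (\<Sum>n. jumps n u x t f)))"

lemma
  assumes x: "x \<in> space M"
  shows sets_transition: "sets (transition u x t) = sets M"
    and nn_integral_transition:
      "f \<in> borel_measurable M \<Longrightarrow> (\<integral>\<^sup>+y. f y \<partial>transition u x t) = (\<Sum>n. jumps n u x t f)"
  using someI_ex[OF jumps_sum_measure_exists[OF x, where u=u and t=t and I=UNIV]]
  by (auto simp: transition_def nn_integral_count_space_nat)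

lemma emeasure_transition:
  assumes "x \<in> space M" "B \<in> sets M"
  shows "emeasure (transition u x t) B = (\<Sum>n. jumps n u x t (indicator B))"
  using nn_integral_transition[OF assms(1), of "indicator B"] sets_transition[OF assms(1)] assms(2) by simp

text \<open>The path either survives until \<open>t\<close> or jumps first at some time
  \<open>w\<close>, after which the hypothesis for \<open>N\<close> bounds the rest by 1. The kernel
  mass equals the rate, so the second case has at most the probability
  \<open>1 - survival u t x\<close>.\<close>

lemma sum_jumps_le_1:
  "x \<in> space M \<Longrightarrow> (\<Sum>n<N. jumps n u x t (\<lambda>_. 1)) \<le> 1"
proof (induction N arbitrary: u x)
  case (Suc N)
  note x = \<open>x \<in> space M\<close>
  have m: "(\<lambda>w. \<integral>\<^sup>+y. ennreal (survival u w x) * jumps n w y t (\<lambda>_. 1) \<partial>K x w) \<in> borel_measurable borel" for n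
  proof (rule nn_integral_kernel_compose)
    show "(\<lambda>(w, y). ennreal (survival u w x) * jumps n w y t (\<lambda>_. 1)) \<in> borel_measurable (borel \<Otimes>\<^sub>M M)"
      using jumps_measurable_start[of "\<lambda>_. 1" n t] x unfolding case_prod_unfold by measurable
  qed (use x in measurable)
  have "(\<Sum>n<Suc N. jumps n u x t (\<lambda>_. 1)) =
      ennreal (survival u t x) + (\<Sum>n<N. jumps (Suc n) u x t (\<lambda>_. 1))"
    by (simp only: sum.lessThan_Suc_shift) simp
  also have "(\<Sum>n<N. jumps (Suc n) u x t (\<lambda>_. 1)) =
    (\<integral>\<^sup>+w\<in>{u<..<t}. (\<Sum>n<N. \<integral>\<^sup>+y. ennreal (survival u w x) * jumps n w y t (\<lambda>_. 1) \<partial>K x w) \<partial>lborel)"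
    using m by (simp add: nn_integral_sum[symmetric] sum_distrib_right)
  also have "\<dots> \<le> (\<integral>\<^sup>+w\<in>{u<..<t}. ennreal (r x w) * ennreal (survival u w x) \<partial>lborel)"
  proof (intro nn_integral_mono mult_right_mono)
    fix w
    have "(\<Sum>n<N. \<integral>\<^sup>+y. ennreal (survival u w x) * jumps n w y t (\<lambda>_. 1) \<partial>K x w) =
        (\<integral>\<^sup>+y. (\<Sum>n<N. ennreal (survival u w x) * jumps n w y t (\<lambda>_. 1)) \<partial>K x w)"
      by (intro nn_integral_sum[symmetric]) (simp add: measurable_kernel_eq[OF x])
    also have "\<dots> \<le> (\<integral>\<^sup>+y. ennreal (survival u w x) \<partial>K x w)"
    proof (intro nn_integral_mono)
      fix y assume "y \<in> space (K x w)"
      then have "(\<Sum>n<N. jumps n w y t (\<lambda>_. 1)) \<le> 1" using Suc.IH space_kernel[OF x] by simp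
      from mult_left_mono[OF this, of "ennreal (survival u w x)"]
      show "(\<Sum>n<N. ennreal (survival u w x) * jumps n w y t (\<lambda>_. 1)) \<le> ennreal (survival u w x)"
        by (simp add: sum_distrib_left)
    qed
    also have "\<dots> = ennreal (r x w) * ennreal (survival u w x)"
      by (simp add: space_kernel[OF x] kernel_space[OF x] mult.commute)
    finally show "(\<Sum>n<N. \<integral>\<^sup>+y. ennreal (survival u w x) * jumps n w y t (\<lambda>_. 1) \<partial>K x w)
        \<le> ennreal (r x w) * ennreal (survival u w x)" .
  qed simp
  also have "\<dots> \<le> ennreal (1 - survival u t x)"
  proof (cases "u \<le> t")
    case True
    then show ?thesis using integral_rate_survival_forward[OF x True] by simp
  next
    case False
    \<comment> \<open>No order between \<open>u\<close> and \<open>t\<close> is assumed; for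
      \<open>t < u\<close> only the term without jumps remains.\<close>
    then have "{u<..<t} = {}" by auto
    then show ?thesis by simp
  qed
  also have "ennreal (survival u t x) + ennreal (1 - survival u t x) = 1"
    using survival_le_1[OF x, of u t] by (subst ennreal_plus[symmetric]) auto
  finally show ?case by (simp add: add_left_mono)
qed simp

lemma transition_space_le_1: "x \<in> space M \<Longrightarrow> emeasure (transition u x t) (space M) \<le> 1"
proof -
  assume x: "x \<in> space M"
  have "emeasure (transition u x t) (space M) = (\<integral>\<^sup>+y. 1 \<partial>transition u x t)"
    using sets_eq_imp_space_eq[OF sets_transition[OF x]] by simp
  also have "\<dots> = (\<Sum>n. jumps n u x t (\<lambda>_. 1))" using nn_integral_transition[OF x, of "\<lambda>_. 1"] by simp
  also have "\<dots> \<le> 1" by (intro suminf_le_const sum_jumps_le_1[OF x]) simp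
  finally show ?thesis .
qed

lemma finite_transition: "x \<in> space M \<Longrightarrow> finite_measure (transition u x t)"
proof (rule finite_measureI)
  assume x: "x \<in> space M"
  show "emeasure (transition u x t) (space (transition u x t)) \<noteq> \<infinity>"
    using transition_space_le_1[OF x, of u t] sets_eq_imp_space_eq[OF sets_transition[OF x]]
    by (auto simp: top_unique)
qed

lemma transition_measurable:
  assumes x: "x \<in> space M" and B: "B \<in> sets M"
  shows "(\<lambda>t. emeasure (transition u x t) B) \<in> borel_measurable borel"
proof -
  have "(\<lambda>t. jumps n u x t (indicator B)) \<in> borel_measurable borel" for n
    using x B by (intro jumps_compose) (simp_all add: case_prod_unfold)
  then show ?thesis unfolding emeasure_transition[OF assms] by measurable
qed

text \<open>The term with no jump is kept apart; \<open>jumps_Suc_last\<close> is summed over the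
  others.\<close>

lemma transition_last_jump:
  assumes x: "x \<in> space M" and f: "f \<in> borel_measurable M"
  shows "(\<integral>\<^sup>+y. f y \<partial>transition u x t) = f x * ennreal (survival u t x) +
    (\<integral>\<^sup>+v\<in>{u<..<t}. (\<integral>\<^sup>+z. last_jump v t f z \<partial>transition u x v) \<partial>lborel)"
proof -
  have Lm: "(\<lambda>(v, y). last_jump v t f y) \<in> borel_measurable (borel \<Otimes>\<^sub>M M)"
    using last_jump_compose[of fst "borel \<Otimes>\<^sub>M M" "\<lambda>_. t" snd "\<lambda>_. f"] f
    by (simp add: case_prod_unfold)
  have Jm: "(\<lambda>v. jumps n u x v (last_jump v t f)) \<in> borel_measurable borel" for n
    using x Lm by (intro jumps_compose) simp_all
  have Lm1: "last_jump v t f \<in> borel_measurable M" for v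
    using measurable_compose[OF _ Lm, of "\<lambda>y. (v, y)" M] by simp
  have "(\<integral>\<^sup>+y. f y \<partial>transition u x t) = (\<Sum>n. jumps n u x t f)"
    by (rule nn_integral_transition[OF x f])
  also have "\<dots> = jumps 0 u x t f + (\<Sum>n. jumps (Suc n) u x t f)"
    using sums_Suc[OF summable_sums[of "\<lambda>n. jumps (Suc n) u x t f"]] by (simp add: sums_iff add.commute)
  also have "(\<Sum>n. jumps (Suc n) u x t f) = (\<Sum>n. \<integral>\<^sup>+v\<in>{u<..<t}. jumps n u x v (last_jump v t f) \<partial>lborel)"
    unfolding jumps_Suc_last[OF f x] ..
  also have "\<dots> = (\<integral>\<^sup>+v. (\<Sum>n. jumps n u x v (last_jump v t f) * indicator {u<..<t} v) \<partial>lborel)"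
    using Jm by (intro nn_integral_suminf[symmetric] borel_measurable_times_ennreal) auto
  also have "\<dots> = (\<integral>\<^sup>+v\<in>{u<..<t}. (\<integral>\<^sup>+z. last_jump v t f z \<partial>transition u x v) \<partial>lborel)"
    unfolding nn_integral_transition[OF x Lm1] by simp
  finally show ?thesis by simp
qed

end

section \<open>Duality between the two forward equations\<close>

text \<open>Restricting both measures to \<open>B\<close> by a density turns agreement on subsets of
  \<open>B\<close> into equality of measures. Agreement is available only there, since the forward
  equation is given on \<open>q\<close>-bounded sets.\<close>

lemma nn_integral_eq_on_subset:
  assumes L: "sets L = sets M" and R: "sets R = sets M" and B: "B \<in> sets M" and f: "f \<in> borel_measurable M"
    and eq: "\<And>C. C \<in> sets M \<Longrightarrow> C \<subseteq> B \<Longrightarrow> emeasure L C = emeasure R C"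
  shows "(\<integral>\<^sup>+y. f y * indicator B y \<partial>L) = (\<integral>\<^sup>+y. f y * indicator B y \<partial>R)"
proof -
  have dens: "emeasure (density N (indicator B)) C = emeasure N (B \<inter> C)" if "sets N = sets M" "C \<in> sets M" for N C
    using that B by (simp add: emeasure_density indicator_inter_arith[symmetric])
  have "density L (indicator B) = density R (indicator B)"
  proof (rule measure_eqI)
    fix C assume "C \<in> sets (density L (indicator B))"
    then have C: "C \<in> sets M" using L by simp
    show "emeasure (density L (indicator B)) C = emeasure (density R (indicator B)) C"
      unfolding dens[OF L C] dens[OF R C] using B C by (intro eq) auto
  qed (simp add: L R)
  moreover have "(\<integral>\<^sup>+y. f y \<partial>density N (indicator B)) = (\<integral>\<^sup>+y. f y * indicator B y \<partial>N)" if N: "sets N = sets M" for N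
    using f B N by (subst nn_integral_density) (simp_all add: measurable_cong_sets[OF N refl] mult.commute)
  ultimately show ?thesis using L R by metis
qed

text \<open>\<open>\<kappa> v\<close> plays the role of \<open>P u x v\<close> with \<open>u\<close>
  and \<open>x\<close> frozen. Both \<open>transition u x\<close> and any competitor are instances,
  which allows each direction of the duality to be proved once.\<close>

locale forward_family = jump_kernel M r K
  for M :: "'a measure" and r :: "'a \<Rightarrow> real \<Rightarrow> real" and K :: "'a \<Rightarrow> real \<Rightarrow> 'a measure" +
  fixes \<kappa> :: "real \<Rightarrow> 'a measure"
  assumes sets_path: "\<And>v. sets (\<kappa> v) = sets M"
    and finite_path: "\<And>v. finite_measure (\<kappa> v)"
    and path_measurable: "\<And>B. B \<in> sets M \<Longrightarrow> (\<lambda>v. emeasure (\<kappa> v) B) \<in> borel_measurable borel"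
begin

definition path_int :: "real \<Rightarrow> real \<Rightarrow> (real \<Rightarrow> 'a \<Rightarrow> ennreal) \<Rightarrow> ennreal" where
  "path_int u t g = (\<integral>\<^sup>+v\<in>{u<..<t}. (\<integral>\<^sup>+y. g v y \<partial>\<kappa> v) \<partial>lborel)"

text \<open>Integration against the flux of jumps: \<open>z\<close> is the state left at time
  \<open>v\<close>, distributed by \<open>\<kappa> v\<close>, and \<open>g\<close> is evaluated at
  the landing point \<open>y\<close>.\<close>

definition jump_int :: "real \<Rightarrow> real \<Rightarrow> (real \<Rightarrow> 'a \<Rightarrow> ennreal) \<Rightarrow> ennreal" where
  "jump_int u t g = (\<integral>\<^sup>+v\<in>{u<..<t}. (\<integral>\<^sup>+z. (\<integral>\<^sup>+y. g v y \<partial>K z v) \<partial>\<kappa> v) \<partial>lborel)"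

lemma space_path: "space (\<kappa> v) = space M"
  using sets_path by (rule sets_eq_imp_space_eq)

lemma measurable_path_eq: "measurable (\<kappa> v) N = measurable M N"
  by (rule measurable_cong_sets[OF sets_path refl])

lemma nn_integral_path_compose [measurable (raw)]:
  assumes v: "v \<in> borel_measurable N"
    and f: "(\<lambda>(w, y). f w y) \<in> borel_measurable (N \<Otimes>\<^sub>M M)"
  shows "(\<lambda>w. \<integral>\<^sup>+y. f w y \<partial>\<kappa> (v w)) \<in> borel_measurable N"
proof (rule nn_integral_kernel_measurable[where M=M])
  fix B assume "B \<in> sets M"
  from measurable_compose[OF v path_measurable[OF this]]
  show "(\<lambda>w. emeasure (\<kappa> (v w)) B) \<in> borel_measurable N" .
qed (use f sets_path finite_path in auto)

lemma section_measurable: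
  assumes "(\<lambda>(v, y). g v y) \<in> borel_measurable (borel \<Otimes>\<^sub>M M)"
  shows "g v \<in> borel_measurable M"
  using measurable_compose[OF _ assms, of "\<lambda>y. (v, y)" M] by simp

lemma nn_integral_jump_measurable:
  assumes "(\<lambda>(w, y). g w y) \<in> borel_measurable (N \<Otimes>\<^sub>M M)" "v \<in> borel_measurable N"
  shows "(\<lambda>(w, z). \<integral>\<^sup>+y. g w y \<partial>K z (v w)) \<in> borel_measurable (N \<Otimes>\<^sub>M M)"
proof -
  have "(\<lambda>p. \<integral>\<^sup>+y. g (fst p) y \<partial>K (snd p) (v (fst p))) \<in> borel_measurable (N \<Otimes>\<^sub>M M)"
  proof (rule nn_integral_kernel_compose)
    show "(\<lambda>p. v (fst p)) \<in> borel_measurable (N \<Otimes>\<^sub>M M)"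
      using measurable_compose[OF measurable_fst assms(2)] .
    show "(\<lambda>(p, y). g (fst p) y) \<in> borel_measurable ((N \<Otimes>\<^sub>M M) \<Otimes>\<^sub>M M)"
      using measurable_compose[OF _ assms(1), of "\<lambda>(p, y). (fst p, y)" "(N \<Otimes>\<^sub>M M) \<Otimes>\<^sub>M M"]
      by (simp add: case_prod_unfold)
  qed simp
  then show ?thesis by (simp add: case_prod_unfold)
qed

lemma path_measurable_integral:
  assumes "(\<lambda>(v, y). g v y) \<in> borel_measurable (borel \<Otimes>\<^sub>M M)"
  shows "(\<lambda>v. \<integral>\<^sup>+y. g v y \<partial>\<kappa> v) \<in> borel_measurable borel"
  using assms by (intro nn_integral_path_compose) simp_all

lemma jump_measurable_integral:
  assumes "(\<lambda>(v, y). g v y) \<in> borel_measurable (borel \<Otimes>\<^sub>M M)"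
  shows "(\<lambda>v. \<integral>\<^sup>+z. (\<integral>\<^sup>+y. g v y \<partial>K z v) \<partial>\<kappa> v) \<in> borel_measurable borel"
  using nn_integral_jump_measurable[OF assms, of "\<lambda>v. v"] by (intro path_measurable_integral) simp

lemma path_int_cong:
  assumes "\<And>v y. u < v \<Longrightarrow> v < t \<Longrightarrow> y \<in> space M \<Longrightarrow> g v y = h v y"
  shows "path_int u t g = path_int u t h"
  unfolding path_int_def using assms
  by (intro nn_integral_cong) (auto split: split_indicator simp: space_path intro!: nn_integral_cong)

lemma jump_int_cong:
  assumes "\<And>v y. u < v \<Longrightarrow> v < t \<Longrightarrow> y \<in> space M \<Longrightarrow> g v y = h v y"
  shows "jump_int u t g = jump_int u t h"
  unfolding jump_int_def using assms
  by (intro nn_integral_cong) (auto split: split_indicator simp: space_path space_kernel intro!: nn_integral_cong)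

lemma path_int_add:
  assumes "(\<lambda>(v, y). g v y) \<in> borel_measurable (borel \<Otimes>\<^sub>M M)" "(\<lambda>(v, y). h v y) \<in> borel_measurable (borel \<Otimes>\<^sub>M M)"
  shows "path_int u t (\<lambda>v y. g v y + h v y) = path_int u t g + path_int u t h"
proof -
  have "(\<integral>\<^sup>+y. g v y + h v y \<partial>\<kappa> v) = (\<integral>\<^sup>+y. g v y \<partial>\<kappa> v) + (\<integral>\<^sup>+y. h v y \<partial>\<kappa> v)" for v
    using assms[THEN section_measurable] by (intro nn_integral_add) (simp_all add: measurable_path_eq)
  then show ?thesis unfolding path_int_def using assms[THEN path_measurable_integral]
    by (simp add: distrib_right nn_integral_add)
qed

lemma jump_int_add:
  assumes "(\<lambda>(v, y). g v y) \<in> borel_measurable (borel \<Otimes>\<^sub>M M)" "(\<lambda>(v, y). h v y) \<in> borel_measurable (borel \<Otimes>\<^sub>M M)"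
  shows "jump_int u t (\<lambda>v y. g v y + h v y) = jump_int u t g + jump_int u t h"
proof -
  have 1: "(\<integral>\<^sup>+y. g v y + h v y \<partial>K z v) = (\<integral>\<^sup>+y. g v y \<partial>K z v) + (\<integral>\<^sup>+y. h v y \<partial>K z v)" if "z \<in> space M" for z v
    using assms[THEN section_measurable] by (intro nn_integral_add) (simp_all add: measurable_kernel_eq[OF that])
  note m = assms[THEN nn_integral_jump_measurable, of "\<lambda>v. v"]
  have "jump_int u t (\<lambda>v y. g v y + h v y) = path_int u t (\<lambda>v z. (\<integral>\<^sup>+y. g v y \<partial>K z v) + (\<integral>\<^sup>+y. h v y \<partial>K z v))"
    using path_int_cong[of u t "\<lambda>v z. \<integral>\<^sup>+y. g v y + h v y \<partial>K z v"] 1 by (simp add: jump_int_def path_int_def)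
  also have "\<dots> = jump_int u t g + jump_int u t h"
    using m by (subst path_int_add) (simp_all add: jump_int_def path_int_def)
  finally show ?thesis .
qed

lemma triangle_measurable:
  fixes u t :: real
  assumes "(\<lambda>((v, \<theta>), y). g v \<theta> y) \<in> borel_measurable ((borel \<Otimes>\<^sub>M borel) \<Otimes>\<^sub>M M)"
  shows "(\<lambda>((v, \<theta>), y). (if u < v \<and> v < \<theta> \<and> \<theta> < t then 1 else 0 :: ennreal) * g v \<theta> y)
    \<in> borel_measurable ((borel \<Otimes>\<^sub>M borel) \<Otimes>\<^sub>M M)"
  using assms unfolding case_prod_unfold by measurable

lemma path_int_measurable:
  assumes g: "(\<lambda>((v, \<theta>), y). g v \<theta> y) \<in> borel_measurable ((borel \<Otimes>\<^sub>M borel) \<Otimes>\<^sub>M M)"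
  shows "(\<lambda>\<theta>. path_int u \<theta> (\<lambda>v. g v \<theta>)) \<in> borel_measurable borel"
proof -
  have "(\<lambda>(q, y). g (snd q) (fst q) y) \<in> borel_measurable ((borel \<Otimes>\<^sub>M borel) \<Otimes>\<^sub>M M)"
    using measurable_compose[OF _ g, of "\<lambda>(q, y). ((snd q, fst q), y)" "(borel \<Otimes>\<^sub>M borel) \<Otimes>\<^sub>M M"]
    by (simp add: case_prod_unfold)
  then have "(\<lambda>q. \<integral>\<^sup>+y. g (snd q) (fst q) y \<partial>\<kappa> (snd q)) \<in> borel_measurable (borel \<Otimes>\<^sub>M borel)"
    by (intro nn_integral_path_compose) simp_all
  then have "(\<lambda>(\<theta>, v). (\<integral>\<^sup>+y. g v \<theta> y \<partial>\<kappa> v) * (if u < v \<and> v < \<theta> then 1 else 0)) \<in> borel_measurable (borel \<Otimes>\<^sub>M lborel)"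
    unfolding case_prod_unfold by measurable
  then have "(\<lambda>\<theta>. \<integral>\<^sup>+v. (\<integral>\<^sup>+y. g v \<theta> y \<partial>\<kappa> v) * (if u < v \<and> v < \<theta> then 1 else 0) \<partial>lborel) \<in> borel_measurable borel"
    by (rule lborel.borel_measurable_nn_integral)
  moreover have "(if u < v \<and> v < \<theta> then 1 else 0) = (indicator {u<..<\<theta>} v :: ennreal)" for v \<theta>
    by (auto split: split_indicator)
  ultimately show ?thesis by (simp add: path_int_def)
qed

lemma jump_int_measurable:
  assumes g: "(\<lambda>((v, \<theta>), y). g v \<theta> y) \<in> borel_measurable ((borel \<Otimes>\<^sub>M borel) \<Otimes>\<^sub>M M)"
  shows "(\<lambda>\<theta>. jump_int u \<theta> (\<lambda>v. g v \<theta>)) \<in> borel_measurable borel"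
proof -
  have "(\<lambda>((v, \<theta>), z). \<integral>\<^sup>+y. g v \<theta> y \<partial>K z v) \<in> borel_measurable ((borel \<Otimes>\<^sub>M borel) \<Otimes>\<^sub>M M)"
    using nn_integral_jump_measurable[of "\<lambda>p. g (fst p) (snd p)" "borel \<Otimes>\<^sub>M borel" fst] g
    by (simp add: case_prod_unfold)
  from path_int_measurable[OF this] show ?thesis by (simp add: jump_int_def path_int_def)
qed

text \<open>Tonelli on the triangle \<open>u < v < \<theta> < t\<close>, with the path measure
  attached to the earlier time \<open>v\<close>.\<close>

lemma nn_integral_path_int:
  assumes g: "(\<lambda>((v, \<theta>), y). g v \<theta> y) \<in> borel_measurable ((borel \<Otimes>\<^sub>M borel) \<Otimes>\<^sub>M M)"
  shows "(\<integral>\<^sup>+\<theta>\<in>{u<..<t}. path_int u \<theta> (\<lambda>v. g v \<theta>) \<partial>lborel) =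
    path_int u t (\<lambda>v y. \<integral>\<^sup>+\<theta>\<in>{v<..<t}. g v \<theta> y \<partial>lborel)"
proof -
  define F where "F = (\<lambda>v \<theta> y. (if u < v \<and> v < \<theta> \<and> \<theta> < t then 1 else 0 :: ennreal) * g v \<theta> y)"
  have F: "(\<lambda>((v, \<theta>), y). F v \<theta> y) \<in> borel_measurable ((borel \<Otimes>\<^sub>M borel) \<Otimes>\<^sub>M M)"
    unfolding F_def by (rule triangle_measurable[OF g])
  have "(\<integral>\<^sup>+\<theta>\<in>{u<..<t}. path_int u \<theta> (\<lambda>v. g v \<theta>) \<partial>lborel) = (\<integral>\<^sup>+\<theta>. (\<integral>\<^sup>+v. (\<integral>\<^sup>+y. F v \<theta> y \<partial>\<kappa> v) \<partial>lborel) \<partial>lborel)"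
  proof (intro nn_integral_cong)
    fix \<theta> :: real
    show "path_int u \<theta> (\<lambda>v. g v \<theta>) * indicator {u<..<t} \<theta> = (\<integral>\<^sup>+v. (\<integral>\<^sup>+y. F v \<theta> y \<partial>\<kappa> v) \<partial>lborel)"
    proof (cases "u < \<theta> \<and> \<theta> < t")
      case True
      then show ?thesis
        by (auto simp: path_int_def F_def split: split_indicator intro!: nn_integral_cong)
    next
      case False
      then have "F v \<theta> y = 0" for v y by (auto simp: F_def)
      then show ?thesis using False by auto
    qed
  qed
  also have "\<dots> = (\<integral>\<^sup>+v. (\<integral>\<^sup>+y. (\<integral>\<^sup>+\<theta>. F v \<theta> y \<partial>lborel) \<partial>\<kappa> v) \<partial>lborel)"
    using sets_path finite_path path_measurable F by (rule nn_integral_kernel_swap[symmetric])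
  also have "\<dots> = path_int u t (\<lambda>v y. \<integral>\<^sup>+\<theta>\<in>{v<..<t}. g v \<theta> y \<partial>lborel)"
    unfolding path_int_def
  proof (intro nn_integral_cong)
    fix v :: real
    show "(\<integral>\<^sup>+y. (\<integral>\<^sup>+\<theta>. F v \<theta> y \<partial>lborel) \<partial>\<kappa> v) =
      (\<integral>\<^sup>+y. (\<integral>\<^sup>+\<theta>\<in>{v<..<t}. g v \<theta> y \<partial>lborel) \<partial>\<kappa> v) * indicator {u<..<t} v"
    proof (cases "u < v \<and> v < t")
      case True
      then show ?thesis
        by (auto simp: F_def split: split_indicator intro!: nn_integral_cong)
    next
      case False
      then have "F v \<theta> y = 0" for \<theta> y by (auto simp: F_def)
      then show ?thesis using False by auto
    qed
  qed
  finally show ?thesis .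
qed

text \<open>Integrating out the landing point first turns this into the case of
  \<open>path_int\<close>; inside, the kernel integral is exchanged with the one over
  \<open>\<theta>\<close>.\<close>

lemma nn_integral_jump_int:
  assumes g: "(\<lambda>((v, \<theta>), y). g v \<theta> y) \<in> borel_measurable ((borel \<Otimes>\<^sub>M borel) \<Otimes>\<^sub>M M)"
  shows "(\<integral>\<^sup>+\<theta>\<in>{u<..<t}. jump_int u \<theta> (\<lambda>v. g v \<theta>) \<partial>lborel) =
    jump_int u t (\<lambda>v y. \<integral>\<^sup>+\<theta>\<in>{v<..<t}. g v \<theta> y \<partial>lborel)"
proof -
  define h where "h = (\<lambda>v \<theta> z. \<integral>\<^sup>+y. g v \<theta> y \<partial>K z v)"
  have h: "(\<lambda>((v, \<theta>), z). h v \<theta> z) \<in> borel_measurable ((borel \<Otimes>\<^sub>M borel) \<Otimes>\<^sub>M M)"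
    using nn_integral_jump_measurable[of "\<lambda>p. g (fst p) (snd p)" "borel \<Otimes>\<^sub>M borel" fst] g
    by (simp add: h_def case_prod_unfold)
  have "(\<integral>\<^sup>+\<theta>\<in>{u<..<t}. jump_int u \<theta> (\<lambda>v. g v \<theta>) \<partial>lborel) = (\<integral>\<^sup>+\<theta>\<in>{u<..<t}. path_int u \<theta> (\<lambda>v. h v \<theta>) \<partial>lborel)"
    by (simp add: jump_int_def path_int_def h_def)
  also have "\<dots> = path_int u t (\<lambda>v z. \<integral>\<^sup>+\<theta>\<in>{v<..<t}. h v \<theta> z \<partial>lborel)"
    by (rule nn_integral_path_int[OF h])
  also have "\<dots> = path_int u t (\<lambda>v z. \<integral>\<^sup>+y. (\<integral>\<^sup>+\<theta>\<in>{v<..<t}. g v \<theta> y \<partial>lborel) \<partial>K z v)"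
  proof (rule path_int_cong)
    fix v z assume z: "z \<in> space M"
    have gv: "(\<lambda>(\<theta>, y). g v \<theta> y) \<in> borel_measurable (borel \<Otimes>\<^sub>M M)"
      using measurable_compose[OF _ g, of "\<lambda>(\<theta>, y). ((v, \<theta>), y)" "borel \<Otimes>\<^sub>M M"] by (simp add: case_prod_unfold)
    have "(\<lambda>(\<theta>, y). g v \<theta> y * indicator {v<..<t} \<theta>) \<in> borel_measurable (borel \<Otimes>\<^sub>M M)"
      using gv unfolding case_prod_unfold by measurable
    then have "(\<integral>\<^sup>+y. (\<integral>\<^sup>+\<theta>\<in>{v<..<t}. g v \<theta> y \<partial>lborel) \<partial>K z v) = (\<integral>\<^sup>+\<theta>. (\<integral>\<^sup>+y. g v \<theta> y * indicator {v<..<t} \<theta> \<partial>K z v) \<partial>lborel)"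
      by (intro nn_integral_Fubini_finite[OF finite_kernel[OF z] sets_kernel[OF z]])
    also have "\<dots> = (\<integral>\<^sup>+\<theta>\<in>{v<..<t}. h v \<theta> z \<partial>lborel)"
      by (intro nn_integral_cong) (auto simp: h_def split: split_indicator)
    finally show "(\<integral>\<^sup>+\<theta>\<in>{v<..<t}. h v \<theta> z \<partial>lborel) = (\<integral>\<^sup>+y. (\<integral>\<^sup>+\<theta>\<in>{v<..<t}. g v \<theta> y \<partial>lborel) \<partial>K z v)" by simp
  qed
  finally show ?thesis by (simp add: jump_int_def path_int_def)
qed

lemma last_jump_int:
  "(\<integral>\<^sup>+v\<in>{u<..<t}. (\<integral>\<^sup>+z. last_jump v t f z \<partial>\<kappa> v) \<partial>lborel) = jump_int u t (\<lambda>v y. ennreal (survival v t y) * f y)"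
  by (simp add: jump_int_def last_jump_def)

lemma indicator_snd_measurable:
  "B \<in> sets M \<Longrightarrow> (\<lambda>p. indicator B (snd p) :: ennreal) \<in> borel_measurable (N \<Otimes>\<^sub>M M)"
  by (rule measurable_compose[OF measurable_snd borel_measurable_indicator])

lemma survival_add_compl:
  assumes "y \<in> space M"
  shows "ennreal (survival v t y) + ennreal (1 - survival v t y) = 1"
  using survival_le_1[OF assms, of v t] by (subst ennreal_plus[symmetric]) auto

text \<open>The equation split at the last jump is used at each time \<open>\<theta>\<close> with the function
  \<open>indicator B * r \<theta>\<close> and integrated over \<open>\<theta>\<close>; exchanging the integrals,
  the survival probabilities integrate to \<open>1 - survival v t\<close>.\<close>

lemma forward_of_last_jump:
  assumes x: "x \<in> space M" and "u < t" and B: "B \<in> sets M"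
    and last: "\<And>s f. u < s \<Longrightarrow> s \<le> t \<Longrightarrow> f \<in> borel_measurable M \<Longrightarrow>
      (\<integral>\<^sup>+y. f y \<partial>\<kappa> s) = f x * ennreal (survival u s x) + jump_int u s (\<lambda>v y. ennreal (survival v s y) * f y)"
  shows "emeasure (\<kappa> t) B + path_int u t (\<lambda>v y. indicator B y * ennreal (r y v)) =
    indicator B x + jump_int u t (\<lambda>v y. indicator B y)"
proof -
  note [measurable] = indicator_snd_measurable[OF B]
  define g where "g = (\<lambda>v \<theta> y. ennreal (survival v \<theta> y) * (indicator B y * ennreal (r y \<theta>)))"
  have g: "(\<lambda>((v, \<theta>), y). g v \<theta> y) \<in> borel_measurable ((borel \<Otimes>\<^sub>M borel) \<Otimes>\<^sub>M M)"
    unfolding g_def case_prod_unfold by measurable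
  note J = jump_int_measurable[OF g, of u]
  have "path_int u t (\<lambda>v y. indicator B y * ennreal (r y v)) =
      (\<integral>\<^sup>+\<theta>. indicator B x * (ennreal (r x \<theta>) * ennreal (survival u \<theta> x) * indicator {u<..<t} \<theta>) +
        jump_int u \<theta> (\<lambda>v. g v \<theta>) * indicator {u<..<t} \<theta> \<partial>lborel)"
    unfolding path_int_def
  proof (rule nn_integral_cong)
    fix \<theta> :: real
    show "(\<integral>\<^sup>+y. indicator B y * ennreal (r y \<theta>) \<partial>\<kappa> \<theta>) * indicator {u<..<t} \<theta> =
      indicator B x * (ennreal (r x \<theta>) * ennreal (survival u \<theta> x) * indicator {u<..<t} \<theta>) +
        jump_int u \<theta> (\<lambda>v. g v \<theta>) * indicator {u<..<t} \<theta>"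
    proof (cases "u < \<theta> \<and> \<theta> < t")
      case True
      have "(\<lambda>y. indicator B y * ennreal (r y \<theta>)) \<in> borel_measurable M" using B by measurable
      from last[OF _ _ this, of \<theta>] show ?thesis using True by (simp add: g_def mult.assoc)
    qed auto
  qed
  also have "\<dots> = indicator B x * (\<integral>\<^sup>+\<theta>\<in>{u<..<t}. ennreal (r x \<theta>) * ennreal (survival u \<theta> x) \<partial>lborel) +
      (\<integral>\<^sup>+\<theta>\<in>{u<..<t}. jump_int u \<theta> (\<lambda>v. g v \<theta>) \<partial>lborel)"
  proof -
    have "(\<lambda>\<theta>. ennreal (r x \<theta>) * ennreal (survival u \<theta> x) * indicator {u<..<t} \<theta>) \<in> borel_measurable lborel"
      using x by measurable
    moreover have "(\<lambda>\<theta>. jump_int u \<theta> (\<lambda>v. g v \<theta>) * indicator {u<..<t} \<theta>) \<in> borel_measurable lborel"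
      using J by measurable
    ultimately show ?thesis by (simp add: nn_integral_add nn_integral_cmult)
  qed
  also have "\<dots> = indicator B x * ennreal (1 - survival u t x) + jump_int u t (\<lambda>v y. \<integral>\<^sup>+\<theta>\<in>{v<..<t}. g v \<theta> y \<partial>lborel)"
    using nn_integral_jump_int[OF g] integral_rate_survival_forward[OF x, of u t] \<open>u < t\<close> by simp
  also have "jump_int u t (\<lambda>v y. \<integral>\<^sup>+\<theta>\<in>{v<..<t}. g v \<theta> y \<partial>lborel) = jump_int u t (\<lambda>v y. indicator B y * ennreal (1 - survival v t y))"
  proof (rule jump_int_cong)
    fix v y assume *: "u < v" "v < t" "y \<in> space M"
    have "(\<integral>\<^sup>+\<theta>\<in>{v<..<t}. g v \<theta> y \<partial>lborel) = (\<integral>\<^sup>+\<theta>. indicator B y * (ennreal (r y \<theta>) * ennreal (survival v \<theta> y) * indicator {v<..<t} \<theta>) \<partial>lborel)"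
      by (intro nn_integral_cong) (simp add: g_def mult_ac)
    also have "\<dots> = indicator B y * ennreal (1 - survival v t y)"
    proof -
      have "(\<lambda>\<theta>. ennreal (r y \<theta>) * ennreal (survival v \<theta> y) * indicator {v<..<t} \<theta>) \<in> borel_measurable lborel"
        using *(3) by measurable
      then show ?thesis using integral_rate_survival_forward[OF *(3), of v t] *(2) by (simp add: nn_integral_cmult)
    qed
    finally show "(\<integral>\<^sup>+\<theta>\<in>{v<..<t}. g v \<theta> y \<partial>lborel) = indicator B y * ennreal (1 - survival v t y)" .
  qed
  finally have A: "path_int u t (\<lambda>v y. indicator B y * ennreal (r y v)) =
    indicator B x * ennreal (1 - survival u t x) + jump_int u t (\<lambda>v y. indicator B y * ennreal (1 - survival v t y))" .
  \<comment> \<open>Now the last-jump equation is used for the indicator of \<open>B\<close> itself.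
    Added to the exit integral \<open>A\<close>, survival and its complement sum to 1 both in the
    initial term and under the jump integral.\<close>
  have "emeasure (\<kappa> t) B = (\<integral>\<^sup>+y. indicator B y \<partial>\<kappa> t)" using B sets_path by simp
  also have "\<dots> = indicator B x * ennreal (survival u t x) + jump_int u t (\<lambda>v y. ennreal (survival v t y) * indicator B y)"
    using B \<open>u < t\<close> by (intro last) simp_all
  finally have "emeasure (\<kappa> t) B + path_int u t (\<lambda>v y. indicator B y * ennreal (r y v)) =
    indicator B x * (ennreal (survival u t x) + ennreal (1 - survival u t x)) +
    (jump_int u t (\<lambda>v y. ennreal (survival v t y) * indicator B y) + jump_int u t (\<lambda>v y. indicator B y * ennreal (1 - survival v t y)))"
    unfolding A by (simp only: distrib_left add_ac)
  also have "(jump_int u t (\<lambda>v y. ennreal (survival v t y) * indicator B y) + jump_int u t (\<lambda>v y. indicator B y * ennreal (1 - survival v t y)))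
      = jump_int u t (\<lambda>v y. ennreal (survival v t y) * indicator B y + indicator B y * ennreal (1 - survival v t y))"
    by (intro jump_int_add[symmetric]; unfold case_prod_unfold; measurable)
  also have "\<dots> = jump_int u t (\<lambda>v y. indicator B y)"
    using survival_add_compl by (intro jump_int_cong) (auto split: split_indicator)
  finally show ?thesis using survival_add_compl[OF x, of u t] by simp
qed

text \<open>Accumulated exits as a measure in the state; together with
  \<open>jump_int_measure_exists\<close> this prepares the extension of the integrated forward
  equation from sets to functions.\<close>

lemma path_int_measure_exists:
  "\<exists>\<rho>. sets \<rho> = sets M \<and> (\<forall>f\<in>borel_measurable M. (\<integral>\<^sup>+y. f y \<partial>\<rho>) = path_int u t (\<lambda>v y. f y * ennreal (r y v)))"
proof -
  have m: "(\<lambda>v. \<integral>\<^sup>+y. f y * ennreal (r y v) \<partial>\<kappa> v) \<in> borel_measurable borel" if "f \<in> borel_measurable M" for f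
    using that by (intro path_measurable_integral; unfold case_prod_unfold; measurable)
  have d: "(\<integral>\<^sup>+y. f y \<partial>density (\<kappa> v) (\<lambda>y. ennreal (r y v))) = (\<integral>\<^sup>+y. f y * ennreal (r y v) \<partial>\<kappa> v)"
    if "f \<in> borel_measurable M" for f v
  proof -
    have "(\<lambda>y. ennreal (r y v)) \<in> borel_measurable M" by measurable
    then show ?thesis using that by (subst nn_integral_density) (simp_all add: measurable_path_eq mult.commute)
  qed
  have "\<exists>\<rho>. sets \<rho> = sets M \<and> (\<forall>f\<in>borel_measurable M. (\<integral>\<^sup>+y. f y \<partial>\<rho>) =
      (\<integral>\<^sup>+v. (\<integral>\<^sup>+y. f y \<partial>density (\<kappa> v) (\<lambda>y. ennreal (r y v))) \<partial>density lborel (indicator {u<..<t})))"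
  proof (rule mixture_exists)
    fix B assume B: "B \<in> sets M"
    have "emeasure (density (\<kappa> v) (\<lambda>y. ennreal (r y v))) B = (\<integral>\<^sup>+y. indicator B y * ennreal (r y v) \<partial>\<kappa> v)" for v
      using d[of "indicator B" v] B sets_path by simp
    then show "(\<lambda>v. emeasure (density (\<kappa> v) (\<lambda>y. ennreal (r y v))) B) \<in> borel_measurable (density lborel (indicator {u<..<t}))"
      using m[of "indicator B"] B by simp
  qed (simp add: sets_path)
  then show ?thesis using m d by (simp add: path_int_def nn_integral_density mult.commute)
qed

lemma jump_int_measure_exists:
  "\<exists>\<rho>. sets \<rho> = sets M \<and> (\<forall>f\<in>borel_measurable M. (\<integral>\<^sup>+y. f y \<partial>\<rho>) = jump_int u t (\<lambda>v. f))"
proof -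
  have "\<exists>\<sigma>. sets \<sigma> = sets M \<and> (\<forall>f\<in>borel_measurable M. (\<integral>\<^sup>+y. f y \<partial>\<sigma>) = (\<integral>\<^sup>+z. (\<integral>\<^sup>+y. f y \<partial>K z v) \<partial>\<kappa> v))" for v
  proof (rule mixture_exists)
    fix B assume "B \<in> sets M"
    from measurable_compose[OF _ kernel_measurable[OF this], of "\<lambda>z. (z, v)" M]
    show "(\<lambda>z. emeasure (K z v) B) \<in> borel_measurable (\<kappa> v)" by (simp add: measurable_path_eq)
  qed (simp add: sets_kernel space_path)
  then obtain \<sigma> where \<sigma>: "\<forall>v. sets (\<sigma> v) = sets M \<and> (\<forall>f\<in>borel_measurable M. (\<integral>\<^sup>+y. f y \<partial>\<sigma> v) = (\<integral>\<^sup>+z. (\<integral>\<^sup>+y. f y \<partial>K z v) \<partial>\<kappa> v))"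
    using choice[of "\<lambda>v \<sigma>. sets \<sigma> = sets M \<and> (\<forall>f\<in>borel_measurable M. (\<integral>\<^sup>+y. f y \<partial>\<sigma>) = (\<integral>\<^sup>+z. (\<integral>\<^sup>+y. f y \<partial>K z v) \<partial>\<kappa> v))"] by blast
  have m: "(\<lambda>v. \<integral>\<^sup>+z. (\<integral>\<^sup>+y. f y \<partial>K z v) \<partial>\<kappa> v) \<in> borel_measurable borel" if "f \<in> borel_measurable M" for f
    using that by (intro jump_measurable_integral; unfold case_prod_unfold; measurable)
  have "\<exists>\<rho>. sets \<rho> = sets M \<and> (\<forall>f\<in>borel_measurable M. (\<integral>\<^sup>+y. f y \<partial>\<rho>) =
      (\<integral>\<^sup>+v. (\<integral>\<^sup>+y. f y \<partial>\<sigma> v) \<partial>density lborel (indicator {u<..<t})))"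
  proof (rule mixture_exists)
    fix B assume B: "B \<in> sets M"
    have "emeasure (\<sigma> v) B = (\<integral>\<^sup>+z. (\<integral>\<^sup>+y. indicator B y \<partial>K z v) \<partial>\<kappa> v)" for v
      using bspec[OF conjunct2[OF spec[OF \<sigma>, of v]], of "indicator B"] spec[OF \<sigma>, of v] B by simp
    then show "(\<lambda>v. emeasure (\<sigma> v) B) \<in> borel_measurable (density lborel (indicator {u<..<t}))"
      using m[of "indicator B"] B by simp
  qed (use \<sigma> in simp)
  then show ?thesis using m \<sigma> by (simp add: jump_int_def nn_integral_density mult.commute)
qed

text \<open>Each side of the set equation is the value of one measure: \<open>\<kappa> t\<close>
  plus accumulated exits on the left, a point mass plus accumulated entrances on the right. They
  agree on subsets of \<open>B\<close> and hence integrate \<open>f * indicator B\<close>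
  alike.\<close>

lemma forward_functions:
  assumes x: "x \<in> space M" and B: "B \<in> sets M" and f: "f \<in> borel_measurable M"
    and forward: "\<And>C. C \<in> sets M \<Longrightarrow> C \<subseteq> B \<Longrightarrow>
      emeasure (\<kappa> t) C + path_int u t (\<lambda>v y. indicator C y * ennreal (r y v)) =
      indicator C x + jump_int u t (\<lambda>v y. indicator C y)"
  shows "(\<integral>\<^sup>+y. f y * indicator B y \<partial>\<kappa> t) + path_int u t (\<lambda>v y. f y * indicator B y * ennreal (r y v)) =
      f x * indicator B x + jump_int u t (\<lambda>v y. f y * indicator B y)"
proof -
  obtain \<rho>1 where \<rho>1: "sets \<rho>1 = sets M"
    "\<forall>f\<in>borel_measurable M. (\<integral>\<^sup>+y. f y \<partial>\<rho>1) = path_int u t (\<lambda>v y. f y * ennreal (r y v))"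
    using path_int_measure_exists[of u t] by (elim exE conjE)
  obtain \<rho>2 where \<rho>2: "sets \<rho>2 = sets M"
    "\<forall>f\<in>borel_measurable M. (\<integral>\<^sup>+y. f y \<partial>\<rho>2) = jump_int u t (\<lambda>v. f)"
    using jump_int_measure_exists[of u t] by (elim exE conjE)
  obtain \<delta> where \<delta>: "sets \<delta> = sets M" "\<forall>f\<in>borel_measurable M. (\<integral>\<^sup>+y. f y \<partial>\<delta>) = f x * 1"
    using point_measure_exists[OF x, of 1] by (elim exE conjE)
  obtain L where L: "sets L = sets M"
    "\<forall>f\<in>borel_measurable M. (\<integral>\<^sup>+y. f y \<partial>L) = (\<integral>\<^sup>+y. f y \<partial>\<kappa> t) + (\<integral>\<^sup>+y. f y \<partial>\<rho>1)"
    using sum_measure_exists[OF sets_path[of t] \<rho>1(1)] by (elim exE conjE)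
  obtain R where R: "sets R = sets M"
    "\<forall>f\<in>borel_measurable M. (\<integral>\<^sup>+y. f y \<partial>R) = (\<integral>\<^sup>+y. f y \<partial>\<delta>) + (\<integral>\<^sup>+y. f y \<partial>\<rho>2)"
    using sum_measure_exists[OF \<delta>(1) \<rho>2(1)] by (elim exE conjE)
  have eq: "emeasure L C = emeasure R C" if C: "C \<in> sets M" "C \<subseteq> B" for C
  proof -
    have "indicator C \<in> borel_measurable M" using C(1) by simp
    note i = L(2)[rule_format, OF this] R(2)[rule_format, OF this] \<rho>1(2)[rule_format, OF this]
      \<rho>2(2)[rule_format, OF this] \<delta>(2)[rule_format, OF this]
    have "emeasure L C = emeasure (\<kappa> t) C + path_int u t (\<lambda>v y. indicator C y * ennreal (r y v))"
      using i(1,3) C(1) L(1) sets_path by simp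
    also have "\<dots> = indicator C x + jump_int u t (\<lambda>v y. indicator C y)" by (rule forward[OF C])
    also have "\<dots> = emeasure R C" using i(2,4,5) C(1) R(1) by simp
    finally show ?thesis .
  qed
  have "(\<integral>\<^sup>+y. f y * indicator B y \<partial>L) = (\<integral>\<^sup>+y. f y * indicator B y \<partial>R)"
    by (rule nn_integral_eq_on_subset[OF L(1) R(1) B f eq])
  moreover have m: "(\<lambda>y. f y * indicator B y) \<in> borel_measurable M" using f B by measurable
  note L(2)[rule_format, OF m] R(2)[rule_format, OF m] \<rho>1(2)[rule_format, OF m]
      \<rho>2(2)[rule_format, OF m] \<delta>(2)[rule_format, OF m]
  ultimately show ?thesis by simp
qed

text \<open>Conversely, the integrated forward equation is used at each time \<open>\<theta>\<close> with the function
  \<open>indicator B * r \<theta> * survival \<theta> t\<close>. The terms cancelled at the end are finite only because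
  of \<open>fin\<close>.\<close>

lemma last_jump_of_forward:
  assumes x: "x \<in> space M" and "u < t" and B: "B \<in> sets M"
    and forward: "\<And>s C. u < s \<Longrightarrow> s \<le> t \<Longrightarrow> C \<in> sets M \<Longrightarrow> C \<subseteq> B \<Longrightarrow>
      emeasure (\<kappa> s) C + path_int u s (\<lambda>v y. indicator C y * ennreal (r y v)) =
      indicator C x + jump_int u s (\<lambda>v y. indicator C y)"
    and fin: "jump_int u t (\<lambda>v y. indicator B y) < \<infinity>"
  shows "emeasure (\<kappa> t) B = indicator B x * ennreal (survival u t x) +
    jump_int u t (\<lambda>v y. ennreal (survival v t y) * indicator B y)"
proof -
  note [measurable] = indicator_snd_measurable[OF B]
  \<comment> \<open>Integrated over \<open>\<theta>\<close> from \<open>v\<close> to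
    \<open>t\<close>, the weight \<open>h \<theta> y\<close> gives
    \<open>1 - survival v t y\<close>, by the backward survival identity. It depends on the
    integration time and the final time, but not on \<open>v\<close>.\<close>
  define h where "h = (\<lambda>\<theta> y. ennreal (r y \<theta>) * ennreal (survival \<theta> t y))"
  define g1 where "g1 = (\<lambda>v \<theta> y. h \<theta> y * indicator B y * ennreal (r y v))"
  define g2 where "g2 = (\<lambda>(v::real) \<theta> y. h \<theta> y * indicator B y :: ennreal)"
  have g1: "(\<lambda>((v, \<theta>), y). g1 v \<theta> y) \<in> borel_measurable ((borel \<Otimes>\<^sub>M borel) \<Otimes>\<^sub>M M)"
    unfolding g1_def h_def case_prod_unfold by measurable
  have g2: "(\<lambda>((v, \<theta>), y). g2 v \<theta> y) \<in> borel_measurable ((borel \<Otimes>\<^sub>M borel) \<Otimes>\<^sub>M M)"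
    unfolding g2_def h_def case_prod_unfold by measurable
  have h: "h \<theta> \<in> borel_measurable M" for \<theta> unfolding h_def by measurable
  have hy: "(\<lambda>\<theta>. h \<theta> y) \<in> borel_measurable borel" if "y \<in> space M" for y
    using that unfolding h_def by measurable
  have hint: "(\<integral>\<^sup>+\<theta>\<in>{v<..<t}. h \<theta> y \<partial>lborel) = ennreal (1 - survival v t y)" if "y \<in> space M" "v \<le> t" for v y
    unfolding h_def by (rule integral_rate_survival_backward[OF that])
  have const: "(\<integral>\<^sup>+\<theta>\<in>{v<..<t}. h \<theta> y * c \<partial>lborel) = ennreal (1 - survival v t y) * c"
    if "y \<in> space M" "v \<le> t" for v y c
  proof -
    have "(\<integral>\<^sup>+\<theta>\<in>{v<..<t}. h \<theta> y * c \<partial>lborel) = (\<integral>\<^sup>+\<theta>. (h \<theta> y * indicator {v<..<t} \<theta>) * c \<partial>lborel)"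
      by (intro nn_integral_cong) (simp add: mult_ac)
    also have "\<dots> = (\<integral>\<^sup>+\<theta>\<in>{v<..<t}. h \<theta> y \<partial>lborel) * c"
      using hy[OF that(1)] by (intro nn_integral_multc borel_measurable_times_ennreal) auto
    finally show ?thesis using hint[OF that] by simp
  qed
  note P = path_int_measurable[OF g1, of u] and J = jump_int_measurable[OF g2, of u]
  have H: "(\<lambda>\<theta>. \<integral>\<^sup>+y. h \<theta> y * indicator B y \<partial>\<kappa> \<theta>) \<in> borel_measurable borel"
    unfolding h_def by (intro path_measurable_integral; unfold case_prod_unfold; measurable)
  \<comment> \<open>\<open>X\<close> collects all exits from \<open>B\<close>. The entrances are
    split into \<open>Y''\<close>, where the landing state survives until \<open>t\<close>, and
    \<open>Y'\<close>, where it does not.\<close>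
  define X where "X = path_int u t (\<lambda>v y. indicator B y * ennreal (r y v))"
  define Y' where "Y' = jump_int u t (\<lambda>v y. ennreal (1 - survival v t y) * indicator B y)"
  define Y'' where "Y'' = jump_int u t (\<lambda>v y. ennreal (survival v t y) * indicator B y)"
  \<comment> \<open>The rate is split by \<open>1 = survival v t y + (1 - survival v t y)\<close>:
    the first share is the weight \<open>h v y\<close>, the second is \<open>h\<close> integrated
    over later times. Together they form the left side of the forward equation for the function
    \<open>h \<theta>\<close>, integrated over \<open>\<theta>\<close>.\<close>
  have "X = path_int u t (\<lambda>v y. h v y * indicator B y + ennreal (1 - survival v t y) * indicator B y * ennreal (r y v))"
    unfolding X_def
  proof (rule path_int_cong)
    fix v y assume "y \<in> space M"
    have "h v y * indicator B y + ennreal (1 - survival v t y) * indicator B y * ennreal (r y v) =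
        (ennreal (survival v t y) + ennreal (1 - survival v t y)) * (indicator B y * ennreal (r y v))"
      unfolding h_def distrib_right by (simp only: mult_ac)
    then show "indicator B y * ennreal (r y v) = h v y * indicator B y + ennreal (1 - survival v t y) * indicator B y * ennreal (r y v)"
      by (simp only: survival_add_compl[OF \<open>y \<in> space M\<close>] mult_1)
  qed
  also have "\<dots> = path_int u t (\<lambda>v y. h v y * indicator B y) + path_int u t (\<lambda>v y. ennreal (1 - survival v t y) * indicator B y * ennreal (r y v))"
    unfolding h_def by (intro path_int_add; unfold case_prod_unfold; measurable)
  also have "path_int u t (\<lambda>v y. ennreal (1 - survival v t y) * indicator B y * ennreal (r y v)) =
      path_int u t (\<lambda>v y. \<integral>\<^sup>+\<theta>\<in>{v<..<t}. g1 v \<theta> y \<partial>lborel)"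
    unfolding g1_def
  proof (rule path_int_cong)
    fix v y assume "u < v" "v < t" "y \<in> space M"
    then show "ennreal (1 - survival v t y) * indicator B y * ennreal (r y v) =
        (\<integral>\<^sup>+\<theta>\<in>{v<..<t}. h \<theta> y * indicator B y * ennreal (r y v) \<partial>lborel)"
      using const[of y v "indicator B y * ennreal (r y v)"] by (simp add: mult.assoc)
  qed
  also have "\<dots> = (\<integral>\<^sup>+\<theta>\<in>{u<..<t}. path_int u \<theta> (\<lambda>v. g1 v \<theta>) \<partial>lborel)"
    by (rule nn_integral_path_int[OF g1, symmetric])
  also have "path_int u t (\<lambda>v y. h v y * indicator B y) + \<dots> =
      (\<integral>\<^sup>+\<theta>. ((\<integral>\<^sup>+y. h \<theta> y * indicator B y \<partial>\<kappa> \<theta>) + path_int u \<theta> (\<lambda>v. g1 v \<theta>)) * indicator {u<..<t} \<theta> \<partial>lborel)"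
    unfolding path_int_def[of u t] distrib_right using H P
    by (intro nn_integral_add[symmetric] borel_measurable_times_ennreal) auto
  also have "\<dots> = (\<integral>\<^sup>+\<theta>. (h \<theta> x * indicator B x + jump_int u \<theta> (\<lambda>v. g2 v \<theta>)) * indicator {u<..<t} \<theta> \<partial>lborel)"
  proof (intro nn_integral_cong)
    fix \<theta> :: real
    show "((\<integral>\<^sup>+y. h \<theta> y * indicator B y \<partial>\<kappa> \<theta>) + path_int u \<theta> (\<lambda>v. g1 v \<theta>)) * indicator {u<..<t} \<theta> =
      (h \<theta> x * indicator B x + jump_int u \<theta> (\<lambda>v. g2 v \<theta>)) * indicator {u<..<t} \<theta>"
    proof (cases "u < \<theta> \<and> \<theta> < t")
      case True
      then show ?thesis using forward_functions[OF x B h, of \<theta> u] forward[of \<theta>] by (simp add: g1_def g2_def)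
    qed auto
  qed
  also have "\<dots> = (\<integral>\<^sup>+\<theta>\<in>{u<..<t}. h \<theta> x * indicator B x \<partial>lborel) + (\<integral>\<^sup>+\<theta>\<in>{u<..<t}. jump_int u \<theta> (\<lambda>v. g2 v \<theta>) \<partial>lborel)"
    unfolding distrib_right using hy[OF x] J
    by (intro nn_integral_add borel_measurable_times_ennreal) auto
  also have "(\<integral>\<^sup>+\<theta>\<in>{u<..<t}. h \<theta> x * indicator B x \<partial>lborel) = ennreal (1 - survival u t x) * indicator B x"
    using \<open>u < t\<close> by (intro const[OF x]) simp
  also have "(\<integral>\<^sup>+\<theta>\<in>{u<..<t}. jump_int u \<theta> (\<lambda>v. g2 v \<theta>) \<partial>lborel) = jump_int u t (\<lambda>v y. \<integral>\<^sup>+\<theta>\<in>{v<..<t}. g2 v \<theta> y \<partial>lborel)"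
    by (rule nn_integral_jump_int[OF g2])
  also have "\<dots> = Y'"
    unfolding Y'_def g2_def by (intro jump_int_cong) (simp add: const)
  finally have X: "X = ennreal (1 - survival u t x) * indicator B x + Y'" .
  have Y: "jump_int u t (\<lambda>v y. indicator B y) = Y'' + Y'"
  proof -
    have "jump_int u t (\<lambda>v y. indicator B y) = jump_int u t (\<lambda>v y. ennreal (survival v t y) * indicator B y + ennreal (1 - survival v t y) * indicator B y)"
      using survival_add_compl by (intro jump_int_cong) (auto split: split_indicator)
    also have "\<dots> = Y'' + Y'"
      unfolding Y'_def Y''_def by (intro jump_int_add; unfold case_prod_unfold; measurable)
    finally show ?thesis .
  qed
  have "emeasure (\<kappa> t) B + X = indicator B x + jump_int u t (\<lambda>v y. indicator B y)"
    unfolding X_def using \<open>u < t\<close> B by (intro forward) auto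
  also have "\<dots> = (ennreal (survival u t x) + ennreal (1 - survival u t x)) * indicator B x + (Y'' + Y')"
    unfolding Y survival_add_compl[OF x] by simp
  also have "\<dots> = (ennreal (survival u t x) * indicator B x + ennreal (1 - survival u t x) * indicator B x) + (Y'' + Y')"
    by (simp only: distrib_right)
  \<comment> \<open>Both sides now contain \<open>X\<close> in its computed form; removing it leaves
    the last-jump equation.\<close>
  finally have "(ennreal (1 - survival u t x) * indicator B x + Y') + emeasure (\<kappa> t) B =
    (ennreal (1 - survival u t x) * indicator B x + Y') + (indicator B x * ennreal (survival u t x) + Y'')"
    unfolding X by (simp only: add_ac mult.commute)
  moreover have "ennreal (1 - survival u t x) * indicator B x + Y' \<noteq> \<infinity>"
    using fin unfolding Y by (auto split: split_indicator simp: ennreal_mult_eq_top_iff)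
  ultimately show ?thesis unfolding Y''_def by (simp add: ennreal_add_left_cancel)
qed

end

section \<open>Indefinite integrals of nonnegative functions\<close>

text \<open>Truncation of \<open>f\<close> at a high level \<open>n\<close> costs less than half of
  \<open>e\<close>; the truncated part is bounded by \<open>n\<close> and contributes little on sets
  of small measure.\<close>

lemma nn_integral_small:
  assumes f: "f \<in> borel_measurable N" and fin: "(\<integral>\<^sup>+x. f x \<partial>N) < \<infinity>" and e: "0 < (e :: real)"
  shows "\<exists>d>0. \<forall>A\<in>sets N. emeasure N A < ennreal d \<longrightarrow> (\<integral>\<^sup>+x\<in>A. f x \<partial>N) < ennreal e"
proof -
  define g where "g = (\<lambda>n x. min (f x) (of_nat n))"
  have gm: "g n \<in> borel_measurable N" for n unfolding g_def using f by measurable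
  have g_le: "g n x \<le> f x" for n x by (simp add: g_def)
  have "(SUP n. g n x) = f x" for x
  proof (intro antisym SUP_least g_le)
    show "f x \<le> (SUP n. g n x)"
    proof (cases "f x = top")
      case True
      then have "(SUP n. g n x) = (SUP n. of_nat n)" by (simp add: g_def)
      also have "\<dots> = top" by (rule ennreal_SUP_of_nat_eq_top)
      finally show ?thesis by (simp only: top_greatest)
    next
      case False
      then obtain n :: nat where "f x \<le> of_nat n" using ennreal_Ex_less_of_nat[of "f x"] by (auto simp: less_top intro: less_imp_le)
      then have "g n x = f x" by (simp add: g_def)
      then show ?thesis by (metis SUP_upper UNIV_I)
    qed
  qed
  moreover have "incseq g" by (auto simp: incseq_def le_fun_def g_def min.coboundedI2)
  ultimately have "(\<integral>\<^sup>+x. f x \<partial>N) = (SUP n. \<integral>\<^sup>+x. g n x \<partial>N)"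
    using nn_integral_monotone_convergence_SUP[of g N] gm by simp
  moreover have "(\<integral>\<^sup>+x. f x \<partial>N) < (\<integral>\<^sup>+x. f x \<partial>N) + ennreal (e / 2)"
    using fin e by (cases "\<integral>\<^sup>+x. f x \<partial>N") (auto simp: ennreal_less_iff simp flip: ennreal_plus)
  ultimately have "(\<integral>\<^sup>+x. f x \<partial>N) < (SUP n. \<integral>\<^sup>+x. g n x \<partial>N) + ennreal (e / 2)" by simp
  then have "\<exists>n. (\<integral>\<^sup>+x. f x \<partial>N) < (\<integral>\<^sup>+x. g n x \<partial>N) + ennreal (e / 2)"
    unfolding ennreal_SUP_add_left[OF UNIV_not_empty, symmetric] less_SUP_iff by simp
  then obtain n where n: "(\<integral>\<^sup>+x. f x \<partial>N) < (\<integral>\<^sup>+x. g n x \<partial>N) + ennreal (e / 2)" by blast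
  \<comment> \<open>Chosen so that \<open>n * d \<le> e / 2\<close>; the \<open>+ 1\<close> covers
    \<open>n = 0\<close>.\<close>
  define d where "d = e / (2 * (real n + 1))"
  have gfin: "(\<integral>\<^sup>+x. g n x \<partial>N) < \<infinity>"
    using le_less_trans[OF nn_integral_mono fin, of "g n"] g_le by simp
  have diff: "(\<integral>\<^sup>+x. f x - g n x \<partial>N) < ennreal (e / 2)"
  proof -
    have "(\<integral>\<^sup>+x. f x - g n x \<partial>N) = (\<integral>\<^sup>+x. f x \<partial>N) - (\<integral>\<^sup>+x. g n x \<partial>N)"
      using gfin g_le by (intro nn_integral_diff f gm) auto
    also have "\<dots> < ennreal (e / 2)"
      using n gfin fin e by (cases "(\<integral>\<^sup>+x. f x \<partial>N)"; cases "(\<integral>\<^sup>+x. g n x \<partial>N)")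
        (auto simp: ennreal_minus ennreal_less_iff intro!: ennreal_lessI simp flip: ennreal_plus)
    finally show ?thesis .
  qed
  have "(\<integral>\<^sup>+x\<in>A. f x \<partial>N) < ennreal e" if A: "A \<in> sets N" "emeasure N A < ennreal d" for A
  proof -
    have "(\<integral>\<^sup>+x\<in>A. f x \<partial>N) \<le> (\<integral>\<^sup>+x. (f x - g n x) + of_nat n * indicator A x \<partial>N)"
    proof (intro nn_integral_mono)
      fix x
      have "f x = (f x - g n x) + g n x" using g_le[of n x] by (simp add: diff_add_cancel_ennreal)
      also have "\<dots> \<le> (f x - g n x) + of_nat n" by (intro add_left_mono) (simp add: g_def)
      finally show "f x * indicator A x \<le> (f x - g n x) + of_nat n * indicator A x"
        by (simp split: split_indicator)
    qed
    also have "\<dots> = (\<integral>\<^sup>+x. f x - g n x \<partial>N) + of_nat n * emeasure N A"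
      using A f gm by (simp add: nn_integral_add nn_integral_cmult)
    also have "of_nat n * emeasure N A \<le> ennreal (e / 2)"
    proof -
      have "of_nat n * emeasure N A \<le> ennreal (real n) * ennreal d"
        using A(2) by (auto simp: ennreal_of_nat_eq_real_of_nat intro!: mult_left_mono)
      also have "\<dots> = ennreal (real n * d)" by (intro ennreal_mult[symmetric]) (use e in \<open>simp_all add: d_def\<close>)
      also have "\<dots> \<le> ennreal (e / 2)" using e by (intro ennreal_leI) (simp add: d_def field_simps)
      finally show ?thesis .
    qed
    also have "(\<integral>\<^sup>+x. f x - g n x \<partial>N) + ennreal (e / 2) < ennreal (e / 2) + ennreal (e / 2)"
      using diff by (simp add: ennreal_add_left_cancel_less add.commute)
    also have "ennreal (e / 2) + ennreal (e / 2) = ennreal e" using e by (simp flip: ennreal_plus)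
    finally show ?thesis by (simp add: add_left_mono)
  qed
  moreover have "d > 0" using e by (simp add: d_def)
  ultimately show ?thesis by blast
qed


lemma nn_integral_Ioo_add:
  fixes g :: "real \<Rightarrow> ennreal"
  assumes g: "g \<in> borel_measurable borel" and "u \<le> a" "a < b"
  shows "(\<integral>\<^sup>+v\<in>{u<..<a}. g v \<partial>lborel) + (\<integral>\<^sup>+v\<in>{a<..<b}. g v \<partial>lborel) = (\<integral>\<^sup>+v\<in>{u<..<b}. g v \<partial>lborel)"
proof -
  have "(\<integral>\<^sup>+v\<in>{u<..<a}. g v \<partial>lborel) + (\<integral>\<^sup>+v\<in>{a<..<b}. g v \<partial>lborel) =
      (\<integral>\<^sup>+v. g v * indicator {u<..<a} v + g v * indicator {a<..<b} v \<partial>lborel)"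
    using g by (intro nn_integral_add[symmetric] borel_measurable_times_ennreal) auto
  also have "\<dots> = (\<integral>\<^sup>+v\<in>{u<..<b}. g v \<partial>lborel)"
    using AE_lborel_singleton[of a]
    by (intro nn_integral_cong_AE, eventually_elim) (use assms(2,3) in \<open>auto split: split_indicator\<close>)
  finally show ?thesis .
qed

text \<open>The increments over disjoint intervals add up to the integral over their union, whose
  measure is the sum of the lengths.\<close>

lemma nn_integral_Ioo_absolutely_continuous:
  fixes g :: "real \<Rightarrow> ennreal"
  assumes g: "g \<in> borel_measurable borel" and fin: "(\<integral>\<^sup>+v\<in>{u<..<s}. g v \<partial>lborel) < \<infinity>"
  shows "absolutely_continuous_on {u<..<s} (\<lambda>t. enn2real (\<integral>\<^sup>+v\<in>{u<..<t}. g v \<partial>lborel))"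
    (is "absolutely_continuous_on _ ?G")
  unfolding absolutely_continuous_on_def
proof (intro allI impI)
  fix e :: real assume "e > 0"
  define f where "f = (\<lambda>v. g v * indicator {u<..<s} v)"
  have fm: "f \<in> borel_measurable lborel" unfolding f_def using g by (intro borel_measurable_times_ennreal) auto
  have ffin: "(\<integral>\<^sup>+v. f v \<partial>lborel) < \<infinity>" using fin by (simp add: f_def)
  from nn_integral_small[OF fm ffin \<open>e > 0\<close>] obtain d where
    d': "d > 0 \<and> (\<forall>A\<in>sets lborel. emeasure lborel A < ennreal d \<longrightarrow> (\<integral>\<^sup>+x\<in>A. f x \<partial>lborel) < ennreal e)" ..
  note d = conjunct1[OF d'] conjunct2[OF d']
  have "(\<Sum>(a, b)\<in>D. \<bar>?G b - ?G a\<bar>) < e"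
    if D: "finite D" "\<forall>(a, b)\<in>D. a < b \<and> {a..b} \<subseteq> {u<..<s}" "disjoint_family_on (\<lambda>(a, b). {a<..<b}) D"
      "(\<Sum>(a, b)\<in>D. b - a) < d" for D
  proof -
    define I :: "real \<times> real \<Rightarrow> real set" where "I = (\<lambda>(a, b). {a<..<b})"
    have ab: "ennreal \<bar>?G b - ?G a\<bar> = (\<integral>\<^sup>+v\<in>I (a, b). f v \<partial>lborel)" if "(a, b) \<in> D" for a b
    proof -
      have "a < b" "{a..b} \<subseteq> {u<..<s}" using bspec[OF D(2) that] by simp_all
      then have "a \<in> {u<..<s}" "b \<in> {u<..<s}" by (simp_all add: subset_iff)
      with \<open>a < b\<close> have *: "u < a" "a < b" "b < s" by simp_all
      have le: "(\<integral>\<^sup>+v\<in>{u<..<c}. g v \<partial>lborel) \<le> (\<integral>\<^sup>+v\<in>{u<..<s}. g v \<partial>lborel)" if "c \<le> s" for c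
        using that by (intro nn_integral_mono) (auto split: split_indicator)
      have fin': "(\<integral>\<^sup>+v\<in>{u<..<c}. g v \<partial>lborel) < \<infinity>" if "c \<le> s" for c
        using le[OF that] fin by (rule le_less_trans)
      have sum: "(\<integral>\<^sup>+v\<in>{u<..<a}. g v \<partial>lborel) + (\<integral>\<^sup>+v\<in>{a<..<b}. g v \<partial>lborel) = (\<integral>\<^sup>+v\<in>{u<..<b}. g v \<partial>lborel)"
        using * by (intro nn_integral_Ioo_add g) auto
      have "(\<integral>\<^sup>+v\<in>I (a, b). f v \<partial>lborel) = (\<integral>\<^sup>+v\<in>{a<..<b}. g v \<partial>lborel)"
        using * by (intro nn_integral_cong) (auto simp: f_def I_def split: split_indicator)
      moreover have "(\<integral>\<^sup>+v\<in>{a<..<b}. g v \<partial>lborel) = ennreal \<bar>?G b - ?G a\<bar>"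
        using sum fin'[of a] fin'[of b] *
        by (cases "\<integral>\<^sup>+v\<in>{u<..<a}. g v \<partial>lborel"; cases "\<integral>\<^sup>+v\<in>{a<..<b}. g v \<partial>lborel"; cases "\<integral>\<^sup>+v\<in>{u<..<b}. g v \<partial>lborel")
           (auto simp flip: ennreal_plus)
      ultimately show ?thesis by simp
    qed
    have em: "emeasure lborel (\<Union>z\<in>D. I z) = ennreal (\<Sum>(a, b)\<in>D. b - a)"
    proof -
      have "emeasure lborel (\<Union>z\<in>D. I z) = (\<Sum>z\<in>D. emeasure lborel (I z))"
        using D(1,3) by (intro sum_emeasure[symmetric]) (auto simp: I_def)
      also have "\<dots> = (\<Sum>z\<in>D. ennreal (case z of (a, b) \<Rightarrow> b - a))"
        using D(2) by (intro sum.cong) (auto simp: I_def)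
      also have "\<dots> = ennreal (\<Sum>(a, b)\<in>D. b - a)"
        using D(2) by (intro sum_ennreal) auto
      finally show ?thesis .
    qed
    have ind: "indicator (\<Union>z\<in>D. I z) v = (\<Sum>z\<in>D. indicator (I z) v :: ennreal)" for v
      using D(1,3) by (intro indicator_UN_disjoint) (auto simp: I_def)
    have "ennreal (\<Sum>(a, b)\<in>D. \<bar>?G b - ?G a\<bar>) = (\<Sum>z\<in>D. ennreal (case z of (a, b) \<Rightarrow> \<bar>?G b - ?G a\<bar>))"
      by (intro sum_ennreal[symmetric]) auto
    also have "\<dots> = (\<Sum>z\<in>D. \<integral>\<^sup>+v\<in>I z. f v \<partial>lborel)" using ab by (intro sum.cong) auto
    also have "\<dots> = (\<integral>\<^sup>+v. (\<Sum>z\<in>D. f v * indicator (I z) v) \<partial>lborel)"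
      using fm by (intro nn_integral_sum[symmetric] borel_measurable_times_ennreal) (auto simp: I_def)
    also have "\<dots> = (\<integral>\<^sup>+v\<in>(\<Union>z\<in>D. I z). f v \<partial>lborel)"
      unfolding ind by (simp add: sum_distrib_left)
    also have "\<dots> < ennreal e"
    proof (rule d(2)[rule_format])
      show "(\<Union>z\<in>D. I z) \<in> sets lborel" using D(1) by (intro sets.finite_UN) (auto simp: I_def)
      show "emeasure lborel (\<Union>z\<in>D. I z) < ennreal d"
        unfolding em using D(2,4) \<open>d > 0\<close> by (subst ennreal_less_iff) (auto intro!: sum_nonneg)
    qed
    finally show ?thesis
      by (subst (asm) ennreal_less_iff) (auto intro!: sum_nonneg)
  qed
  with d(1) show "\<exists>\<delta>>0. \<forall>D. finite D \<longrightarrow> (\<forall>(a, b)\<in>D. a < b \<and> {a..b} \<subseteq> {u<..<s}) \<longrightarrow>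
      disjoint_family_on (\<lambda>(a, b). {a<..<b}) D \<longrightarrow> (\<Sum>(a, b)\<in>D. b - a) < \<delta> \<longrightarrow>
      (\<Sum>(a, b)\<in>D. \<bar>?G b - ?G a\<bar>) < e" by (intro exI[of _ d]) simp
qed

lemma nn_integral_Ioo_tendsto_0:
  fixes g :: "real \<Rightarrow> ennreal"
  assumes g: "g \<in> borel_measurable borel" and "u < s" and fin: "(\<integral>\<^sup>+v\<in>{u<..<s}. g v \<partial>lborel) < \<infinity>"
  shows "((\<lambda>t. enn2real (\<integral>\<^sup>+v\<in>{u<..<t}. g v \<partial>lborel)) \<longlongrightarrow> 0) (at_right u)"
proof (rule tendstoI)
  fix e :: real assume "e > 0"
  define f where "f = (\<lambda>v. g v * indicator {u<..<s} v)"
  have fm: "f \<in> borel_measurable lborel" unfolding f_def using g by (intro borel_measurable_times_ennreal) auto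
  have ffin: "(\<integral>\<^sup>+v. f v \<partial>lborel) < \<infinity>" using fin by (simp add: f_def)
  from nn_integral_small[OF fm ffin \<open>e > 0\<close>] obtain d where
    d': "d > 0 \<and> (\<forall>A\<in>sets lborel. emeasure lborel A < ennreal d \<longrightarrow> (\<integral>\<^sup>+x\<in>A. f x \<partial>lborel) < ennreal e)" ..
  note d = conjunct1[OF d'] conjunct2[OF d']
  have "dist (enn2real (\<integral>\<^sup>+v\<in>{u<..<t}. g v \<partial>lborel)) 0 < e" if "u < t" "t < min s (u + d)" for t
  proof -
    have "(\<integral>\<^sup>+v\<in>{u<..<t}. g v \<partial>lborel) = (\<integral>\<^sup>+v\<in>{u<..<t}. f v \<partial>lborel)"
      using that by (intro nn_integral_cong) (auto simp: f_def split: split_indicator)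
    also have "\<dots> < ennreal e" using that by (intro d(2)[rule_format]) (auto simp: ennreal_less_iff)
    finally show ?thesis
      by (cases "\<integral>\<^sup>+v\<in>{u<..<t}. g v \<partial>lborel") (auto simp: ennreal_less_iff)
  qed
  then show "\<forall>\<^sub>F t in at_right u. dist (enn2real (\<integral>\<^sup>+v\<in>{u<..<t}. g v \<partial>lborel)) 0 < e"
    using \<open>u < s\<close> d(1) unfolding eventually_at_right_field by (intro exI[of _ "min s (u + d)"]) auto
qed

text \<open>Finite integrals over bounded intervals make \<open>g\<close> finite almost everywhere,
  so a real-valued version can be differentiated.\<close>

lemma nn_integral_Ioo_has_derivative_ae:
  fixes g :: "real \<Rightarrow> ennreal"
  assumes g: "g \<in> borel_measurable borel" and fin: "\<And>t. (\<integral>\<^sup>+v\<in>{u<..<t}. g v \<partial>lborel) < \<infinity>"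
  shows "AE t in lborel. u < t \<longrightarrow> g t < \<infinity> \<and>
    ((\<lambda>t. enn2real (\<integral>\<^sup>+v\<in>{u<..<t}. g v \<partial>lborel)) has_real_derivative enn2real (g t)) (at t)"
proof -
  have ind: "(\<lambda>v. g v * indicator {u<..<t} v) \<in> borel_measurable lborel" for t
    using g by (intro borel_measurable_times_ennreal) auto
  have "AE v in lborel. \<forall>n::nat. g v * indicator {u<..<u + real n} v \<noteq> \<infinity>"
    using nn_integral_noteq_infinite[OF ind] fin by (intro AE_all_countable[THEN iffD2]) (auto simp: less_top)
  then have gfin: "AE v in lborel. u < v \<longrightarrow> g v < \<infinity>"
  proof eventually_elim
    case (elim v)
    obtain n :: nat where "v - u < real n" using reals_Archimedean2 by blast
    then show ?case using elim[rule_format, of n] by (auto simp: less_top split: split_indicator_asm)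
  qed
  \<comment> \<open>Cutting \<open>g\<close> to 0 up to \<open>u\<close> makes \<open>h\<close>
    integrable on every interval, as \<open>indefinite_integral_has_derivative_ae\<close>
    requires.\<close>
  define h where "h = (\<lambda>v. if u < v then enn2real (g v) else 0)"
  have hm: "h \<in> borel_measurable borel" unfolding h_def using g by measurable
  have eq: "(\<integral>\<^sup>+v. ennreal (h v * indicator {a..t} v) \<partial>lborel) = (\<integral>\<^sup>+v\<in>{u<..<t}. g v \<partial>lborel)" if "a \<le> u" for a t
    using gfin AE_lborel_singleton[of t]
    by (intro nn_integral_cong_AE, eventually_elim) (use \<open>a \<le> u\<close> in \<open>auto simp: h_def split: split_indicator\<close>)
  have int: "((\<lambda>v. h v * indicator {a..t} v) has_integral enn2real (\<integral>\<^sup>+v\<in>{u<..<t}. g v \<partial>lborel)) UNIV" if "a \<le> u" for a t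
  proof (rule nn_integral_has_integral)
    show "(\<integral>\<^sup>+v. ennreal (h v * indicator {a..t} v) \<partial>lborel) = ennreal (enn2real (\<integral>\<^sup>+v\<in>{u<..<t}. g v \<partial>lborel))"
      unfolding eq[OF that] using fin[of t] by (simp add: ennreal_enn2real)
  qed (use hm in \<open>auto simp: h_def\<close>)
  have int': "(h has_integral enn2real (\<integral>\<^sup>+v\<in>{u<..<t}. g v \<partial>lborel)) {a..t}" if "a \<le> u" for a t
  proof -
    have "(\<lambda>v. h v * indicator {a..t} v) = (\<lambda>v. if v \<in> {a..t} then h v else 0)" by (auto split: split_indicator)
    then show ?thesis using int[OF that, of t] by (simp only: has_integral_restrict_UNIV)
  qed
  have "h integrable_on {a..b}" for a b
    by (rule integrable_on_subinterval[OF has_integral_integrable[OF int'[of "min a u" b]]]) auto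
  from indefinite_integral_has_derivative_ae[OF this] gfin
  show ?thesis
  proof eventually_elim
    case (elim t)
    show ?case
    proof (intro impI conjI)
      assume "u < t"
      then show "g t < \<infinity>" using elim by simp
      have "((\<lambda>s. integral {u..s} h) has_real_derivative enn2real (g t)) (at t)"
        using elim \<open>u < t\<close> by (auto simp: h_def)
      moreover have "integral {u..s} h = enn2real (\<integral>\<^sup>+v\<in>{u<..<s}. g v \<partial>lborel)" for s
        by (rule integral_unique) (rule int', simp)
      ultimately show "((\<lambda>t. enn2real (\<integral>\<^sup>+v\<in>{u<..<t}. g v \<partial>lborel)) has_real_derivative enn2real (g t)) (at t)"
        by simp
    qed
  qed
qed

text \<open>Only \<open>g1\<close> is assumed to have a finite integral; for \<open>g2\<close> this
  is a consequence. In the application \<open>g1\<close> is the exit rate, bounded on the set, while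
  the entrance rate \<open>g2\<close> has no a priori bound.\<close>

lemma nn_integral_derivative_diff:
  fixes F :: "real \<Rightarrow> real" and g1 g2 :: "real \<Rightarrow> ennreal"
  assumes "a \<le> b" and ac: "absolutely_continuous_on {a..b} F" and F: "0 \<le> F a" "0 \<le> F b"
    and g: "g1 \<in> borel_measurable borel" "g2 \<in> borel_measurable borel"
    and fin: "(\<integral>\<^sup>+v\<in>{a<..<b}. g1 v \<partial>lborel) < \<infinity>"
    and deriv: "AE t in lborel. a < t \<and> t < b \<longrightarrow> g1 t < \<infinity> \<and> g2 t < \<infinity> \<and>
      (F has_real_derivative enn2real (g2 t) - enn2real (g1 t)) (at t)"
  shows "ennreal (F a) + (\<integral>\<^sup>+v\<in>{a<..<b}. g2 v \<partial>lborel) = ennreal (F b) + (\<integral>\<^sup>+v\<in>{a<..<b}. g1 v \<partial>lborel)"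
proof -
  obtain N where N: "{t \<in> space lborel. \<not> (a < t \<and> t < b \<longrightarrow> g1 t < \<infinity> \<and> g2 t < \<infinity> \<and>
      (F has_real_derivative enn2real (g2 t) - enn2real (g1 t)) (at t))} \<subseteq> N"
    "emeasure lborel N = 0" "N \<in> sets lborel"
    using AE_E[OF deriv] .
  have neg: "negligible (N \<union> {a, b})"
    using null_sets_completionI[OF null_setsI[OF N(2,3)]] by (simp add: negligible_iff_null_sets[symmetric])
  have hi: "((\<lambda>t. enn2real (g2 t) - enn2real (g1 t)) has_integral F b - F a) {a..b}"
  proof (rule absolutely_continuous_has_integral_derivative[OF \<open>a \<le> b\<close> ac neg])
    fix s assume "s \<in> {a..b}" "s \<notin> N \<union> {a, b}"
    then have "a < s \<and> s < b" "s \<notin> N" by auto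
    then have "(F has_real_derivative enn2real (g2 s) - enn2real (g1 s)) (at s)" using subsetD[OF N(1), of s] by auto
    then show "(F has_real_derivative enn2real (g2 s) - enn2real (g1 s)) (at s within {a..b})" by (rule DERIV_subset) simp
  qed
  define h where "h = (\<lambda>(g :: real \<Rightarrow> ennreal) t. enn2real (g t) * indicator {a..b} t)"
  have hm: "h g \<in> borel_measurable borel" if "g \<in> borel_measurable borel" for g
    unfolding h_def using that by measurable
  have hn: "0 \<le> h g t" for g t by (simp add: h_def)
  have eq: "(\<integral>\<^sup>+t. ennreal (h g1 t) \<partial>lborel) = (\<integral>\<^sup>+v\<in>{a<..<b}. g1 v \<partial>lborel)"
    "(\<integral>\<^sup>+t. ennreal (h g2 t) \<partial>lborel) = (\<integral>\<^sup>+v\<in>{a<..<b}. g2 v \<partial>lborel)"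
    by (intro nn_integral_cong_AE, use deriv AE_lborel_singleton[of a] AE_lborel_singleton[of b] in eventually_elim,
        auto simp: h_def split: split_indicator)+
  define I1 where "I1 = enn2real (\<integral>\<^sup>+v\<in>{a<..<b}. g1 v \<partial>lborel)"
  have I1: "(\<integral>\<^sup>+v\<in>{a<..<b}. g1 v \<partial>lborel) = ennreal I1" "0 \<le> I1" using fin by (auto simp: I1_def)
  have "(h g1 has_integral I1) UNIV"
    using I1 eq(1) hm[OF g(1)] hn by (intro nn_integral_has_integral) auto
  moreover have "((\<lambda>t. (enn2real (g2 t) - enn2real (g1 t)) * indicator {a..b} t) has_integral F b - F a) UNIV"
  proof -
    have "(\<lambda>t. (enn2real (g2 t) - enn2real (g1 t)) * indicator {a..b} t) =
        (\<lambda>t. if t \<in> {a..b} then enn2real (g2 t) - enn2real (g1 t) else 0)" by (auto split: split_indicator)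
    then show ?thesis using hi by (simp only: has_integral_restrict_UNIV)
  qed
  \<comment> \<open>The derivative of \<open>F\<close> is only Henstock-Kurzweil integrable so far.
    Adding \<open>g1\<close> gives the nonnegative function \<open>g2\<close>, for which this
    integral is the Lebesgue integral.\<close>
  ultimately have "((\<lambda>t. h g1 t + (enn2real (g2 t) - enn2real (g1 t)) * indicator {a..b} t) has_integral I1 + (F b - F a)) UNIV"
    by (rule has_integral_add)
  moreover have "(\<lambda>t. h g1 t + (enn2real (g2 t) - enn2real (g1 t)) * indicator {a..b} t) = h g2"
    by (auto simp: h_def algebra_simps)
  ultimately have h2: "(h g2 has_integral I1 + (F b - F a)) UNIV" by simp
  then have "(\<integral>\<^sup>+v\<in>{a<..<b}. g2 v \<partial>lborel) = ennreal (I1 + (F b - F a))"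
    using nn_integral_has_integral_lborel[OF hm[OF g(2)] hn h2] eq(2) by simp
  moreover have "0 \<le> I1 + (F b - F a)" by (rule has_integral_nonneg[OF h2]) (rule hn)
  ultimately show ?thesis using I1 F by (simp flip: ennreal_plus)
qed

text \<open>The sets \<open>{x. \<forall>t. r x t \<le> n}\<close> are complements of projections and need not be in \<open>sets M\<close>;
  this is why measurable projection is needed.\<close>

lemma le_on_bounded_imp_le:
  fixes r :: "'a \<Rightarrow> real \<Rightarrow> real"
  assumes r: "(\<lambda>(x, t). r x t) \<in> borel_measurable (M \<Otimes>\<^sub>M borel)"
    and bdd: "\<And>x. x \<in> space M \<Longrightarrow> \<exists>c. \<forall>t. r x t \<le> c"
    and \<mu>: "finite_measure \<mu>" "sets \<mu> = sets M" and \<nu>: "sets \<nu> = sets M"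
    and le: "\<And>B. B \<in> sets M \<Longrightarrow> \<exists>c. \<forall>x\<in>B. \<forall>t. r x t \<le> c \<Longrightarrow> emeasure \<mu> B \<le> emeasure \<nu> B"
    and B: "B \<in> sets M"
  shows "emeasure \<mu> B \<le> emeasure \<nu> B"
proof -
  have "\<exists>A :: nat \<Rightarrow> 'a set. incseq A \<and> (\<forall>n. A n \<in> sets M) \<and> (\<forall>n. \<exists>c. \<forall>x\<in>A n. \<forall>t. r x t \<le> c) \<and>
    emeasure \<mu> (space M - (\<Union>n. A n)) = 0"
    by (rule bounded_sections_exhaust[OF r bdd \<mu>])
  then obtain A :: "nat \<Rightarrow> 'a set" where A: "incseq A" "\<And>n. A n \<in> sets M" "\<And>n. \<exists>c. \<forall>x\<in>A n. \<forall>t. r x t \<le> c"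
    "emeasure \<mu> (space M - (\<Union>n. A n)) = 0"
    by (elim exE conjE) (rule that, auto)
  have null: "space M - (\<Union>n. A n) \<in> null_sets \<mu>" using A \<mu>(2) by (intro null_setsI) auto
  have "emeasure \<mu> B = emeasure \<mu> (B - (space M - (\<Union>n. A n)))"
    using null B \<mu>(2) by (intro emeasure_Diff_null_set[symmetric]) auto
  also have "B - (space M - (\<Union>n. A n)) = (\<Union>n. B \<inter> A n)" using sets.sets_into_space[OF B] by auto
  also have "emeasure \<mu> (\<Union>n. B \<inter> A n) = (SUP n. emeasure \<mu> (B \<inter> A n))"
  proof (rule SUP_emeasure_incseq[symmetric])
    show "range (\<lambda>n. B \<inter> A n) \<subseteq> sets \<mu>" using A(2) B \<mu>(2) by auto
    show "incseq (\<lambda>n. B \<inter> A n)"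
      unfolding incseq_def by (intro allI impI Int_mono order_refl incseqD[OF A(1)])
  qed
  also have "\<dots> \<le> emeasure \<nu> B"
  proof (rule SUP_least)
    fix n
    have "\<exists>c. \<forall>x\<in>B \<inter> A n. \<forall>t. r x t \<le> c" using A(3)[of n] by (elim exE) (intro exI, auto)
    then have "emeasure \<mu> (B \<inter> A n) \<le> emeasure \<nu> (B \<inter> A n)" using A(2) B by (intro le) auto
    also have "\<dots> \<le> emeasure \<nu> B" using B \<nu> by (intro emeasure_mono) auto
    finally show "emeasure \<mu> (B \<inter> A n) \<le> emeasure \<nu> B" .
  qed
  finally show ?thesis .
qed

section \<open>Comparison of the jump expansion with a solution of the last-jump equation\<close>

context forward_family
begin

text \<open>Induction on the number of terms. Inserting the bound for \<open>N\<close> terms into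
  the last-jump equation gives it for \<open>Suc N\<close> terms on sets with bounded rate only. The
  extension to all measurable sets has to be made inside each step, because the next one integrates
  \<open>last_jump v t (indicator C)\<close>, which does not vanish outside sets of bounded
  rate.\<close>

lemma sum_jumps_le:
  assumes x: "x \<in> space M"
    and last: "\<And>t B. u < t \<Longrightarrow> t \<le> b \<Longrightarrow> B \<in> sets M \<Longrightarrow> \<exists>c. \<forall>y\<in>B. \<forall>s. r y s \<le> c \<Longrightarrow>
      emeasure (\<kappa> t) B = indicator B x * ennreal (survival u t x) +
        jump_int u t (\<lambda>v y. ennreal (survival v t y) * indicator B y)"
  shows "u < t \<Longrightarrow> t \<le> b \<Longrightarrow> B \<in> sets M \<Longrightarrow> (\<Sum>n<N. jumps n u x t (indicator B)) \<le> emeasure (\<kappa> t) B"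
proof (induction N arbitrary: t B)
  case (Suc N)
  have part: "\<exists>\<rho>. sets \<rho> = sets M \<and>
      (\<forall>f\<in>borel_measurable M. (\<integral>\<^sup>+y. f y \<partial>\<rho>) = (\<Sum>n<m. jumps n u x v f))" for m v
    using jumps_sum_measure_exists[OF x, where u=u and t=v and I="{..<m}"]
    by (simp add: nn_integral_count_space_finite)
  \<comment> \<open>The hypothesis for sets is an inequality between measures, and so holds for
    integrals of functions as well.\<close>
  have IH: "(\<Sum>n<N. jumps n u x v f) \<le> (\<integral>\<^sup>+y. f y \<partial>\<kappa> v)"
    if v: "u < v" "v \<le> b" and f: "f \<in> borel_measurable M" for v f
  proof -
    obtain \<rho> where \<rho>: "sets \<rho> = sets M" "\<forall>f\<in>borel_measurable M. (\<integral>\<^sup>+y. f y \<partial>\<rho>) = (\<Sum>n<N. jumps n u x v f)"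
      using part[where m=N and v=v] by (elim exE conjE)
    have "emeasure \<rho> B \<le> emeasure (\<kappa> v) B" for B
    proof (cases "B \<in> sets M")
      case True
      then have "emeasure \<rho> B = (\<Sum>n<N. jumps n u x v (indicator B))"
        using \<rho>(1) \<rho>(2)[rule_format, of "indicator B"] by simp
      then show ?thesis using Suc.IH[OF v True] by simp
    qed (simp add: emeasure_notin_sets \<rho>(1))
    then have "\<rho> \<le> \<kappa> v" using \<rho>(1) sets_path by (subst le_measure) auto
    then have "(\<integral>\<^sup>+y. f y \<partial>\<rho>) \<le> (\<integral>\<^sup>+y. f y \<partial>\<kappa> v)" using \<rho>(1) sets_path by (intro nn_integral_mono_measure) auto
    then show ?thesis using \<rho>(2) f by simp
  qed
  have bounded: "(\<Sum>n<Suc N. jumps n u x t (indicator C)) \<le> emeasure (\<kappa> t) C"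
    if C: "C \<in> sets M" "\<exists>c. \<forall>y\<in>C. \<forall>s. r y s \<le> c" for C
  proof -
    have Cm: "indicator C \<in> borel_measurable M" using C(1) by simp
    have Lm: "(\<lambda>(v, y). last_jump v t (indicator C) y) \<in> borel_measurable (borel \<Otimes>\<^sub>M M)"
      using last_jump_compose[of fst "borel \<Otimes>\<^sub>M M" "\<lambda>_. t" snd "\<lambda>_. indicator C"] indicator_snd_measurable[OF C(1), of "(borel :: real measure) \<Otimes>\<^sub>M M"]
      by (simp add: case_prod_unfold)
    have Jm: "(\<lambda>v. jumps n u x v (last_jump v t (indicator C)) * indicator {u<..<t} v) \<in> borel_measurable lborel" for n
    proof -
      have "(\<lambda>v. jumps n u x v (last_jump v t (indicator C))) \<in> borel_measurable borel"
        using x Lm by (intro jumps_compose) simp_all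
      then show ?thesis by (intro borel_measurable_times_ennreal) auto
    qed
    have "(\<Sum>n<N. jumps (Suc n) u x t (indicator C)) =
        (\<integral>\<^sup>+v. (\<Sum>n<N. jumps n u x v (last_jump v t (indicator C)) * indicator {u<..<t} v) \<partial>lborel)"
      unfolding jumps_Suc_last[OF Cm x] by (intro nn_integral_sum[symmetric] Jm)
    also have "\<dots> \<le> (\<integral>\<^sup>+v\<in>{u<..<t}. (\<integral>\<^sup>+z. last_jump v t (indicator C) z \<partial>\<kappa> v) \<partial>lborel)"
    proof (rule nn_integral_mono)
      fix v
      show "(\<Sum>n<N. jumps n u x v (last_jump v t (indicator C)) * indicator {u<..<t} v) \<le>
        (\<integral>\<^sup>+z. last_jump v t (indicator C) z \<partial>\<kappa> v) * indicator {u<..<t} v"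
      proof (cases "u < v \<and> v < t")
        case True
        have Lv: "last_jump v t (indicator C) \<in> borel_measurable M" by (rule section_measurable[OF Lm])
        have "u < v" "v \<le> b" using True Suc.prems(2) by auto
        then show ?thesis using IH[OF _ _ Lv] True by simp
      qed auto
    qed
    also have "\<dots> = jump_int u t (\<lambda>v y. ennreal (survival v t y) * indicator C y)" by (rule last_jump_int)
    finally have "indicator C x * ennreal (survival u t x) + (\<Sum>n<N. jumps (Suc n) u x t (indicator C)) \<le> emeasure (\<kappa> t) C"
      unfolding last[OF Suc.prems(1,2) C] by (rule add_left_mono)
    moreover have "(\<Sum>n<Suc N. jumps n u x t (indicator C)) =
        indicator C x * ennreal (survival u t x) + (\<Sum>n<N. jumps (Suc n) u x t (indicator C))"
      by (simp only: sum.lessThan_Suc_shift jumps.simps(1))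
    ultimately show ?thesis by (simp only:)
  qed
  obtain \<rho> where \<rho>: "sets \<rho> = sets M" "\<forall>f\<in>borel_measurable M. (\<integral>\<^sup>+y. f y \<partial>\<rho>) = (\<Sum>n<Suc N. jumps n u x t f)"
    using part[where m="Suc N" and v=t] by (elim exE conjE)
  have em: "emeasure \<rho> B = (\<Sum>n<Suc N. jumps n u x t (indicator B))" if "B \<in> sets M" for B
    using \<rho>(1) \<rho>(2)[rule_format, of "indicator B"] that by simp
  have "emeasure \<rho> (space \<rho>) = (\<Sum>n<Suc N. jumps n u x t (\<lambda>_. 1))"
    using \<rho>(2)[rule_format, of "\<lambda>_. 1"] by simp
  then have "emeasure \<rho> (space \<rho>) \<le> 1"
    using sum_jumps_le_1[OF x, where N="Suc N" and u=u and t=t] by (simp only:)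
  then have \<rho>fin: "finite_measure \<rho>" by (intro finite_measureI) (auto simp: top_unique)
  \<comment> \<open>The partial sum is a finite measure of mass at most 1, so sets with bounded rate
    exhaust the space up to a null set of it.\<close>
  have "emeasure \<rho> B \<le> emeasure (\<kappa> t) B"
  proof (rule le_on_bounded_imp_le[OF rate_measurable rate_bounded \<rho>fin \<rho>(1) sets_path _ Suc.prems(3)])
    fix C assume C: "C \<in> sets M" "\<exists>c. \<forall>y\<in>C. \<forall>s. r y s \<le> c"
    show "emeasure \<rho> C \<le> emeasure (\<kappa> t) C" unfolding em[OF C(1)] by (rule bounded[OF C])
  qed
  then show ?case using em[OF Suc.prems(3)] by simp
qed simp

lemma transition_le_path:
  assumes x: "x \<in> space M"
    and last: "\<And>t B. u < t \<Longrightarrow> t \<le> b \<Longrightarrow> B \<in> sets M \<Longrightarrow> \<exists>c. \<forall>y\<in>B. \<forall>s. r y s \<le> c \<Longrightarrow>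
      emeasure (\<kappa> t) B = indicator B x * ennreal (survival u t x) +
        jump_int u t (\<lambda>v y. ennreal (survival v t y) * indicator B y)"
    and "u < b" "B \<in> sets M"
  shows "emeasure (transition u x b) B \<le> emeasure (\<kappa> b) B"
  unfolding emeasure_transition[OF x \<open>B \<in> sets M\<close>]
proof (rule suminf_le_const)
  show "(\<Sum>n<N. jumps n u x b (indicator B)) \<le> emeasure (\<kappa> b) B" for N
    by (rule sum_jumps_le[OF x last \<open>u < b\<close> order_refl \<open>B \<in> sets M\<close>])
qed simp

end

context jump_kernel
begin

lemma transition_forward_family:
  assumes x: "x \<in> space M"
  shows "forward_family M r K (transition u x)"
  by (intro forward_family.intro forward_family_axioms.intro jump_kernel_axioms sets_transition[OF x] finite_transition[OF x] transition_measurable[OF x])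

lemma transition_forward:
  assumes x: "x \<in> space M" and "u < t" and B: "B \<in> sets M"
  shows "emeasure (transition u x t) B +
      (\<integral>\<^sup>+v\<in>{u<..<t}. (\<integral>\<^sup>+y. indicator B y * ennreal (r y v) \<partial>transition u x v) \<partial>lborel) =
    indicator B x + (\<integral>\<^sup>+v\<in>{u<..<t}. (\<integral>\<^sup>+z. emeasure (K z v) B \<partial>transition u x v) \<partial>lborel)"
proof -
  interpret forward_family M r K "transition u x" by (rule transition_forward_family[OF x])
  have "emeasure (transition u x t) B + path_int u t (\<lambda>v y. indicator B y * ennreal (r y v)) =
    indicator B x + jump_int u t (\<lambda>v y. indicator B y)"
    using x \<open>u < t\<close> B
  proof (rule forward_of_last_jump)
    fix s and f :: "'a \<Rightarrow> ennreal" assume f: "f \<in> borel_measurable M"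
    show "(\<integral>\<^sup>+y. f y \<partial>transition u x s) = f x * ennreal (survival u s x) +
        jump_int u s (\<lambda>v y. ennreal (survival v s y) * f y)"
      unfolding last_jump_int[symmetric] by (rule transition_last_jump[OF x f])
  qed
  moreover have "jump_int u t (\<lambda>v y. indicator B y) = (\<integral>\<^sup>+v\<in>{u<..<t}. (\<integral>\<^sup>+z. emeasure (K z v) B \<partial>transition u x v) \<partial>lborel)"
    unfolding jump_int_def using B
    by (intro nn_integral_cong arg_cong2[where f="(*)"] refl) (simp add: space_path sets_kernel)
  ultimately show ?thesis by (simp add: path_int_def)
qed

end

section \<open>From Q-functions to jump kernels\<close>

text \<open>Distinct points have disjoint neighbourhoods from a countable base, so the complement of
  the diagonal is a countable union of open rectangles. This is needed because \<open>{x}\<close>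
  and \<open>B - {x}\<close>, on which \<open>q x t\<close> is evaluated, move with
  \<open>x\<close>.\<close>

lemma standard_borel_diagonal:
  assumes "standard_borel M"
  shows "{p \<in> space (M \<Otimes>\<^sub>M M). fst p = snd p} \<in> sets (M \<Otimes>\<^sub>M M)"
proof -
  obtain X where X: "completely_metrizable_space X" "second_countable X" "topspace X = space M"
    "sets M = sigma_sets (topspace X) {U. openin X U}"
    using assms unfolding standard_borel_def by blast
  have open_sets: "U \<in> sets M" if "openin X U" for U
    using that by (auto simp: X(4))
  have haus: "Hausdorff_space X"
    using X(1) by (intro metrizable_imp_Hausdorff_space completely_metrizable_imp_metrizable_space)
  obtain \<B> where \<B>: "countable \<B>" "\<forall>V\<in>\<B>. openin X V"
    "\<forall>U x. openin X U \<and> x \<in> U \<longrightarrow> (\<exists>V\<in>\<B>. x \<in> V \<and> V \<subseteq> U)"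
    using X(2) unfolding second_countable_def by (elim exE conjE)
  define \<D> where "\<D> = {(U, V) \<in> \<B> \<times> \<B>. U \<inter> V = {}}"
  have "countable \<D>" unfolding \<D>_def using \<B>(1) by (intro countable_subset[OF _ countable_SIGMA[of \<B> "\<lambda>_. \<B>"]]) auto
  moreover have "(case z of (U, V) \<Rightarrow> U \<times> V) \<in> sets (M \<Otimes>\<^sub>M M)" if "z \<in> \<D>" for z
    using that \<B>(2) by (auto simp: \<D>_def intro!: pair_measureI open_sets)
  ultimately have D: "(\<Union>z\<in>\<D>. case z of (U, V) \<Rightarrow> U \<times> V) \<in> sets (M \<Otimes>\<^sub>M M)"
    by (intro sets.countable_UN') auto
  have "{p \<in> space (M \<Otimes>\<^sub>M M). fst p = snd p} = space (M \<Otimes>\<^sub>M M) - (\<Union>z\<in>\<D>. case z of (U, V) \<Rightarrow> U \<times> V)"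
  proof (intro antisym subsetI)
    fix p assume p: "p \<in> space (M \<Otimes>\<^sub>M M) - (\<Union>z\<in>\<D>. case z of (U, V) \<Rightarrow> U \<times> V)"
    have "fst p = snd p"
    proof (rule ccontr)
      assume "fst p \<noteq> snd p"
      moreover have "fst p \<in> topspace X" "snd p \<in> topspace X" using p X(3) by (auto simp: space_pair_measure)
      ultimately obtain U V where UV: "openin X U" "openin X V" "fst p \<in> U" "snd p \<in> V" "disjnt U V"
        using haus unfolding Hausdorff_space_def by blast
      obtain U' where U': "U' \<in> \<B>" "fst p \<in> U'" "U' \<subseteq> U" using \<B>(3) UV(1,3) by blast
      obtain V' where V': "V' \<in> \<B>" "snd p \<in> V'" "V' \<subseteq> V" using \<B>(3) UV(2,4) by blast
      have "U' \<inter> V' = {}" using UV(5) U'(3) V'(3) unfolding disjnt_def by blast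
      then have "(U', V') \<in> \<D>" "p \<in> U' \<times> V'"
        using U' V' by (auto simp: \<D>_def mem_Times_iff)
      then show False using p by blast
    qed
    then show "p \<in> {p \<in> space (M \<Otimes>\<^sub>M M). fst p = snd p}" using p by simp
  qed (auto simp: \<D>_def)
  then show ?thesis using D by simp
qed

lemma standard_borel_singleton:
  assumes "standard_borel M" "x \<in> space M"
  shows "{x} \<in> sets M"
proof -
  have "Pair x -` {p \<in> space (M \<Otimes>\<^sub>M M). fst p = snd p} = {x}"
    using assms(2) by (auto simp: space_pair_measure)
  then show ?thesis using sets_Pair1[OF standard_borel_diagonal[OF assms(1)], of x] by simp
qed

lemma finite_signed_measure_Un:
  assumes "finite_signed_measure M \<mu>" "A \<in> sets M" "B \<in> sets M" "A \<inter> B = {}"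
  shows "\<mu> (A \<union> B) = \<mu> A + \<mu> B"
proof -
  have "range (binaryset A B) \<subseteq> sets M" "disjoint_family (binaryset A B)"
    using assms(2-4) by (auto simp: binaryset_def disjoint_family_on_def)
  then have "(\<lambda>i. \<mu> (binaryset A B i)) sums \<mu> (\<Union>i. binaryset A B i)"
    using assms(1) unfolding finite_signed_measure_def by simp
  moreover have "(\<lambda>i. \<mu> (binaryset A B i)) sums (\<mu> A + \<mu> B)"
    using assms(1) by (intro binaryset_sums) (simp add: finite_signed_measure_def)
  ultimately show ?thesis by (simp add: UN_binaryset_eq sums_unique2)
qed

lemma Q_function_signed:
  "Q_function M T0 T1 q \<Longrightarrow> x \<in> space M \<Longrightarrow> t \<in> time_interval T0 T1 \<Longrightarrow> finite_signed_measure M (q x t)"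
  by (simp add: Q_function_def)

text \<open>The definition of a Q-function gives measurability for a fixed set; here the set is a
  section that varies with the state. The Dynkin argument also works for real signed measures, where
  complements become differences.\<close>

lemma Q_function_section_measurable:
  assumes Q: "Q_function M T0 T1 q" and E: "E \<in> sets (M \<Otimes>\<^sub>M M)"
  shows "(\<lambda>p. q (fst p) (snd p) (Pair (fst p) -` E)) \<in>
    borel_measurable (M \<Otimes>\<^sub>M restrict_space borel (time_interval T0 T1))" (is "_ \<in> borel_measurable ?S")
proof -
  have qm: "(\<lambda>p. q (fst p) (snd p) B) \<in> borel_measurable ?S" if "B \<in> sets M" for B
    using Q that by (simp add: Q_function_def case_prod_unfold)
  have sp: "fst p \<in> space M" "snd p \<in> time_interval T0 T1" if "p \<in> space ?S" for p
    using that by (auto simp: space_pair_measure space_restrict_space)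
  show ?thesis
    using Int_stable_pair_measure_generator pair_measure_closed E[unfolded sets_pair_measure]
  proof (induction rule: sigma_sets_induct_disjoint)
    case (basic E)
    then obtain A B where E: "E = A \<times> B" "A \<in> sets M" "B \<in> sets M" by auto
    have "q (fst p) (snd p) (Pair (fst p) -` E) = (if fst p \<in> A then q (fst p) (snd p) B else 0)"
      if "p \<in> space ?S" for p
    proof -
      have "Pair (fst p) -` E = (if fst p \<in> A then B else {})" by (auto simp: E)
      then show ?thesis using Q_function_signed[OF Q sp[OF that]] by (simp add: finite_signed_measure_def)
    qed
    moreover have "(\<lambda>p. if fst p \<in> A then q (fst p) (snd p) B else 0) \<in> borel_measurable ?S"
    proof (rule measurable_If)
      show "{p \<in> space ?S. fst p \<in> A} \<in> sets ?S" using E(2) by measurable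
    qed (use qm[OF E(3)] in auto)
    ultimately show ?case by (simp cong: measurable_cong)
  next
    case empty
    have "q (fst p) (snd p) (Pair (fst p) -` {}) = 0" if "p \<in> space ?S" for p
      using Q_function_signed[OF Q sp[OF that]] by (simp add: finite_signed_measure_def)
    then show ?case by (simp cong: measurable_cong)
  next
    case (compl E)
    have "q (fst p) (snd p) (Pair (fst p) -` (space M \<times> space M - E)) =
        q (fst p) (snd p) (space M) - q (fst p) (snd p) (Pair (fst p) -` E)" if "p \<in> space ?S" for p
    proof -
      have E: "Pair (fst p) -` E \<in> sets M"
        using sets_Pair1[of E M M] compl(1) by (simp add: sets_pair_measure)
      have eq: "Pair (fst p) -` (space M \<times> space M - E) = space M - Pair (fst p) -` E" using sp[OF that] by auto
      have "q (fst p) (snd p) (Pair (fst p) -` E \<union> (space M - Pair (fst p) -` E)) =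
          q (fst p) (snd p) (Pair (fst p) -` E) + q (fst p) (snd p) (space M - Pair (fst p) -` E)"
        using E by (intro finite_signed_measure_Un[OF Q_function_signed[OF Q sp[OF that]]]) auto
      moreover have "Pair (fst p) -` E \<union> (space M - Pair (fst p) -` E) = space M"
        using sets.sets_into_space[OF E] by auto
      ultimately show ?thesis unfolding eq by simp
    qed
    then show ?case using compl(2) qm[of "space M"] by (simp cong: measurable_cong)
  next
    case (union A)
    have sums: "(\<lambda>i. q (fst p) (snd p) (Pair (fst p) -` A i)) sums q (fst p) (snd p) (Pair (fst p) -` (\<Union>i. A i))"
      if "p \<in> space ?S" for p
    proof -
      have "range (\<lambda>i. Pair (fst p) -` A i) \<subseteq> sets M"
        using sets_Pair1[of _ M M] union(2) by (auto simp: sets_pair_measure)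
      moreover have "disjoint_family (\<lambda>i. Pair (fst p) -` A i)"
        using union(1) by (auto simp: disjoint_family_on_def)
      ultimately show ?thesis
        using Q_function_signed[OF Q sp[OF that]] unfolding finite_signed_measure_def vimage_UN by simp
    qed
    have "(\<lambda>p. \<Sum>i. q (fst p) (snd p) (Pair (fst p) -` A i)) \<in> borel_measurable ?S"
      using union(3) by (intro borel_measurable_suminf) auto
    moreover have "q (fst p) (snd p) (Pair (fst p) -` (\<Union>i. A i)) = (\<Sum>i. q (fst p) (snd p) (Pair (fst p) -` A i))"
      if "p \<in> space ?S" for p
      by (rule sums_unique[OF sums[OF that]])
    ultimately show ?case by (subst measurable_cong) auto
  qed
qed

text \<open>Rates and kernels vanish outside the time interval, so that all integrals may range over the
  reals.\<close>

definition ext_rate :: "real \<Rightarrow> ereal \<Rightarrow> ('a \<Rightarrow> real \<Rightarrow> 'a set \<Rightarrow> real) \<Rightarrow> 'a \<Rightarrow> real \<Rightarrow> real" where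
  "ext_rate T0 T1 q x t = (if t \<in> time_interval T0 T1 then exit_rate q x t else 0)"

definition ext_kernel ::
    "'a measure \<Rightarrow> real \<Rightarrow> ereal \<Rightarrow> ('a \<Rightarrow> real \<Rightarrow> 'a set \<Rightarrow> real) \<Rightarrow> 'a \<Rightarrow> real \<Rightarrow> 'a measure" where
  "ext_kernel M T0 T1 q x t = (if t \<in> time_interval T0 T1 then jump_measure M q x t else null_measure M)"

lemma time_interval_borel: "time_interval T0 T1 \<in> sets borel"
proof -
  have "{t \<in> space borel. T0 \<le> t \<and> ereal t < T1} \<in> sets borel" by measurable
  then show ?thesis by (simp add: time_interval_def)
qed

lemma time_after_borel: "time_after u T1 \<in> sets borel"
proof -
  have "{t \<in> space borel. u < t \<and> ereal t < T1} \<in> sets borel" by measurable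
  then show ?thesis by (simp add: time_after_def)
qed

lemma measurable_time_extension:
  assumes J: "J \<in> sets borel" and g: "g \<in> borel_measurable (M \<Otimes>\<^sub>M restrict_space borel J)"
  shows "(\<lambda>p. if snd p \<in> J then g p else c) \<in> borel_measurable (M \<Otimes>\<^sub>M (borel :: real measure))"
proof -
  let ?R = "restrict_space (M \<Otimes>\<^sub>M (borel :: real measure)) {p. snd p \<in> J}"
  have J': "{p \<in> space (M \<Otimes>\<^sub>M (borel :: real measure)). snd p \<in> J} \<in> sets (M \<Otimes>\<^sub>M borel)" using J by measurable
  have "snd \<in> ?R \<rightarrow>\<^sub>M restrict_space borel J"
    by (intro measurable_restrict_space2 measurable_restrict_space1 measurable_snd)
       (auto simp: space_restrict_space)
  then have "(\<lambda>p. (fst p, snd p)) \<in> ?R \<rightarrow>\<^sub>M M \<Otimes>\<^sub>M restrict_space borel J"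
    by (rule measurable_Pair[OF measurable_restrict_space1[OF measurable_fst]])
  from measurable_compose[OF this g] show ?thesis
    by (simp add: measurable_If_restrict_space_iff[OF J'])
qed

locale bounded_Q =
  fixes M :: "'a measure" and T0 :: real and T1 :: ereal and q :: "'a \<Rightarrow> real \<Rightarrow> 'a set \<Rightarrow> real"
  assumes standard_borel: "standard_borel M"
    and Q_function: "Q_function M T0 T1 q"
    and conservative: "conservative M T0 T1 q"
    and exit_rate_bdd: "\<And>x. x \<in> space M \<Longrightarrow> bdd_above ((\<lambda>t. exit_rate q x t) ` time_interval T0 T1)"
begin

lemma q_nonneg: "x \<in> space M \<Longrightarrow> t \<in> time_interval T0 T1 \<Longrightarrow> B \<in> sets M \<Longrightarrow> 0 \<le> q x t (B - {x})"
  using Q_function by (simp add: Q_function_def)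

lemma emeasure_jump_measure:
  assumes x: "x \<in> space M" and t: "t \<in> time_interval T0 T1" and B: "B \<in> sets M"
  shows "emeasure (jump_measure M q x t) B = ennreal (q x t (B - {x}))"
  unfolding jump_measure_def
proof (rule emeasure_measure_of_sigma)
  note s = Q_function_signed[OF Q_function x t, unfolded finite_signed_measure_def]
  have sx: "{x} \<in> sets M" by (rule standard_borel_singleton[OF standard_borel x])
  show "positive (sets M) (\<lambda>B. ennreal (q x t (B - {x})))" using s by (simp add: positive_def)
  show "countably_additive (sets M) (\<lambda>B. ennreal (q x t (B - {x})))"
  proof (rule countably_additiveI)
    fix A :: "nat \<Rightarrow> 'a set" assume A: "range A \<subseteq> sets M" "disjoint_family A"
    have r: "range (\<lambda>i. A i - {x}) \<subseteq> sets M" using A(1) sx by auto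
    have d: "disjoint_family (\<lambda>i. A i - {x})" using A(2) by (auto simp: disjoint_family_on_def)
    have "(\<lambda>i. q x t (A i - {x})) sums q x t (\<Union>i. A i - {x})"
      by (rule conjunct2[OF s, rule_format, OF r d])
    moreover have "0 \<le> q x t (A i - {x})" for i
      using A(1) by (intro q_nonneg x t) auto
    ultimately have "(\<Sum>i. ennreal (q x t (A i - {x}))) = ennreal (q x t (\<Union>i. A i - {x}))"
      by (intro suminf_ennreal_eq)
    also have "(\<Union>i. A i - {x}) = (\<Union>i. A i) - {x}" by auto
    finally show "(\<Sum>i. ennreal (q x t (A i - {x}))) = ennreal (q x t ((\<Union>i. A i) - {x}))" .
  qed
qed (use B sets.sigma_algebra_axioms in auto)

text \<open>Conservativity: the masses of \<open>{x}\<close> and of its complement cancel. This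
  gives nonnegative rates and identifies them with the total mass of the jump measure.\<close>

lemma exit_rate_eq:
  assumes x: "x \<in> space M" and t: "t \<in> time_interval T0 T1"
  shows "exit_rate q x t = q x t (space M - {x})"
proof -
  have sx: "{x} \<in> sets M" by (rule standard_borel_singleton[OF standard_borel x])
  have "q x t ({x} \<union> (space M - {x})) = q x t {x} + q x t (space M - {x})"
    using sx by (intro finite_signed_measure_Un[OF Q_function_signed[OF Q_function x t]]) auto
  moreover have "{x} \<union> (space M - {x}) = space M" using x by auto
  ultimately show ?thesis using conservative x t by (simp add: conservative_def exit_rate_def)
qed

lemma exit_rate_nonneg: "x \<in> space M \<Longrightarrow> t \<in> time_interval T0 T1 \<Longrightarrow> 0 \<le> exit_rate q x t"
  using exit_rate_eq q_nonneg by simp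

lemma emeasure_ext_kernel:
  assumes "x \<in> space M" "B \<in> sets M"
  shows "emeasure (ext_kernel M T0 T1 q x t) B =
    ennreal (if t \<in> time_interval T0 T1 then q x t (B - {x}) else 0)"
  using assms by (simp add: ext_kernel_def emeasure_jump_measure)

sublocale jump_kernel M "ext_rate T0 T1 q" "ext_kernel M T0 T1 q"
proof
  let ?S = "M \<Otimes>\<^sub>M restrict_space borel (time_interval T0 T1)"
  let ?D = "{p \<in> space (M \<Otimes>\<^sub>M M). fst p = snd p}"
  have sp: "fst p \<in> space M" "snd p \<in> time_interval T0 T1" if "p \<in> space ?S" for p
    using that by (auto simp: space_pair_measure space_restrict_space)
  \<comment> \<open>The singleton \<open>{x}\<close> is the section of the diagonal at
    \<open>x\<close>; further below \<open>B - {x}\<close> is the section of a strip without the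
    diagonal.\<close>
  have "(\<lambda>p. q (fst p) (snd p) (Pair (fst p) -` ?D)) \<in> borel_measurable ?S"
    by (rule Q_function_section_measurable[OF Q_function standard_borel_diagonal[OF standard_borel]])
  then have "(\<lambda>p. - q (fst p) (snd p) (Pair (fst p) -` ?D)) \<in> borel_measurable ?S"
    by (rule borel_measurable_uminus)
  moreover have "Pair x -` ?D = {x}" if "x \<in> space M" for x
    using that by (auto simp: space_pair_measure)
  ultimately have "(\<lambda>p. exit_rate q (fst p) (snd p)) \<in> borel_measurable ?S"
    using sp by (simp add: exit_rate_def cong: measurable_cong)
  from measurable_time_extension[OF time_interval_borel this, of 0]
  show "(\<lambda>(x, t). ext_rate T0 T1 q x t) \<in> borel_measurable (M \<Otimes>\<^sub>M borel)"
    by (simp add: ext_rate_def case_prod_unfold)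
  show "0 \<le> ext_rate T0 T1 q x t" if "x \<in> space M" for x t
    using exit_rate_nonneg[OF that] by (simp add: ext_rate_def)
  show "\<exists>c. \<forall>t. ext_rate T0 T1 q x t \<le> c" if x: "x \<in> space M" for x
  proof -
    obtain c where c: "\<forall>t\<in>time_interval T0 T1. exit_rate q x t \<le> c"
      using exit_rate_bdd[OF x] unfolding bdd_above_def by auto
    show ?thesis using c by (intro exI[of _ "max c 0"]) (auto simp: ext_rate_def intro: max.coboundedI1)
  qed
  show "sets (ext_kernel M T0 T1 q x t) = sets M" for x t
    by (simp add: ext_kernel_def jump_measure_def)
  show "(\<lambda>(x, t). emeasure (ext_kernel M T0 T1 q x t) B) \<in> borel_measurable (M \<Otimes>\<^sub>M borel)" if B: "B \<in> sets M" for B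
  proof -
    have "space M \<times> B - ?D \<in> sets (M \<Otimes>\<^sub>M M)"
      by (intro sets.Diff standard_borel_diagonal[OF standard_borel] pair_measureI B sets.top)
    from Q_function_section_measurable[OF Q_function this]
    have "(\<lambda>p. q (fst p) (snd p) (Pair (fst p) -` (space M \<times> B - ?D))) \<in> borel_measurable ?S" .
    moreover have "Pair x -` (space M \<times> B - ?D) = B - {x}" if "x \<in> space M" for x
      using that sets.sets_into_space[OF B] by (auto simp: space_pair_measure)
    ultimately have "(\<lambda>p. q (fst p) (snd p) (B - {fst p})) \<in> borel_measurable ?S"
      using sp by (simp cong: measurable_cong)
    from measurable_time_extension[OF time_interval_borel this, of 0]
    have "(\<lambda>p. ennreal (if snd p \<in> time_interval T0 T1 then q (fst p) (snd p) (B - {fst p}) else 0)) \<in> borel_measurable (M \<Otimes>\<^sub>M borel)"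
      by (rule measurable_compose[OF _ measurable_ennreal])
    moreover have "emeasure (ext_kernel M T0 T1 q (fst p) (snd p)) B =
        ennreal (if snd p \<in> time_interval T0 T1 then q (fst p) (snd p) (B - {fst p}) else 0)"
      if "p \<in> space (M \<Otimes>\<^sub>M (borel :: real measure))" for p
      using that B by (intro emeasure_ext_kernel) (auto simp: space_pair_measure)
    ultimately show ?thesis unfolding case_prod_unfold by (subst measurable_cong) auto
  qed
  show "emeasure (ext_kernel M T0 T1 q x t) (space M) = ennreal (ext_rate T0 T1 q x t)" if "x \<in> space M" for x t
    using that by (simp add: emeasure_ext_kernel ext_rate_def exit_rate_eq)
qed

lemma exp_exit_rate_eq_survival:
  assumes "u \<in> time_interval T0 T1" "ereal w < T1"
  shows "exp (- (LBINT s:{u..w}. exit_rate q x s)) = survival u w x"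
proof -
  have "s \<in> time_interval T0 T1" if "s \<in> {u..w}" for s
    using that assms by (auto simp: time_interval_def intro: le_less_trans[of _ "ereal w"])
  then have "(LBINT s:{u..w}. exit_rate q x s) = (LBINT s:{u..w}. ext_rate T0 T1 q x s)"
    by (intro set_lebesgue_integral_cong) (auto simp: ext_rate_def)
  then show ?thesis by (simp add: survival_def)
qed

text \<open>All times in the recursion lie between \<open>u\<close> and \<open>t\<close>, inside the
  time interval, where the extended rate and kernel are the original ones.\<close>

lemma P_bar_n_eq:
  "u \<in> time_interval T0 T1 \<Longrightarrow> x \<in> space M \<Longrightarrow> ereal t < T1 \<Longrightarrow>
    P_bar_n M q n u x t B = jumps n u x t (indicator B)"
proof (induction n arbitrary: u x)
  case 0
  then show ?case using exp_exit_rate_eq_survival by simp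
next
  case (Suc n)
  show ?case unfolding P_bar_n.simps(2) jumps.simps(2)
  proof (intro nn_integral_cong)
    fix w :: real
    show "(\<integral>\<^sup>+y. ennreal (exp (- (LBINT s:{u..w}. exit_rate q x s))) * P_bar_n M q n w y t B \<partial>jump_measure M q x w) * indicator {u<..<t} w =
      (\<integral>\<^sup>+y. ennreal (survival u w x) * jumps n w y t (indicator B) \<partial>ext_kernel M T0 T1 q x w) * indicator {u<..<t} w"
    proof (cases "u < w \<and> w < t")
      case True
      have w: "ereal w < T1" using True Suc.prems(3) by (auto intro: less_trans[of _ "ereal t"])
      then have wJ: "w \<in> time_interval T0 T1" using True Suc.prems(1) by (auto simp: time_interval_def)
      then have K: "ext_kernel M T0 T1 q x w = jump_measure M q x w" by (simp add: ext_kernel_def)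
      have "(\<integral>\<^sup>+y. ennreal (survival u w x) * P_bar_n M q n w y t B \<partial>jump_measure M q x w) =
          (\<integral>\<^sup>+y. ennreal (survival u w x) * jumps n w y t (indicator B) \<partial>jump_measure M q x w)"
        using Suc.IH[OF wJ _ Suc.prems(3)] by (intro nn_integral_cong) (simp add: jump_measure_def)
      then show ?thesis using exp_exit_rate_eq_survival[OF Suc.prems(1) w, of x] K by simp
    qed auto
  qed
qed

lemma P_bar_eq:
  assumes "u \<in> time_interval T0 T1" "x \<in> space M" "t \<in> time_after u T1" "B \<in> sets M"
  shows "P_bar M q u x t B = emeasure (transition u x t) B"
  using assms P_bar_n_eq[of u x t] by (simp add: P_bar_def emeasure_transition time_after_def)

text \<open>An upper bound is enough because exit rates are nonnegative; the extension adds only the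
  value 0.\<close>

lemma q_bounded_iff:
  "q_bounded M T0 T1 q B \<longleftrightarrow> B \<in> sets M \<and> (\<exists>c. \<forall>y\<in>B. \<forall>t. ext_rate T0 T1 q y t \<le> c)"
proof
  assume B: "q_bounded M T0 T1 q B"
  then obtain c where c: "\<forall>z\<in>(\<lambda>(x, t). exit_rate q x t) ` (B \<times> time_interval T0 T1). norm z \<le> c"
    unfolding q_bounded_def bounded_iff by blast
  have "ext_rate T0 T1 q y t \<le> max c 0" if "y \<in> B" for y t
  proof (cases "t \<in> time_interval T0 T1")
    case True
    then have "norm (exit_rate q y t) \<le> c" using that by (intro bspec[OF c]) auto
    then show ?thesis using True by (simp add: ext_rate_def)
  qed (simp add: ext_rate_def)
  then show "B \<in> sets M \<and> (\<exists>c. \<forall>y\<in>B. \<forall>t. ext_rate T0 T1 q y t \<le> c)"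
    using B by (auto simp: q_bounded_def)
next
  assume *: "B \<in> sets M \<and> (\<exists>c. \<forall>y\<in>B. \<forall>t. ext_rate T0 T1 q y t \<le> c)"
  then obtain c where B: "B \<in> sets M" and c: "\<forall>y\<in>B. \<forall>t. ext_rate T0 T1 q y t \<le> c" by blast
  have "norm (exit_rate q y t) \<le> c" if "y \<in> B" "t \<in> time_interval T0 T1" for y t
  proof -
    have "ext_rate T0 T1 q y t \<le> c" using c that(1) by blast
    then show ?thesis
      using that exit_rate_nonneg[of y t] sets.sets_into_space[OF B] by (auto simp: ext_rate_def)
  qed
  then show "q_bounded M T0 T1 q B" using B unfolding q_bounded_def bounded_iff by auto
qed

end

section \<open>The forward equation in differential and integrated form, minimality and
  uniqueness\<close>

lemma emeasure_measure_of_measure_space: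
  assumes "measure_space (space M) (sets M) \<mu>" "B \<in> sets M"
  shows "emeasure (measure_of (space M) (sets M) \<mu>) B = \<mu> B"
  using assms by (intro emeasure_measure_of_sigma) (auto simp: measure_space_def)

text \<open>Continuity from below of the measure with density \<open>g\<close>. The denominator
  \<open>n + 2\<close> puts the lower endpoint strictly between \<open>u\<close> and
  \<open>s\<close> already for \<open>n = 0\<close>.\<close>

lemma LIMSEQ_nn_integral_Ioo:
  fixes g :: "real \<Rightarrow> ennreal"
  assumes g: "g \<in> borel_measurable borel" and "u < s"
  shows "(\<lambda>n. \<integral>\<^sup>+v\<in>{u + (s - u) / real (n + 2)<..<s}. g v \<partial>lborel) \<longlonglongrightarrow> (\<integral>\<^sup>+v\<in>{u<..<s}. g v \<partial>lborel)"
proof -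
  define A where "A = (\<lambda>n. {u + (s - u) / real (n + 2)<..<s})"
  have em: "emeasure (density lborel g) B = (\<integral>\<^sup>+v\<in>B. g v \<partial>lborel)" if "B \<in> sets borel" for B
    using g that by (simp add: emeasure_density)
  have "incseq A"
  proof (rule incseq_SucI)
    fix n
    have le: "(s - u) / real (Suc n + 2) \<le> (s - u) / real (n + 2)"
      using \<open>u < s\<close> by (intro divide_left_mono) auto
    show "A n \<subseteq> A (Suc n)"
    proof
      fix v assume "v \<in> A n"
      then have "u + (s - u) / real (n + 2) < v" "v < s" unfolding A_def greaterThanLessThan_iff by auto
      then show "v \<in> A (Suc n)"
        unfolding A_def greaterThanLessThan_iff using le_less_trans[OF add_left_mono[OF le]] by blast
    qed
  qed
  then have "(\<lambda>n. emeasure (density lborel g) (A n)) \<longlonglongrightarrow> emeasure (density lborel g) (\<Union>n. A n)"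
    by (intro Lim_emeasure_incseq) (auto simp: A_def)
  moreover have "(\<Union>n. A n) = {u<..<s}"
  proof (intro antisym subsetI)
    fix v assume "v \<in> (\<Union>n. A n)"
    then obtain n where "u + (s - u) / real (n + 2) < v" "v < s" by (auto simp: A_def)
    moreover have "0 < (s - u) / real (n + 2)" using \<open>u < s\<close> by simp
    ultimately show "v \<in> {u<..<s}" by simp
  next
    fix v assume v: "v \<in> {u<..<s}"
    obtain n :: nat where n: "(s - u) / (v - u) < real n" using reals_Archimedean2 by blast
    have "(s - u) / real (n + 2) < v - u"
    proof -
      have "s - u < real n * (v - u)" using n v by (simp add: pos_divide_less_eq)
      also have "\<dots> \<le> real (n + 2) * (v - u)" using v by (intro mult_right_mono) auto
      finally show ?thesis by (simp add: pos_divide_less_eq mult.commute)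
    qed
    then have "v \<in> A n" using v unfolding A_def by (simp add: less_diff_eq add.commute)
    then show "v \<in> (\<Union>n. A n)" by blast
  qed
  ultimately have "(\<lambda>n. emeasure (density lborel g) (A n)) \<longlonglongrightarrow> emeasure (density lborel g) {u<..<s}" by simp
  then show ?thesis by (subst (asm) (1 2) em) (simp_all add: A_def)
qed

context forward_family
begin

lemma exit_measurable:
  assumes B: "B \<in> sets M"
  shows "(\<lambda>v. \<integral>\<^sup>+y. indicator B y * ennreal (r y v) \<partial>\<kappa> v) \<in> borel_measurable borel"
proof (rule path_measurable_integral)
  show "(\<lambda>(v, y). indicator B y * ennreal (r y v)) \<in> borel_measurable (borel \<Otimes>\<^sub>M M)"
    using indicator_snd_measurable[OF B, of "borel :: real measure"] unfolding case_prod_unfold by measurable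
qed

lemma entrance_measurable:
  assumes B: "B \<in> sets M"
  shows "(\<lambda>v. \<integral>\<^sup>+z. emeasure (K z v) B \<partial>\<kappa> v) \<in> borel_measurable borel"
proof (rule path_measurable_integral)
  have "(\<lambda>p. (snd p, fst p)) \<in> borel \<Otimes>\<^sub>M M \<rightarrow>\<^sub>M M \<Otimes>\<^sub>M (borel :: real measure)" by measurable
  from measurable_compose[OF this kernel_measurable[OF B]]
  show "(\<lambda>(v, z). emeasure (K z v) B) \<in> borel_measurable (borel \<Otimes>\<^sub>M M)"
    by (simp add: case_prod_unfold)
qed

end

context bounded_Q
begin

lemma time_after_in_interval:
  "u \<in> time_interval T0 T1 \<Longrightarrow> t \<in> time_after u T1 \<Longrightarrow> t \<in> time_interval T0 T1"
  by (auto simp: time_interval_def time_after_def)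

text \<open>Translates the Bochner integrals of the definition into nonnegative ones. The exit
  integral is finite because the rate is bounded on \<open>B\<close> and \<open>\<nu>\<close> is
  finite; finiteness of the entrance integral is part of the content.\<close>

lemma forward_equation_at_iff:
  assumes \<nu>: "\<nu> = measure_of (space M) (sets M) (P u x t)" and fin: "finite_measure \<nu>"
    and t: "t \<in> time_interval T0 T1" and B: "q_bounded M T0 T1 q B"
  shows "forward_equation_at M q P u x t B \<longleftrightarrow>
    (\<integral>\<^sup>+z. emeasure (ext_kernel M T0 T1 q z t) B \<partial>\<nu>) < \<infinity> \<and>
    (\<integral>\<^sup>+y. indicator B y * ennreal (ext_rate T0 T1 q y t) \<partial>\<nu>) < \<infinity> \<and>
    ((\<lambda>r. enn2real (P u x r B)) has_real_derivative
      enn2real (\<integral>\<^sup>+z. emeasure (ext_kernel M T0 T1 q z t) B \<partial>\<nu>) -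
      enn2real (\<integral>\<^sup>+y. indicator B y * ennreal (ext_rate T0 T1 q y t) \<partial>\<nu>)) (at t)"
proof -
  interpret finite_measure \<nu> by fact
  obtain c where Bm: "B \<in> sets M" and c: "\<forall>y\<in>B. \<forall>t. ext_rate T0 T1 q y t \<le> c"
    using B unfolding q_bounded_iff by blast
  have s\<nu>: "sets \<nu> = sets M" "space \<nu> = space M" by (simp_all add: \<nu>)
  have rate: "ext_rate T0 T1 q y t = exit_rate q y t" for y using t by (simp add: ext_rate_def)
  have m: "measurable \<nu> N = measurable M N" for N :: "'z measure" by (rule measurable_cong_sets[OF s\<nu>(1) refl])
  have rm: "(\<lambda>y. exit_rate q y t) \<in> borel_measurable M"
    using rate_compose[of "\<lambda>y. y" M "\<lambda>_. t"] by (simp add: rate)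
  have k: "emeasure (ext_kernel M T0 T1 q z t) B = ennreal (q z t (B - {z}))" if "z \<in> space M" for z
    using emeasure_ext_kernel[OF that Bm] t by simp
  have "(\<lambda>z. emeasure (ext_kernel M T0 T1 q z t) B) \<in> borel_measurable M"
    using measurable_compose[OF _ kernel_measurable[OF Bm], of "\<lambda>z. (z, t)" M] by simp
  then have "(\<lambda>z. enn2real (emeasure (ext_kernel M T0 T1 q z t) B)) \<in> borel_measurable M" by measurable
  moreover have "enn2real (emeasure (ext_kernel M T0 T1 q z t) B) = q z t (B - {z})" if "z \<in> space M" for z
    using k[OF that] q_nonneg[OF that t Bm] by simp
  ultimately have qm: "(\<lambda>z. q z t (B - {z})) \<in> borel_measurable M" by (simp cong: measurable_cong)
  have g2: "(\<integral>\<^sup>+z. emeasure (ext_kernel M T0 T1 q z t) B \<partial>\<nu>) = (\<integral>\<^sup>+z. ennreal (q z t (B - {z})) \<partial>\<nu>)"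
    using k by (intro nn_integral_cong) (simp add: s\<nu>)
  have nn2: "AE z in \<nu>. 0 \<le> q z t (B - {z})" using q_nonneg[OF _ t Bm] by (intro AE_I2) (simp add: s\<nu>)
  have int2: "integrable \<nu> (\<lambda>z. q z t (B - {z})) \<longleftrightarrow> (\<integral>\<^sup>+z. emeasure (ext_kernel M T0 T1 q z t) B \<partial>\<nu>) < \<infinity>"
  proof -
    have "(\<integral>\<^sup>+z. ennreal (norm (q z t (B - {z}))) \<partial>\<nu>) = (\<integral>\<^sup>+z. ennreal (q z t (B - {z})) \<partial>\<nu>)"
      using q_nonneg[OF _ t Bm] by (intro nn_integral_cong) (simp add: s\<nu>)
    then show ?thesis unfolding g2 using qm by (simp add: integrable_iff_bounded m)
  qed
  have L2: "(LINT z|\<nu>. q z t (B - {z})) = enn2real (\<integral>\<^sup>+z. emeasure (ext_kernel M T0 T1 q z t) B \<partial>\<nu>)"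
    unfolding g2 using qm nn2 by (intro integral_eq_nn_integral) (simp_all add: m)
  have im: "(\<lambda>y. indicator B y *\<^sub>R exit_rate q y t) \<in> borel_measurable \<nu>"
    unfolding m using rm Bm by measurable
  have nn1: "AE y in \<nu>. 0 \<le> indicator B y *\<^sub>R exit_rate q y t"
    using exit_rate_nonneg[OF _ t] by (intro AE_I2) (simp add: s\<nu>)
  have g1: "(\<integral>\<^sup>+y. indicator B y * ennreal (ext_rate T0 T1 q y t) \<partial>\<nu>) = (\<integral>\<^sup>+y. ennreal (indicator B y *\<^sub>R exit_rate q y t) \<partial>\<nu>)"
    by (intro nn_integral_cong) (auto simp: rate split: split_indicator)
  have fin1: "(\<integral>\<^sup>+y. indicator B y * ennreal (ext_rate T0 T1 q y t) \<partial>\<nu>) < \<infinity>"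
  proof -
    have "(\<integral>\<^sup>+y. indicator B y * ennreal (ext_rate T0 T1 q y t) \<partial>\<nu>) \<le> (\<integral>\<^sup>+y. ennreal c \<partial>\<nu>)"
      using c by (intro nn_integral_mono) (auto split: split_indicator intro!: ennreal_leI)
    also have "\<dots> < \<infinity>"
      unfolding infinity_ennreal_def nn_integral_const ennreal_mult_less_top by (simp add: less_top[symmetric])
    finally show ?thesis .
  qed
  then have int1: "set_integrable \<nu> B (\<lambda>y. exit_rate q y t)"
    unfolding set_integrable_def g1 using im nn1 by (intro integrableI_nonneg) auto
  have L1: "(LINT y:B|\<nu>. exit_rate q y t) = enn2real (\<integral>\<^sup>+y. indicator B y * ennreal (ext_rate T0 T1 q y t) \<partial>\<nu>)"
    unfolding set_lebesgue_integral_def g1 using im nn1 by (intro integral_eq_nn_integral) auto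
  show ?thesis
    unfolding forward_equation_at_def \<nu>[symmetric] Let_def L1 L2 int2 using int1 fin1
    by (simp add: add.commute[of "- _"])
qed

lemma measure_of_P_bar:
  assumes "u \<in> time_interval T0 T1" "x \<in> space M" "t \<in> time_after u T1"
  shows "measure_space (space M) (sets M) (P_bar M q u x t)"
    and "measure_of (space M) (sets M) (P_bar M q u x t) = transition u x t"
proof -
  have s: "sets (transition u x t) = sets M" "space (transition u x t) = space M"
    using sets_transition[OF assms(2)] by (auto dest: sets_eq_imp_space_eq)
  show ms: "measure_space (space M) (sets M) (P_bar M q u x t)"
    unfolding measure_space_def
  proof (intro conjI)
    show "sigma_algebra (space M) (sets M)" by (rule sets.sigma_algebra_axioms)
    show "positive (sets M) (P_bar M q u x t)" by (simp add: positive_def P_bar_eq[OF assms])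
    show "countably_additive (sets M) (P_bar M q u x t)"
    proof (rule countably_additiveI)
      fix A :: "nat \<Rightarrow> 'a set" assume A: "range A \<subseteq> sets M" "disjoint_family A" "(\<Union>i. A i) \<in> sets M"
      then have "(\<Sum>i. emeasure (transition u x t) (A i)) = emeasure (transition u x t) (\<Union>i. A i)"
        using s by (intro suminf_emeasure) auto
      moreover have "P_bar M q u x t (A i) = emeasure (transition u x t) (A i)" for i
        using A(1) by (intro P_bar_eq[OF assms]) auto
      ultimately show "(\<Sum>i. P_bar M q u x t (A i)) = P_bar M q u x t (\<Union>i. A i)"
        by (simp add: P_bar_eq[OF assms A(3)])
    qed
  qed
  show "measure_of (space M) (sets M) (P_bar M q u x t) = transition u x t"
    by (rule measure_eqI) (use s in \<open>auto simp: emeasure_measure_of_measure_space[OF ms] P_bar_eq[OF assms]\<close>)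
qed

lemma P_bar_le_1:
  assumes "u \<in> time_interval T0 T1" "x \<in> space M" "t \<in> time_after u T1" "B \<in> sets M"
  shows "P_bar M q u x t B \<le> 1"
proof -
  have "emeasure (transition u x t) B \<le> emeasure (transition u x t) (space M)"
    using sets.sets_into_space[OF assms(4)] sets_transition[OF assms(2)] by (intro emeasure_mono) auto
  also have "\<dots> \<le> 1" by (rule transition_space_le_1[OF assms(2)])
  finally show ?thesis by (simp add: P_bar_eq[OF assms])
qed

lemma P_bar_in_P_hat: "P_bar M q \<in> P_hat M T0 T1"
  unfolding P_hat_def mem_Collect_eq
proof (intro ballI conjI)
  fix u x assume u: "u \<in> time_interval T0 T1" and x: "x \<in> space M"
  {
    fix t assume t: "t \<in> time_after u T1"
    show "measure_space (space M) (sets M) (P_bar M q u x t)" by (rule measure_of_P_bar[OF u x t])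
    show "P_bar M q u x t B < \<infinity>" if "B \<in> sets M" for B
      using P_bar_le_1[OF u x t that] by (rule le_less_trans) simp
  }
  fix B assume B: "B \<in> sets M"
  have "(\<lambda>t. emeasure (transition u x t) B) \<in> borel_measurable (restrict_space borel (time_after u T1))"
    by (rule measurable_restrict_space1[OF transition_measurable[OF x B]])
  then show "(\<lambda>t. P_bar M q u x t B) \<in> borel_measurable (restrict_space borel (time_after u T1))"
    by (rule measurable_cong[THEN iffD1, rotated]) (simp add: space_restrict_space P_bar_eq[OF u x _ B])
qed

text \<open>With exit rate \<open>g1\<close> and entrance rate \<open>g2\<close>, the integrated
  equation writes \<open>P_bar\<close> as \<open>indicator B x + G2 t - G1 t\<close>; limit,
  absolute continuity and derivative are then those of indefinite integrals.\<close>

lemma P_bar_properties: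
  assumes u: "u \<in> time_interval T0 T1" and x: "x \<in> space M" and B: "q_bounded M T0 T1 q B"
  shows "((\<lambda>t. enn2real (P_bar M q u x t B)) \<longlongrightarrow> indicator B x) (at_right u)"
    and "s \<in> time_after u T1 \<Longrightarrow> absolutely_continuous_on {u<..<s} (\<lambda>t. enn2real (P_bar M q u x t B))"
    and "AE t in lborel. t \<in> time_after u T1 \<longrightarrow> forward_equation_at M q (P_bar M q) u x t B"
proof -
  interpret forward_family M "ext_rate T0 T1 q" "ext_kernel M T0 T1 q" "transition u x"
    by (rule transition_forward_family[OF x])
  obtain c where Bm: "B \<in> sets M" and c: "\<forall>y\<in>B. \<forall>t. ext_rate T0 T1 q y t \<le> c"
    using B unfolding q_bounded_iff by blast
  define g1 where "g1 = (\<lambda>v. \<integral>\<^sup>+y. indicator B y * ennreal (ext_rate T0 T1 q y v) \<partial>transition u x v)"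
  define g2 where "g2 = (\<lambda>v. \<integral>\<^sup>+z. emeasure (ext_kernel M T0 T1 q z v) B \<partial>transition u x v)"
  have g1m: "g1 \<in> borel_measurable borel" and g2m: "g2 \<in> borel_measurable borel"
    unfolding g1_def g2_def by (rule exit_measurable[OF Bm], rule entrance_measurable[OF Bm])
  have eq: "emeasure (transition u x t) B + (\<integral>\<^sup>+v\<in>{u<..<t}. g1 v \<partial>lborel) =
      indicator B x + (\<integral>\<^sup>+v\<in>{u<..<t}. g2 v \<partial>lborel)" if "u < t" for t
    unfolding g1_def g2_def by (rule transition_forward[OF x that Bm])
  have em1: "emeasure (transition u x t) C \<le> 1" if "C \<in> sets M" for t C
    using emeasure_mono[of C "space M" "transition u x t"] sets.sets_into_space[OF that] sets_path
      transition_space_le_1[OF x, of u t] by (auto intro: order_trans)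
  have g1_le: "g1 v \<le> ennreal c" for v
  proof -
    have "g1 v \<le> (\<integral>\<^sup>+y. ennreal c \<partial>transition u x v)"
      unfolding g1_def using c by (intro nn_integral_mono) (auto split: split_indicator intro!: ennreal_leI)
    also have "\<dots> = ennreal c * emeasure (transition u x v) (space M)" by (simp add: space_path)
    also have "\<dots> \<le> ennreal c * 1" by (intro mult_left_mono em1) auto
    finally show ?thesis by simp
  qed
  have fin1: "(\<integral>\<^sup>+v\<in>{u<..<t}. g1 v \<partial>lborel) < \<infinity>" for t
  proof -
    have "(\<integral>\<^sup>+v\<in>{u<..<t}. g1 v \<partial>lborel) \<le> (\<integral>\<^sup>+v\<in>{u<..<t}. ennreal c \<partial>lborel)"
      by (intro nn_integral_mono mult_right_mono g1_le) simp
    also have "\<dots> = ennreal c * emeasure lborel {u<..<t}" by (simp add: nn_integral_cmult_indicator)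
    also have "\<dots> < \<infinity>" by (cases "u \<le> t") (simp_all add: ennreal_mult_less_top)
    finally show ?thesis .
  qed
  \<comment> \<open>Entrances have no direct bound; the equation itself bounds them by the mass at
    time \<open>t\<close> plus the exits.\<close>
  have fin2: "(\<integral>\<^sup>+v\<in>{u<..<t}. g2 v \<partial>lborel) < \<infinity>" for t
  proof (cases "u < t")
    case True
    have "(\<integral>\<^sup>+v\<in>{u<..<t}. g2 v \<partial>lborel) \<le> emeasure (transition u x t) B + (\<integral>\<^sup>+v\<in>{u<..<t}. g1 v \<partial>lborel)"
      unfolding eq[OF True] by simp
    also have "\<dots> < \<infinity>" using le_less_trans[OF em1[OF Bm]] fin1 by simp
    finally show ?thesis .
  qed simp
  define G1 where "G1 = (\<lambda>t. enn2real (\<integral>\<^sup>+v\<in>{u<..<t}. g1 v \<partial>lborel))"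
  define G2 where "G2 = (\<lambda>t. enn2real (\<integral>\<^sup>+v\<in>{u<..<t}. g2 v \<partial>lborel))"
  have real_eq: "enn2real (emeasure (transition u x t) B) = indicator B x + G2 t - G1 t" if "u < t" for t
  proof -
    have "emeasure (transition u x t) B < \<infinity>" using em1[OF Bm] by (rule le_less_trans) simp
    then have "enn2real (emeasure (transition u x t) B) + G1 t = enn2real (indicator B x + (\<integral>\<^sup>+v\<in>{u<..<t}. g2 v \<partial>lborel))"
      unfolding eq[OF that, symmetric] G1_def using fin1[of t] by (simp add: enn2real_plus)
    also have "\<dots> = indicator B x + G2 t"
      unfolding G2_def using fin2[of t] by (simp add: enn2real_plus split: split_indicator)
    finally show ?thesis by simp
  qed
  have P_eq: "enn2real (P_bar M q u x t B) = indicator B x + G2 t - G1 t" if "t \<in> time_after u T1" for t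
    using real_eq[of t] that P_bar_eq[OF u x that Bm] by (simp add: time_after_def)
  have open_after: "open (time_after u T1)"
  proof -
    have "time_after u T1 = {u<..} \<inter> ereal -` {..<T1}" by (auto simp: time_after_def)
    moreover have "open (ereal -` {..<T1})" by (intro open_ereal_vimage) simp
    ultimately show ?thesis by (metis open_Int open_greaterThan)
  qed
  obtain s0 where s0: "u < s0" "ereal s0 < T1"
  proof -
    have "ereal u < T1" using u by (simp add: time_interval_def)
    then show ?thesis using ereal_dense2 that by (metis ereal_less_eq(3) less_le_not_le less_ereal.simps(1))
  qed
  have after: "t \<in> time_after u T1" if "u < t" "t \<le> s" "s \<in> time_after u T1" for t s
    using that by (auto simp: time_after_def intro: le_less_trans[of _ "ereal s"])
  have s0a: "s0 \<in> time_after u T1" using s0 by (simp add: time_after_def)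
  have "((\<lambda>t. indicator B x + G2 t - G1 t) \<longlongrightarrow> indicator B x + 0 - 0) (at_right u)"
    unfolding G1_def G2_def
    by (intro tendsto_intros nn_integral_Ioo_tendsto_0[OF _ s0(1)] g1m g2m fin1 fin2)
  moreover have "\<forall>\<^sub>F t in at_right u. indicator B x + G2 t - G1 t = enn2real (P_bar M q u x t B)"
    unfolding eventually_at_right_field
    using s0(1) P_eq after[OF _ _ s0a] by (intro exI[of _ s0]) auto
  ultimately show "((\<lambda>t. enn2real (P_bar M q u x t B)) \<longlongrightarrow> indicator B x) (at_right u)"
    by (simp add: tendsto_cong)
  show "absolutely_continuous_on {u<..<s} (\<lambda>t. enn2real (P_bar M q u x t B))" if s: "s \<in> time_after u T1"
  proof (rule absolutely_continuous_on_diff)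
    show "absolutely_continuous_on {u<..<s} G2" "absolutely_continuous_on {u<..<s} G1"
      unfolding G1_def G2_def by (intro nn_integral_Ioo_absolutely_continuous g1m g2m fin1 fin2)+
    show "enn2real (P_bar M q u x t B) = indicator B x + G2 t - G1 t" if "t \<in> {u<..<s}" for t
      using that after[OF _ _ s, of t] by (intro P_eq) auto
  qed
  show "AE t in lborel. t \<in> time_after u T1 \<longrightarrow> forward_equation_at M q (P_bar M q) u x t B"
    using nn_integral_Ioo_has_derivative_ae[OF g1m fin1] nn_integral_Ioo_has_derivative_ae[OF g2m fin2]
  proof eventually_elim
    case (elim t)
    show ?case
    proof
      assume t: "t \<in> time_after u T1"
      then have "u < t" by (simp add: time_after_def)
      note d = elim(1)[rule_format, OF this, folded G1_def] elim(2)[rule_format, OF this, folded G2_def]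
      have "((\<lambda>t. indicator B x + G2 t - G1 t) has_real_derivative enn2real (g2 t) - enn2real (g1 t)) (at t)"
        using d by (auto intro!: derivative_eq_intros)
      then have "((\<lambda>t. enn2real (P_bar M q u x t B)) has_real_derivative enn2real (g2 t) - enn2real (g1 t)) (at t)"
        by (rule has_field_derivative_transform_within_open[OF _ open_after t]) (simp add: P_eq)
      then show "forward_equation_at M q (P_bar M q) u x t B"
        unfolding forward_equation_at_iff[where P="P_bar M q" and u=u and x=x, OF measure_of_P_bar(2)[OF u x t, symmetric] finite_transition[OF x]
            time_after_in_interval[OF u t] B]
        using d by (simp add: g1_def g2_def)
    qed
  qed
qed

text \<open>At \<open>u\<close> only a limit is known, so the equation is integrated over
  \<open>[a, s]\<close> with \<open>u < a\<close> and \<open>a\<close> then decreases to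
  \<open>u\<close>. Finite accumulated entrances come out as a by-product and are what the later
  cancellation needs.\<close>

lemma forward_integral_equation:
  assumes P: "P \<in> P_hat M T0 T1" and init: "initial_ac_property M T0 T1 q P"
    and fwd: "forward_equation_property M T0 T1 q P"
    and u: "u \<in> time_interval T0 T1" and x: "x \<in> space M"
    and fam: "forward_family M (ext_rate T0 T1 q) (ext_kernel M T0 T1 q) \<kappa>"
    and \<kappa>: "\<And>v. v \<in> time_after u T1 \<Longrightarrow> \<kappa> v = measure_of (space M) (sets M) (P u x v)"
    and s: "s \<in> time_after u T1" and C: "q_bounded M T0 T1 q C"
  shows "emeasure (\<kappa> s) C + (\<integral>\<^sup>+v\<in>{u<..<s}. (\<integral>\<^sup>+y. indicator C y * ennreal (ext_rate T0 T1 q y v) \<partial>\<kappa> v) \<partial>lborel) =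
      indicator C x + (\<integral>\<^sup>+v\<in>{u<..<s}. (\<integral>\<^sup>+z. emeasure (ext_kernel M T0 T1 q z v) C \<partial>\<kappa> v) \<partial>lborel)" (is ?eq)
    and "(\<integral>\<^sup>+v\<in>{u<..<s}. (\<integral>\<^sup>+z. emeasure (ext_kernel M T0 T1 q z v) C \<partial>\<kappa> v) \<partial>lborel) < \<infinity>" (is ?fin)
proof -
  interpret forward_family M "ext_rate T0 T1 q" "ext_kernel M T0 T1 q" \<kappa> by (rule fam)
  obtain c where Cm: "C \<in> sets M" and c: "\<forall>y\<in>C. \<forall>t. ext_rate T0 T1 q y t \<le> c"
    using C unfolding q_bounded_iff by blast
  have us: "u < s" using s by (simp add: time_after_def)
  define F where "F = (\<lambda>v. enn2real (P u x v C))"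
  have em: "emeasure (\<kappa> v) C = ennreal (F v)" if v: "v \<in> time_after u T1" for v
  proof -
    have "measure_space (space M) (sets M) (P u x v)" "P u x v C < \<infinity>"
      using P u x v Cm unfolding P_hat_def by auto
    then show ?thesis using Cm by (simp add: \<kappa>[OF v] emeasure_measure_of_measure_space F_def)
  qed
  \<comment> \<open>Absolute continuity is assumed on open intervals only; passing to a later time
    puts \<open>s\<close> inside one.\<close>
  obtain s' where s': "s < s'" "ereal s' < T1"
  proof -
    have "ereal s < T1" using s by (simp add: time_after_def)
    then obtain z where "ereal s < ereal z" "ereal z < T1" using ereal_dense2 by blast
    then show ?thesis using that by simp
  qed
  have s'a: "s' \<in> time_after u T1" using s' us by (simp add: time_after_def)
  have after: "v \<in> time_after u T1" if "u < v" "v \<le> s'" for v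
    using that s' by (auto simp: time_after_def intro: le_less_trans[of _ "ereal s'"])
  have ac: "absolutely_continuous_on {u<..<s'} F" and lim: "(F \<longlongrightarrow> indicator C x) (at_right u)"
    using init u x C s'a unfolding initial_ac_property_def F_def by auto
  have cont: "continuous_on {u<..<s'} F"
    by (rule absolutely_continuous_on_imp_continuous_on[OF ac]) auto
  define g1 where "g1 = (\<lambda>v. \<integral>\<^sup>+y. indicator C y * ennreal (ext_rate T0 T1 q y v) \<partial>\<kappa> v)"
  define g2 where "g2 = (\<lambda>v. \<integral>\<^sup>+z. emeasure (ext_kernel M T0 T1 q z v) C \<partial>\<kappa> v)"
  have g1m: "g1 \<in> borel_measurable borel" and g2m: "g2 \<in> borel_measurable borel"
    unfolding g1_def g2_def by (rule exit_measurable[OF Cm], rule entrance_measurable[OF Cm])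
  \<comment> \<open>A competitor may have mass above 1. Near \<open>u\<close> its value on
    \<open>C\<close> is controlled by the limit, on the remaining compact interval by
    continuity.\<close>
  obtain L where L: "\<And>v. u < v \<Longrightarrow> v \<le> s \<Longrightarrow> F v \<le> L"
  proof -
    have "\<forall>\<^sub>F v in at_right u. F v < indicator C x + 1"
      by (rule order_tendstoD(2)[OF lim]) simp
    then obtain a where a: "u < a" "\<And>v. u < v \<Longrightarrow> v < a \<Longrightarrow> F v < indicator C x + 1"
      unfolding eventually_at_right_field by auto
    have "compact (F ` {a..s})"
      using cont a(1) s'(1) by (intro compact_continuous_image continuous_on_subset[OF cont]) auto
    then have "bdd_above (F ` {a..s})" by (intro bounded_imp_bdd_above compact_imp_bounded)
    then obtain L0 where L0: "\<forall>v\<in>{a..s}. F v \<le> L0" unfolding bdd_above_def by auto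
    show ?thesis
    proof (rule that)
      fix v assume "u < v" "v \<le> s"
      then show "F v \<le> max (indicator C x + 1) L0"
        using a(2)[of v] bspec[OF L0, of v] by (cases "v < a") auto
    qed
  qed
  have g1_le: "g1 v \<le> ennreal c * ennreal L" if "u < v" "v \<le> s" for v
  proof -
    have "g1 v \<le> (\<integral>\<^sup>+y. ennreal c * indicator C y \<partial>\<kappa> v)"
      unfolding g1_def using c by (intro nn_integral_mono) (auto split: split_indicator intro!: ennreal_leI)
    also have "\<dots> = ennreal c * emeasure (\<kappa> v) C" using Cm sets_path by (intro nn_integral_cmult_indicator) simp
    also have "\<dots> \<le> ennreal c * ennreal L"
      using that s'(1) L[OF that] by (subst em) (auto intro!: mult_left_mono ennreal_leI after)
    finally show ?thesis .
  qed
  have fin1: "(\<integral>\<^sup>+v\<in>{u<..<s}. g1 v \<partial>lborel) < \<infinity>"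
  proof -
    have "(\<integral>\<^sup>+v\<in>{u<..<s}. g1 v \<partial>lborel) \<le> (\<integral>\<^sup>+v\<in>{u<..<s}. ennreal c * ennreal L \<partial>lborel)"
      using g1_le by (intro nn_integral_mono) (auto split: split_indicator)
    also have "\<dots> = ennreal c * ennreal L * emeasure lborel {u<..<s}" by (intro nn_integral_cmult_indicator) simp
    also have "\<dots> < \<infinity>" using us by (simp add: ennreal_mult_less_top)
    finally show ?thesis .
  qed
  have ae: "AE v in lborel. u < v \<and> v < s \<longrightarrow> g1 v < \<infinity> \<and> g2 v < \<infinity> \<and>
      (F has_real_derivative enn2real (g2 v) - enn2real (g1 v)) (at v)"
  proof -
    have "AE v in lborel. v \<in> time_after u T1 \<longrightarrow> forward_equation_at M q P u x v C"
      using fwd u x C unfolding forward_equation_property_def by auto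
    then show ?thesis
    proof eventually_elim
      case (elim v)
      show ?case
      proof
        assume v: "u < v \<and> v < s"
        then have va: "v \<in> time_after u T1" using s'(1) by (intro after) auto
        from elim[rule_format, OF va]
        show "g1 v < \<infinity> \<and> g2 v < \<infinity> \<and> (F has_real_derivative enn2real (g2 v) - enn2real (g1 v)) (at v)"
          unfolding forward_equation_at_iff[where P=P and u=u and x=x, OF \<kappa>[OF va] finite_path time_after_in_interval[OF u va] C]
            g1_def g2_def F_def by blast
      qed
    qed
  qed
  have step: "ennreal (F a) + (\<integral>\<^sup>+v\<in>{a<..<s}. g2 v \<partial>lborel) = ennreal (F s) + (\<integral>\<^sup>+v\<in>{a<..<s}. g1 v \<partial>lborel)"
    if "u < a" "a < s" for a
  proof (rule nn_integral_derivative_diff)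
    show "absolutely_continuous_on {a..s} F"
      using that s'(1) by (intro absolutely_continuous_on_subset[OF ac]) auto
    show "(\<integral>\<^sup>+v\<in>{a<..<s}. g1 v \<partial>lborel) < \<infinity>"
      by (rule le_less_trans[OF nn_integral_mono fin1]) (use that in \<open>auto split: split_indicator\<close>)
    show "AE t in lborel. a < t \<and> t < s \<longrightarrow> g1 t < \<infinity> \<and> g2 t < \<infinity> \<and>
      (F has_real_derivative enn2real (g2 t) - enn2real (g1 t)) (at t)"
      using ae by eventually_elim (use that in auto)
  qed (use that g1m g2m in \<open>auto simp: F_def\<close>)
  define a where "a = (\<lambda>n. u + (s - u) / real (n + 2))"
  have a_bounds: "u < a n" "a n < s" for n
  proof -
    have "(s - u) / real (n + 2) < (s - u) / 1" using us by (intro divide_strict_left_mono) auto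
    then show "a n < s" by (simp add: a_def)
  qed (use us in \<open>simp add: a_def\<close>)
  have "a \<longlonglongrightarrow> u + 0"
    unfolding a_def by (intro tendsto_add tendsto_const LIMSEQ_ignore_initial_segment lim_const_over_n)
  then have "filterlim a (at_right u) sequentially"
    using a_bounds by (auto simp: filterlim_at intro!: always_eventually less_imp_neq[symmetric])
  then have "(\<lambda>n. F (a n)) \<longlonglongrightarrow> indicator C x"
    by (rule filterlim_compose[OF lim])
  then have "(\<lambda>n. ennreal (F (a n)) + (\<integral>\<^sup>+v\<in>{a n<..<s}. g2 v \<partial>lborel)) \<longlonglongrightarrow> ennreal (indicator C x) + (\<integral>\<^sup>+v\<in>{u<..<s}. g2 v \<partial>lborel)"
    unfolding a_def by (intro tendsto_add tendsto_ennrealI LIMSEQ_nn_integral_Ioo g2m us)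
  moreover have "(\<lambda>n. ennreal (F s) + (\<integral>\<^sup>+v\<in>{a n<..<s}. g1 v \<partial>lborel)) \<longlonglongrightarrow> ennreal (F s) + (\<integral>\<^sup>+v\<in>{u<..<s}. g1 v \<partial>lborel)"
    unfolding a_def by (intro tendsto_add tendsto_const LIMSEQ_nn_integral_Ioo g1m us)
  ultimately have lim_eq: "ennreal (indicator C x) + (\<integral>\<^sup>+v\<in>{u<..<s}. g2 v \<partial>lborel) = ennreal (F s) + (\<integral>\<^sup>+v\<in>{u<..<s}. g1 v \<partial>lborel)"
    unfolding step[OF a_bounds] by (rule LIMSEQ_unique)
  then show ?eq
    unfolding em[OF s] g1_def g2_def by (simp add: ennreal_indicator)
  have "(\<integral>\<^sup>+v\<in>{u<..<s}. g2 v \<partial>lborel) \<le> ennreal (F s) + (\<integral>\<^sup>+v\<in>{u<..<s}. g1 v \<partial>lborel)"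
    unfolding lim_eq[symmetric] by simp
  also have "\<dots> < \<infinity>" using fin1 by simp
  finally show ?fin unfolding g2_def .
qed

lemma P_bar_minimal:
  assumes P: "P \<in> P_hat M T0 T1" and init: "initial_ac_property M T0 T1 q P"
    and fwd: "forward_equation_property M T0 T1 q P"
  shows "transition_le M T0 T1 (P_bar M q) P"
  unfolding transition_le_def
proof (intro ballI)
  fix u x t B
  assume u: "u \<in> time_interval T0 T1" and x: "x \<in> space M" and t: "t \<in> time_after u T1" and B: "B \<in> sets M"
  \<comment> \<open>The competitor is arbitrary outside its domain; null measures there make
    \<open>\<kappa>\<close> measurable and finite on the whole line.\<close>
  define \<kappa> where "\<kappa> = (\<lambda>v. if v \<in> time_after u T1 then measure_of (space M) (sets M) (P u x v) else null_measure M)"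
  have s\<kappa>: "sets (\<kappa> v) = sets M" "space (\<kappa> v) = space M" for v by (simp_all add: \<kappa>_def)
  have em: "emeasure (\<kappa> v) C = (if v \<in> time_after u T1 then P u x v C else 0)" if "C \<in> sets M" for v C
    using P u x that by (auto simp: \<kappa>_def P_hat_def emeasure_measure_of_measure_space)
  have fam: "forward_family M (ext_rate T0 T1 q) (ext_kernel M T0 T1 q) \<kappa>"
  proof (intro forward_family.intro forward_family_axioms.intro jump_kernel_axioms)
    show "sets (\<kappa> v) = sets M" for v by (rule s\<kappa>)
    show "finite_measure (\<kappa> v)" for v
      using P u x by (intro finite_measureI) (auto simp: s\<kappa> em P_hat_def less_top)
    show "(\<lambda>v. emeasure (\<kappa> v) C) \<in> borel_measurable borel" if C: "C \<in> sets M" for C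
    proof -
      have "{v \<in> space borel. v \<in> time_after u T1} \<in> sets borel" using time_after_borel by simp
      moreover have "(\<lambda>v. P u x v C) \<in> borel_measurable (restrict_space borel (time_after u T1))"
        using P u x C by (simp add: P_hat_def)
      ultimately show ?thesis unfolding em[OF C]
        by (simp add: measurable_If_restrict_space_iff)
    qed
  qed
  interpret forward_family M "ext_rate T0 T1 q" "ext_kernel M T0 T1 q" \<kappa> by (rule fam)
  have \<kappa>eq: "\<kappa> v = measure_of (space M) (sets M) (P u x v)" if "v \<in> time_after u T1" for v
    using that by (simp add: \<kappa>_def)
  have after: "s \<in> time_after u T1" if "u < s" "s \<le> t" for s
    using that t by (auto simp: time_after_def intro: le_less_trans[of _ "ereal t"])
  have J: "jump_int u s (\<lambda>v. indicator C) = (\<integral>\<^sup>+v\<in>{u<..<s}. (\<integral>\<^sup>+z. emeasure (ext_kernel M T0 T1 q z v) C \<partial>\<kappa> v) \<partial>lborel)"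
    if "C \<in> sets M" for s C
    unfolding jump_int_def using that
    by (intro nn_integral_cong arg_cong2[where f="(*)"] refl) (simp add: space_path sets_kernel)
  have last: "emeasure (\<kappa> s) C = indicator C x * ennreal (survival u s x) +
        jump_int u s (\<lambda>v y. ennreal (survival v s y) * indicator C y)"
    if s: "u < s" "s \<le> t" and C: "C \<in> sets M" "\<exists>c. \<forall>y\<in>C. \<forall>s. ext_rate T0 T1 q y s \<le> c" for s C
  proof (rule last_jump_of_forward[OF x s(1) C(1)])
    have bdd: "q_bounded M T0 T1 q D" if "D \<in> sets M" "D \<subseteq> C" for D
      unfolding q_bounded_iff using C(2) that by blast
    note eq = forward_integral_equation[OF P init fwd u x fam \<kappa>eq]
    show "emeasure (\<kappa> s') D + path_int u s' (\<lambda>v y. indicator D y * ennreal (ext_rate T0 T1 q y v)) =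
        indicator D x + jump_int u s' (\<lambda>v y. indicator D y)"
      if "u < s'" "s' \<le> s" "D \<in> sets M" "D \<subseteq> C" for s' D
      using eq(1)[OF _ after bdd, of s' D] that s(2) by (simp add: J path_int_def)
    show "jump_int u s (\<lambda>v y. indicator C y) < \<infinity>"
      using eq(2)[OF _ after[OF s] bdd[OF C(1) order_refl]] by (simp add: J[OF C(1)])
  qed
  have "u < t" using t by (simp add: time_after_def)
  have "emeasure (transition u x t) B \<le> emeasure (\<kappa> t) B"
  proof (rule transition_le_path[OF x _ \<open>u < t\<close> B])
    fix s C assume "u < s" "s \<le> t" "C \<in> sets M" "\<exists>c. \<forall>y\<in>C. \<forall>s. ext_rate T0 T1 q y s \<le> c"
    then show "emeasure (\<kappa> s) C = indicator C x * ennreal (survival u s x) +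
        jump_int u s (\<lambda>v y. ennreal (survival v s y) * indicator C y)"
      by (rule last)
  qed
  then show "P_bar M q u x t B \<le> P u x t B"
    using em[OF B, of t] t by (simp add: P_bar_eq[OF u x t B])
qed

lemma P_bar_initial_ac: "initial_ac_property M T0 T1 q (P_bar M q)"
  using P_bar_properties unfolding initial_ac_property_def by blast

lemma P_bar_forward: "forward_equation_property M T0 T1 q (P_bar M q)"
  using P_bar_properties(3) unfolding forward_equation_property_def by blast

text \<open>By minimality \<open>P\<close> dominates \<open>P_bar\<close> on \<open>B\<close> and on
  its complement, while its total is at most 1, the total of a regular \<open>P_bar\<close>; neither
  inequality can be strict.\<close>

lemma P_bar_unique:
  assumes reg: "regular_transition M T0 T1 (P_bar M q)"
    and P: "P \<in> P_hat M T0 T1" and init: "initial_ac_property M T0 T1 q P"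
    and fwd: "forward_equation_property M T0 T1 q P"
    and le1: "\<forall>u\<in>time_interval T0 T1. \<forall>x\<in>space M. \<forall>t\<in>time_after u T1. \<forall>B\<in>sets M. P u x t B \<in> {0..1}"
  shows "transition_eq M T0 T1 P (P_bar M q)"
  unfolding transition_eq_def
proof (intro ballI)
  fix u x t B
  assume u: "u \<in> time_interval T0 T1" and x: "x \<in> space M" and t: "t \<in> time_after u T1" and B: "B \<in> sets M"
  have le: "P_bar M q u x t C \<le> P u x t C" if "C \<in> sets M" for C
    using P_bar_minimal[OF P init fwd] u x t that unfolding transition_le_def by blast
  define \<nu> where "\<nu> = measure_of (space M) (sets M) (P u x t)"
  have ms: "measure_space (space M) (sets M) (P u x t)" using P u x t by (simp add: P_hat_def)
  have em: "emeasure \<nu> C = P u x t C" if "C \<in> sets M" for C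
    unfolding \<nu>_def by (rule emeasure_measure_of_measure_space[OF ms that])
  have s\<nu>: "sets \<nu> = sets M" by (simp add: \<nu>_def)
  have sum: "P u x t B + P u x t (space M - B) = P u x t (space M)"
    using plus_emeasure[of B \<nu> "space M - B"] B em s\<nu> sets.sets_into_space[OF B]
    by (simp add: Un_absorb1)
  have sum': "P_bar M q u x t B + P_bar M q u x t (space M - B) = P_bar M q u x t (space M)"
    using plus_emeasure[of B "transition u x t" "space M - B"] B sets_transition[OF x] sets.sets_into_space[OF B]
    by (simp add: P_bar_eq[OF u x t] Un_absorb1)
  have bar1: "P_bar M q u x t (space M) = 1" using reg u x t by (simp add: regular_transition_def)
  have "P u x t (space M) \<le> 1" using le1 u x t by auto
  then have tot: "P u x t B + P u x t (space M - B) \<le> P_bar M q u x t B + P_bar M q u x t (space M - B)"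
    unfolding sum sum' bar1 .
  have "P u x t B + P_bar M q u x t (space M - B) \<le> P u x t B + P u x t (space M - B)"
    using B by (intro add_left_mono le) auto
  also note tot
  finally have "P_bar M q u x t (space M - B) + P u x t B \<le> P_bar M q u x t (space M - B) + P_bar M q u x t B"
    by (simp only: add.commute)
  moreover have "P_bar M q u x t (space M - B) \<noteq> \<infinity>"
    using P_bar_le_1[OF u x t, of "space M - B"] B by (auto simp: top_unique)
  ultimately have "P u x t B \<le> P_bar M q u x t B" by (simp add: ennreal_add_left_cancel_le)
  then show "P u x t B = P_bar M q u x t B" using le[OF B] by (rule antisym)
qed

end

theorem corollary5:
  fixes M :: "'a measure" and T0 :: real and T1 :: ereal
    and q :: "'a \<Rightarrow> real \<Rightarrow> 'a set \<Rightarrow> real"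
  assumes "standard_borel M"
    and "0 \<le> T0" and "ereal T0 < T1"
    and "Q_function M T0 T1 q"
    and "conservative M T0 T1 q"
    and "\<And>x. x \<in> space M \<Longrightarrow> bdd_above ((\<lambda>t. exit_rate q x t) ` time_interval T0 T1)"
  shows "minimal_transition M T0 T1
           {P \<in> P_hat M T0 T1. initial_ac_property M T0 T1 q P \<and>
                               forward_equation_property M T0 T1 q P}
           (P_bar M q)
       \<and> (regular_transition M T0 T1 (P_bar M q) \<longrightarrow>
          unique_transition M T0 T1
            {P \<in> P_hat M T0 T1.
               (\<forall>u\<in>time_interval T0 T1. \<forall>x\<in>space M. \<forall>t\<in>time_after u T1. \<forall>B\<in>sets M.
                  P u x t B \<in> {0..1}) \<and>
               initial_ac_property M T0 T1 q P \<and> forward_equation_property M T0 T1 q P}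
            (P_bar M q))"
proof -
  interpret bounded_Q M T0 T1 q by unfold_locales fact+
  show ?thesis
    unfolding minimal_transition_def unique_transition_def
    using P_bar_in_P_hat P_bar_initial_ac P_bar_forward P_bar_minimal P_bar_unique P_bar_le_1 by auto
qed

end
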